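(* Let $\mathbf{T}=(T_t\colon t\ge 0)$ be a subordinator with the Laplace exponent $\phi$. Suppose that $\phi\in\mathrm{WLSC}(\alpha,c,x_0)\cap\mathrm{WUSC}(\beta,C,x_0)$ for some $c\in(0,1]$, $C\ge 1$, $x_0\ge 0$, and $0<\alpha\le\beta<1$. Assume also that $b=0$ and that the Lévy measure $\nu(\mathrm{d}x)$ has an almost monotone density $\nu(x)$. Then there is $x_1\in(0,\infty]$ such that for all $t\in(0,1/\varphi(x_0))$ and $x\in(0,x_1)$, $$p(t,x)\approx\begin{cases}\big(t(-\phi''(w))\big)^{-\frac12}\exp\big\{-t\big(\phi(w)-w\phi'(w)\big)\big\} & \text{if } 0<x\phi^{-1}(1/t)\le 1,\\[2pt] t x^{-1}\phi(1/x) & \text{if } 1<x\phi^{-1}(1/t),\end{cases}$$ where $w=(\phi')^{-1}(x/t)$ and $p(t,\cdot)$ is the density of $T_t$. If $x_0=0$ then $x_1=\infty$.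
   Context: A subordinator is a one-dimensional Lévy process $\mathbf{T}=(T_t\colon t\ge 0)$ with $T_0=0$ and nondecreasing paths. Its Laplace exponent $\phi\colon[0,\infty)\to[0,\infty)$ is defined by $\mathbb{E}\,e^{-\lambda T_t}=e^{-t\phi(\lambda)}$, and $\phi(\lambda)=b\lambda+\int_{(0,\infty)}(1-e^{-\lambda s})\,\nu(\mathrm{d}s)$, where $b\ge 0$ and $\nu$ (the Lévy measure) satisfies $\int_{(0,\infty)}\min\{1,s\}\,\nu(\mathrm{d}s)<\infty$. It is assumed that $\phi''\not\equiv 0$. Under the hypotheses of the claim $T_t$ has a density for every $t>0$, and $p(t,\cdot)$ denotes its continuous version. For $\tau\in\mathbb{R}$, $x_0\ge 0$, a nonnegative function $f$ on $(0,\infty)$ belongs to $\mathrm{WLSC}(\tau,c,x_0)$, $c\in(0,1]$, if $f(\lambda x)\ge c\lambda^{\tau}f(x)$ for all $\lambda\ge 1$ and $x>x_0$; it belongs to $\mathrm{WUSC}(\tau,C,x_0)$, $C\ge1$, if $f(\lambda x)\le C\lambda^{\tau}f(x)$ for all $\lambda\ge1$ and $x>x_0$. A function $f\ge0$ on $(0,\infty)$ is almost increasing if $cf(x)\le f(y)$ for all $y\ge x>0$ and some $c\in(0,1]$; almost decreasing if $Cf(x)\ge f(y)$ for all $y\ge x>0$ and some $C\ge1$; almost monotone means one of the two. Notation: $\varphi(x)=x^2(-\phi''(x))$ for $x>0$; $\phi^{-1}$ and $(\phi')^{-1}$ are the inverse functions of the strictly increasing $\phi$ and strictly decreasing $\phi'$;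 $F\approx G$ on a set means $C^{-1}F\le G\le CF$ on that set for some constant $C\ge1$ (uniformly in $t$ and $x$). Convention when $x_0=0$: $\varphi(x_0)=0$ and $1/\varphi(x_0)=\infty$. *)

theory Defs
  imports "HOL-Probability.Probability"
begin

text \<open>
  A process is a family \<open>T :: real \<Rightarrow> 'w \<Rightarrow> real\<close> of which only the
  times \<open>t \<ge> 0\<close> matter.
\<close>

definition levy_process :: "'w measure \<Rightarrow> (real \<Rightarrow> 'w \<Rightarrow> real) \<Rightarrow> bool" where
  "levy_process M T \<longleftrightarrow>
     prob_space M \<and>
     (\<forall>t\<ge>0. T t \<in> borel_measurable M) \<and>
     (AE \<omega> in M. T 0 \<omega> = 0) \<and>
     (\<forall>n. \<forall>s :: nat \<Rightarrow> real. 0 \<le> s 0 \<longrightarrow> mono_on {..n} s \<longrightarrow>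
        prob_space.indep_vars M (\<lambda>_. borel) (\<lambda>k \<omega>. T (s (Suc k)) \<omega> - T (s k) \<omega>) {..<n}) \<and>
     (\<forall>s\<ge>0. \<forall>t\<ge>0. distr M borel (\<lambda>\<omega>. T (s + t) \<omega> - T s \<omega>) = distr M borel (T t)) \<and>
     (AE \<omega> in M. (\<forall>t\<ge>0. continuous (at_right t) (\<lambda>u. T u \<omega>)) \<and>
                  (\<forall>t>0. \<exists>l. ((\<lambda>u. T u \<omega>) \<longlongrightarrow> l) (at_left t)))"

definition subordinator :: "'w measure \<Rightarrow> (real \<Rightarrow> 'w \<Rightarrow> real) \<Rightarrow> bool" where
  "subordinator M T \<longleftrightarrow> levy_process M T \<and> (AE \<omega> in M. mono_on {0..} (\<lambda>t. T t \<omega>))"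

text \<open>
  The Laplace exponent lives on \<open>[0,\<infinity>)\<close>; the values of \<open>\<phi>\<close> at negative
  arguments are left unconstrained, and its derivatives are only used on \<open>(0,\<infinity>)\<close>.
\<close>

definition laplace_exponent ::
    "'w measure \<Rightarrow> (real \<Rightarrow> 'w \<Rightarrow> real) \<Rightarrow> (real \<Rightarrow> real) \<Rightarrow> bool" where
  "laplace_exponent M T \<phi> \<longleftrightarrow>
     (\<forall>l\<ge>0. 0 \<le> \<phi> l) \<and>
     (\<forall>t\<ge>0. \<forall>l\<ge>0. prob_space.expectation M (\<lambda>\<omega>. exp (- l * T t \<omega>)) = exp (- t * \<phi> l))"

text \<open>
  Measures on \<open>(0,\<infinity>)\<close> are encoded as Borel measures on the real line that do not
  charge \<open>(-\<infinity>,0]\<close>.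
\<close>

definition levy_measure :: "real measure \<Rightarrow> bool" where
  "levy_measure \<nu> \<longleftrightarrow>
     sets \<nu> = sets borel \<and> emeasure \<nu> {..0} = 0 \<and>
     (\<integral>\<^sup>+ s\<in>{0<..}. ennreal (min 1 s) \<partial>\<nu>) < \<infinity>"

definition drift_and_levy_measure :: "(real \<Rightarrow> real) \<Rightarrow> real \<Rightarrow> real measure \<Rightarrow> bool" where
  "drift_and_levy_measure \<phi> b \<nu> \<longleftrightarrow>
     0 \<le> b \<and> levy_measure \<nu> \<and>
     (\<forall>l\<ge>0. \<phi> l = b * l + (LINT s:{0<..}|\<nu>. 1 - exp (- l * s)))"

definition has_levy_density :: "real measure \<Rightarrow> (real \<Rightarrow> real) \<Rightarrow> bool" where
  "has_levy_density \<nu> f \<longleftrightarrow>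
     set_borel_measurable borel {0<..} f \<and> (\<forall>x>0. 0 \<le> f x) \<and>
     \<nu> = density lborel (\<lambda>x. indicator {0<..} x * ennreal (f x))"

definition WLSC :: "real \<Rightarrow> real \<Rightarrow> real \<Rightarrow> (real \<Rightarrow> real) set" where
  "WLSC \<tau> c x0 = {f. (\<forall>x>0. 0 \<le> f x) \<and>
     (\<forall>l\<ge>1. \<forall>x>x0. f (l * x) \<ge> c * l powr \<tau> * f x)}"

definition WUSC :: "real \<Rightarrow> real \<Rightarrow> real \<Rightarrow> (real \<Rightarrow> real) set" where
  "WUSC \<tau> C x0 = {f. (\<forall>x>0. 0 \<le> f x) \<and>
     (\<forall>l\<ge>1. \<forall>x>x0. f (l * x) \<le> C * l powr \<tau> * f x)}"

definition almost_increasing :: "(real \<Rightarrow> real) \<Rightarrow> bool" where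
  "almost_increasing f \<longleftrightarrow> (\<forall>x>0. 0 \<le> f x) \<and>
     (\<exists>c. 0 < c \<and> c \<le> 1 \<and> (\<forall>x>0. \<forall>y\<ge>x. c * f x \<le> f y))"

definition almost_decreasing :: "(real \<Rightarrow> real) \<Rightarrow> bool" where
  "almost_decreasing f \<longleftrightarrow> (\<forall>x>0. 0 \<le> f x) \<and>
     (\<exists>C\<ge>1. \<forall>x>0. \<forall>y\<ge>x. C * f x \<ge> f y)"

definition almost_monotone :: "(real \<Rightarrow> real) \<Rightarrow> bool" where
  "almost_monotone f \<longleftrightarrow> almost_increasing f \<or> almost_decreasing f"

text \<open>At \<open>x = 0\<close> this gives \<open>0\<close>, whatever the value of \<open>deriv (deriv \<phi>) 0\<close>.\<close>

definition varphi :: "(real \<Rightarrow> real) \<Rightarrow> real \<Rightarrow> real" where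
  "varphi \<phi> x = x\<^sup>2 * (- deriv (deriv \<phi>) x)"

definition phi_inv :: "(real \<Rightarrow> real) \<Rightarrow> real \<Rightarrow> real" where
  "phi_inv \<phi> = the_inv_into {0..} \<phi>"

definition dphi_inv :: "(real \<Rightarrow> real) \<Rightarrow> real \<Rightarrow> real" where
  "dphi_inv \<phi> = the_inv_into {0<..} (deriv \<phi>)"

text \<open>
  Nonnegativity is required separately because \<open>ennreal\<close> truncates negative values; with
  it, a continuous density is unique.
\<close>

definition continuous_density :: "'w measure \<Rightarrow> ('w \<Rightarrow> real) \<Rightarrow> (real \<Rightarrow> real) \<Rightarrow> bool" where
  "continuous_density M X f \<longleftrightarrow>
     (\<forall>x. 0 \<le> f x) \<and> continuous_on UNIV f \<and> distributed M lborel X (\<lambda>x. ennreal (f x))"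

definition comparable_on :: "'a set \<Rightarrow> ('a \<Rightarrow> real) \<Rightarrow> ('a \<Rightarrow> real) \<Rightarrow> bool" where
  "comparable_on S F G \<longleftrightarrow>
     (\<exists>C\<ge>1. \<forall>z\<in>S. inverse C * F z \<le> G z \<and> G z \<le> C * F z)"

end

theory Submission
  imports Defs "HOL-Complex_Analysis.Conformal_Mappings"
begin

text \<open>
  By the scaling conditions \<open>\<phi> x\<close>, \<open>x * \<phi>' x\<close> and \<open>- x\<^sup>2 * \<phi>'' x\<close> are comparable, and an almost monotone
  Levy density, necessarily almost decreasing, is comparable to \<open>\<phi> (1 / x) / x\<close> near \<open>0\<close>. The law of
  \<open>T t\<close>, tilted by \<open>exp (- w * x)\<close>, has a characteristic function with modulus
  \<open>exp (- t * decay w \<xi>)\<close>, and the lower bound on the Levy density makes the decay strong enough for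
  Fourier inversion. With \<open>w\<close> the saddle point this gives the upper bound for \<open>x * \<phi>\<^sup>-\<^sup>1 (1 / t) \<le> 1\<close> and,
  by comparison with a Gaussian integral, the lower bound when \<open>t * \<phi> w\<close> is large. All remaining
  bounds come from the size bias identity \<open>x * p t x = t * (\<integral> s * \<nu> s * p t (x - s) ds)\<close>: keeping only
  \<open>s \<ge> x / 2\<close> bounds \<open>p t x\<close> from below by the Levy density times a small ball probability, and
  controlling small \<open>s\<close> by a maximum argument bounds it from above.
\<close>

section \<open>Fourier inversion and parameter integrals\<close>

text \<open>The process enters only through the law of each \<open>T t\<close> and its Laplace
  transform. All constants are produced before \<open>P\<close>, \<open>t\<close> and
  \<open>p\<close> are quantified; this uniformity is possible because, once frequencies are
  rescaled by \<open>w\<close>, the Fourier bounds depend only on \<open>y = t * phi w\<close>. The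
  condition \<open>0 < \<alpha>\<close> yields the comparison of \<open>phi\<close> with its first
  derivative, and \<open>\<beta> < 1\<close> the one with the second. The Gaussian comparison needs
  \<open>y \<ge> M0\<close>, whereas the saddle point is only shown to satisfy
  \<open>y \<ge> y0\<close> with \<open>y0 \<le> 1\<close>. In the gap \<open>w * x\<close> is of
  order one, so both forms of the estimate are of the same order and the small ball bound takes
  over. The size bias identity holds for almost every \<open>x\<close> only, so each bound drawn
  from it is stated between continuous functions and then transferred to every point. If
  \<open>x0 > 0\<close>, scaling is available only at frequencies above \<open>x0\<close>; this is
  the source of the thresholds \<open>x0 < a * w\<close> and \<open>x0 < a / x\<close>, which
  accumulate and finally determine \<open>x1\<close>.\<close>

lemma has_field_derivative_integral:
  fixes h :: "'a::{real_normed_field,banach,second_countable_topology} \<Rightarrow> 'b \<Rightarrow> 'a"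
  assumes S: "open S" "convex S" "z0 \<in> S"
    and int: "\<And>z. z \<in> S \<Longrightarrow> integrable M (h z)"
    and der: "\<And>z x. z \<in> S \<Longrightarrow> x \<in> space M \<Longrightarrow> ((\<lambda>z. h z x) has_field_derivative h' z x) (at z)"
    and bound: "\<And>z x. z \<in> S \<Longrightarrow> x \<in> space M \<Longrightarrow> norm (h' z x) \<le> w x"
    and meas: "h' z0 \<in> borel_measurable M"
    and w: "integrable M w"
  shows "((\<lambda>z. \<integral>x. h z x \<partial>M) has_field_derivative (\<integral>x. h' z0 x \<partial>M)) (at z0)"
proof -
  have "((\<lambda>y. ((\<integral>x. h y x \<partial>M) - (\<integral>x. h z0 x \<partial>M)) / (y - z0)) \<longlongrightarrow> (\<integral>x. h' z0 x \<partial>M)) (at z0 within S)"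
    unfolding tendsto_at_iff_sequentially comp_def
  proof (intro allI impI)
    fix X :: "nat \<Rightarrow> 'a" assume X: "\<forall>i. X i \<in> S - {z0}" "X \<longlonglongrightarrow> z0"
    have eq: "((\<integral>x. h (X i) x \<partial>M) - (\<integral>x. h z0 x \<partial>M)) / (X i - z0) = (\<integral>x. (h (X i) x - h z0 x) / (X i - z0) \<partial>M)" for i
    proof -
      have "integrable M (h (X i))" "integrable M (h z0)" using X S int by auto
      then show ?thesis
        by (subst Bochner_Integration.integral_diff[symmetric]) (assumption | simp)+
    qed
    have "(\<lambda>i. \<integral>x. (h (X i) x - h z0 x) / (X i - z0) \<partial>M) \<longlonglongrightarrow> (\<integral>x. h' z0 x \<partial>M)"
    proof (rule integral_dominated_convergence[where w=w])
      show "(\<lambda>x. (h (X i) x - h z0 x) / (X i - z0)) \<in> borel_measurable M" for i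
        using X S int by (intro borel_measurable_divide borel_measurable_diff borel_measurable_const borel_measurable_integrable) auto
      show "AE x in M. (\<lambda>i. (h (X i) x - h z0 x) / (X i - z0)) \<longlonglongrightarrow> h' z0 x"
      proof (rule AE_I2)
        fix x assume "x \<in> space M"
        from der[OF S(3) this] have "((\<lambda>y. (h y x - h z0 x) / (y - z0)) \<longlongrightarrow> h' z0 x) (at z0 within S)"
          unfolding has_field_derivative_iff by (rule tendsto_within_subset) auto
        from this[unfolded tendsto_at_iff_sequentially comp_def, rule_format, of X] X
        show "(\<lambda>i. (h (X i) x - h z0 x) / (X i - z0)) \<longlonglongrightarrow> h' z0 x"
          by blast
      qed
      show "AE x in M. norm ((h (X i) x - h z0 x) / (X i - z0)) \<le> w x" for i
      proof (rule AE_I2)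
        fix x assume x: "x \<in> space M"
        \<comment> \<open>The mean value inequality along segments of the convex set
          \<open>S\<close> turns the bound on the derivative into one for the difference
          quotients.\<close>
        have "norm (h (X i) x - h z0 x) \<le> w x * norm (X i - z0)"
        proof (rule field_differentiable_bound[OF S(2), where f'="\<lambda>z. h' z x"])
          show "((\<lambda>z. h z x) has_field_derivative h' z x) (at z within S)" if "z \<in> S" for z
            using der[OF that x] by (rule has_field_derivative_at_within)
        qed (use X(1) S(3) bound[OF _ x] in auto)
        then show "norm ((h (X i) x - h z0 x) / (X i - z0)) \<le> w x"
          using X(1)[rule_format, of i] by (simp add: norm_divide divide_le_eq)
      qed
    qed (use w meas in auto)
    then show "(\<lambda>i. ((\<integral>x. h (X i) x \<partial>M) - (\<integral>x. h z0 x \<partial>M)) / (X i - z0)) \<longlonglongrightarrow> (\<integral>x. h' z0 x \<partial>M)"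
      by (simp add: eq)
  qed
  then show ?thesis
    unfolding has_field_derivative_iff at_within_open[OF S(3,1)] .
qed

text \<open>Mean value inequality on the convex half plane where \<open>exp\<close> has modulus at
  most \<open>exp m\<close>.\<close>

lemma norm_exp_diff_le:
  fixes a b :: complex
  assumes "Re a \<le> m" "Re b \<le> m"
  shows "norm (exp a - exp b) \<le> exp m * norm (a - b)"
  using assms
  by (intro field_differentiable_bound[where S="{z. Re z \<le> m}" and f'=exp])
     (auto simp: convex_halfspace_Re_le intro: has_field_derivative_at_within DERIV_exp)

text \<open>A strict failure at one point would persist on an interval of positive measure. The
  closed interval matters: the conclusion is later needed at an end point of the interval on which
  the almost everywhere bound is available.\<close>

lemma AE_lborel_le_imp_le:
  fixes F G :: "real \<Rightarrow> real"
  assumes "continuous_on {a..b} F" "continuous_on {a..b} G" "a < b"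
    and ae: "AE x in lborel. x \<in> {a<..<b} \<longrightarrow> F x \<le> G x"
    and x: "x \<in> {a..b}"
  shows "F x \<le> G x"
proof (rule ccontr)
  assume "\<not> F x \<le> G x"
  define D where "D y = F y - G y" for y
  have contD: "continuous_on {a..b} D"
    unfolding D_def by (intro continuous_intros assms)
  have Dx: "D x > 0" using \<open>\<not> F x \<le> G x\<close> by (simp add: D_def)
  obtain d where d: "d > 0" "\<And>y. y \<in> {a..b} \<Longrightarrow> dist y x < d \<Longrightarrow> dist (D y) (D x) < D x"
    using contD x Dx unfolding continuous_on_iff by metis
  define l r where "l = max a (x - d/2)" and "r = min b (x + d/2)"
  have lr: "l < r" using d(1) x assms(3) by (auto simp: l_def r_def)
  have pos: "D y > 0" if "y \<in> {l<..<r}" for y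
  proof -
    have "dist (D y) (D x) < D x"
      using that d(1) by (intro d) (auto simp: l_def r_def dist_real_def)
    then show ?thesis by (auto simp: dist_real_def abs_if split: if_splits)
  qed
  have "AE y in lborel. y \<notin> {l<..<r}"
    using ae
  proof eventually_elim
    case (elim y)
    show ?case
    proof
      assume y: "y \<in> {l<..<r}"
      with pos[OF y] elim show False by (auto simp: l_def r_def D_def)
    qed
  qed
  then have "emeasure lborel {l<..<r} = 0"
    using AE_iff_measurable[of "{l<..<r}" lborel "\<lambda>y. y \<notin> {l<..<r}"]
    by (auto simp: greaterThanLessThan_def greaterThan_def lessThan_def Int_def)
  then show False
    using lr by (subst (asm) emeasure_lborel_Ioo) auto
qed

text \<open>The antiderivative \<open>H\<close> of \<open>h\<close> reproduces the measure of
  intervals by Levy inversion, so \<open>cdf M\<close> differs from \<open>H\<close> by a constant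
  and has derivative \<open>h\<close>.\<close>

lemma real_distribution_density_of_integrable_char:
  assumes "real_distribution M" and ch: "integrable lborel (char M)"
  defines "h \<equiv> \<lambda>x. (\<integral>\<xi>. Re (iexp (-(\<xi> * x)) * char M \<xi>) \<partial>lborel) / (2 * pi)"
  shows "\<And>x. 0 \<le> h x" "continuous_on UNIV h" "M = density lborel (\<lambda>x. ennreal (h x))"
proof -
  interpret real_distribution M by fact
  \<comment> \<open>The kernel is the integral of \<open>iexp (- (\<xi> * y))\<close> over
    \<open>y\<close> from \<open>0\<close> to \<open>b\<close>. At \<open>\<xi> = 0\<close> division
    by zero gives \<open>0\<close> instead of \<open>b\<close>, so the differentiation below is done
    with the indicator of \<open>-{0}\<close>, which changes the integrals on a null set
    only.\<close>
  define H where "H b = (\<integral>\<xi>. Re ((1 - iexp (-(\<xi> * b))) / (\<i> * \<xi>) * char M \<xi>) \<partial>lborel) / (2 * pi)" for b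
  have kerm: "(\<lambda>\<xi>. (1 - iexp (-(\<xi> * b))) / (\<i> * \<xi>)) \<in> borel_measurable borel" for b
    by measurable
  have kb: "norm ((1 - iexp (-(\<xi> * b))) / (\<i> * \<xi>)) \<le> \<bar>b\<bar>" for \<xi> b :: real
  proof (cases "\<xi> = 0")
    case False
    have "norm (1 - iexp (-(\<xi> * b))) \<le> \<bar>\<xi> * b\<bar>"
      using iexp_approx1[of "-(\<xi>*b)" 0] by (simp add: norm_minus_commute)
    with False show ?thesis by (simp add: norm_divide norm_mult divide_le_eq abs_mult mult.commute)
  qed simp
  have intH: "integrable lborel (\<lambda>\<xi>. (1 - iexp (-(\<xi> * b))) / (\<i> * \<xi>) * char M \<xi>)" for b
  proof (rule Bochner_Integration.integrable_bound[where f="\<lambda>\<xi>. \<bar>b\<bar> * norm (char M \<xi>)"])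
    show "integrable lborel (\<lambda>\<xi>. \<bar>b\<bar> * norm (char M \<xi>))" using ch by auto
    show "AE \<xi> in lborel. norm ((1 - iexp (-(\<xi> * b))) / (\<i> * \<xi>) * char M \<xi>) \<le> norm (\<bar>b\<bar> * norm (char M \<xi>))"
    proof (rule AE_I2)
      fix \<xi>
      show "norm ((1 - iexp (-(\<xi> * b))) / (\<i> * \<xi>) * char M \<xi>) \<le> norm (\<bar>b\<bar> * norm (char M \<xi>))"
        unfolding norm_mult[of "(1 - iexp (-(\<xi> * b))) / (\<i> * \<xi>)"]
        using kb[of \<xi> b] by (simp add: mult_right_mono abs_mult del: norm_divide)
    qed
  qed (use kerm in measurable)
  have derH: "(H has_real_derivative h x) (at x)" for x
  proof -
    have "((\<lambda>b. \<integral>\<xi>. Re ((1 - iexp (-(\<xi> * b))) / (\<i> * \<xi>) * char M \<xi>) * indicator (-{0}) \<xi> \<partial>lborel) has_real_derivative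
           (\<integral>\<xi>. Re (iexp (-(\<xi> * x)) * char M \<xi>) * indicator (-{0}) \<xi> \<partial>lborel)) (at x)"
    proof (rule has_field_derivative_integral[where S=UNIV and w="\<lambda>\<xi>. norm (char M \<xi>)" and
          h="\<lambda>b \<xi>. Re ((1 - iexp (-(\<xi> * b))) / (\<i> * \<xi>) * char M \<xi>) * indicator (-{0}) \<xi>" and
          h'="\<lambda>x \<xi>. Re (iexp (-(\<xi> * x)) * char M \<xi>) * indicator (-{0}) \<xi>"])
      show "integrable lborel (\<lambda>\<xi>. Re ((1 - iexp (-(\<xi> * b))) / (\<i> * \<xi>) * char M \<xi>) * indicator (-{0}) \<xi>)" for b
        by (rule integrable_real_mult_indicator) (use intH[of b] in \<open>auto intro: integrable_Re\<close>)
      show "((\<lambda>b. Re ((1 - iexp (-(\<xi> * b))) / (\<i> * \<xi>) * char M \<xi>) * indicator (-{0}) \<xi>) has_real_derivative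
          Re (iexp (-(\<xi> * x)) * char M \<xi>) * indicator (-{0}) \<xi>) (at x)" for x \<xi>
      proof (cases "\<xi> = 0")
        case False
        have "((\<lambda>z. (1 - exp (-(\<i> * \<xi> * z))) / (\<i> * \<xi>) * char M \<xi>) has_field_derivative
           exp (-(\<i> * \<xi> * x)) * char M \<xi>) (at (of_real x))"
          using False by (auto intro!: derivative_eq_intros simp: field_simps)
        from bounded_linear.has_vector_derivative[OF bounded_linear_Re has_vector_derivative_real_field[OF this]]
        show ?thesis
          using False by (simp add: has_real_derivative_iff_has_vector_derivative mult.assoc)
      qed simp
      show "norm (Re (iexp (-(\<xi> * x)) * char M \<xi>) * indicator (-{0}) \<xi>) \<le> norm (char M \<xi>)" for x \<xi>
        using abs_Re_le_cmod[of "iexp (-(\<xi> * x)) * char M \<xi>"] by (auto simp: norm_mult indicator_def)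
      show "(\<lambda>\<xi>. Re (iexp (-(\<xi> * x)) * char M \<xi>) * indicator (-{0}) \<xi>) \<in> borel_measurable lborel"
        by measurable
    qed (use ch in auto)
    moreover have "(\<integral>\<xi>. g \<xi> * indicator (-{0}) \<xi> \<partial>lborel) = (\<integral>\<xi>. g \<xi> \<partial>lborel)" if [measurable]: "g \<in> borel_measurable borel" for g :: "real \<Rightarrow> real"
      by (intro integral_cong_AE) (use AE_lborel_singleton[of "0::real"] in \<open>auto simp: indicator_def\<close>)
    ultimately have "((\<lambda>b. \<integral>\<xi>. Re ((1 - iexp (-(\<xi> * b))) / (\<i> * \<xi>) * char M \<xi>) \<partial>lborel) has_real_derivative
           (\<integral>\<xi>. Re (iexp (-(\<xi> * x)) * char M \<xi>) \<partial>lborel)) (at x)"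
      by simp
    then show ?thesis unfolding H_def h_def by (rule DERIV_cdivide)
  qed
  have inv: "measure M {a<..b} = H b - H a" if ab: "a \<le> b" "measure M {a} = 0" "measure M {b} = 0" for a b
  proof -
    let ?g = "\<lambda>\<xi>::real. (iexp (-(\<xi> * a)) - iexp (-(\<xi> * b))) / (\<i> * \<xi>) * char M \<xi>"
    have eq: "?g = (\<lambda>\<xi>. (1 - iexp (-(\<xi> * b))) / (\<i> * \<xi>) * char M \<xi> - (1 - iexp (-(\<xi> * a))) / (\<i> * \<xi>) * char M \<xi>)"
      by (simp add: fun_eq_iff diff_divide_distrib ring_distribs)
    have ig: "integrable lborel ?g" unfolding eq by (intro Bochner_Integration.integrable_diff intH)
    have "(\<lambda>n::nat. CLBINT \<xi>=ereal (-real n)..real n. ?g \<xi>) \<longlonglongrightarrow> (CLBINT \<xi>. ?g \<xi>)"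
    proof -
      have "(\<lambda>n::nat. \<integral>\<xi>. indicator {-real n..real n} \<xi> *\<^sub>R ?g \<xi> \<partial>lborel) \<longlonglongrightarrow> (\<integral>\<xi>. ?g \<xi> \<partial>lborel)"
      proof (rule integral_dominated_convergence[where w="\<lambda>\<xi>. norm (?g \<xi>)"])
        show "AE \<xi> in lborel. (\<lambda>n. indicator {- real n..real n} \<xi> *\<^sub>R ?g \<xi>) \<longlonglongrightarrow> ?g \<xi>"
        proof (rule AE_I2)
          fix \<xi> :: real
          obtain N :: nat where "\<bar>\<xi>\<bar> \<le> real N" using real_arch_simple by blast
          then have "\<forall>\<^sub>F n in sequentially. indicator {- real n..real n} \<xi> *\<^sub>R ?g \<xi> = ?g \<xi>"
            by (intro eventually_sequentiallyI[of N]) (auto simp: indicator_def)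
          then show "(\<lambda>n. indicator {- real n..real n} \<xi> *\<^sub>R ?g \<xi>) \<longlonglongrightarrow> ?g \<xi>"
            by (rule tendsto_eventually)
        qed
        show "AE x in lborel. norm (indicator {- real i..real i} x *\<^sub>R ?g x) \<le> norm (?g x)" for i
          by (auto simp: indicator_def)
      qed (use ig in auto)
      then show ?thesis
        by (simp add: interval_integral_Icc set_lebesgue_integral_def del: of_real_minus)
    qed
    then have "(\<lambda>n::nat. 1 / (2 * pi) * (CLBINT \<xi>=ereal (-real n)..real n. ?g \<xi>)) \<longlonglongrightarrow> 1 / (2 * pi) * (CLBINT \<xi>. ?g \<xi>)"
      by (intro tendsto_intros)
    moreover have "(\<lambda>n::nat. 1 / (2 * pi) * (CLBINT \<xi>=ereal (-real n)..real n. ?g \<xi>)) \<longlonglongrightarrow> measure M {a<..b}"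
      using Levy_Inversion[OF ab] by simp
    ultimately have "complex_of_real (measure M {a<..b}) = 1 / (2 * pi) * (CLBINT \<xi>. ?g \<xi>)"
      using LIMSEQ_unique by blast
    then have "measure M {a<..b} = Re (1 / (2 * pi) * (CLBINT \<xi>. ?g \<xi>))"
      by (metis Re_complex_of_real)
    also have "\<dots> = Re (CLBINT \<xi>. ?g \<xi>) / (2 * pi)"
      unfolding Re_complex_of_real times_complex.simps by simp
    finally have m: "measure M {a<..b} = Re (CLBINT \<xi>. ?g \<xi>) / (2 * pi)" .
    have "Re (CLBINT \<xi>. ?g \<xi>) = (\<integral>\<xi>. Re (?g \<xi>) \<partial>lborel)"
      using ig by (rule integral_Re[symmetric])
    also have "\<dots> = 2 * pi * (H b - H a)"
      using Bochner_Integration.integral_diff[OF integrable_Re[OF intH[of b]] integrable_Re[OF intH[of a]]]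
      unfolding eq[THEN fun_cong] H_def minus_complex.simps by (simp add: diff_divide_distrib[symmetric])
    finally show ?thesis unfolding m by simp
  qed
  \<comment> \<open>Levy inversion applies at points without mass only. Atoms are countable, hence
    such points are dense, and right continuity of \<open>cdf M\<close> reaches the others.\<close>
  have const: "\<exists>k. \<forall>x. cdf M x - H x = k"
  proof -
    have count: "countable {x. measure M {x} \<noteq> 0}" using countable_support .
    obtain a0 where a0: "measure M {a0} = 0"
      using open_minus_countable[OF count, of UNIV] by auto
    define D where "D x = cdf M x - H x" for x
    have D1: "D b = D a0" if "measure M {b} = 0" for b
    proof -
      have "D d = D c" if "c < d" "measure M {c} = 0" "measure M {d} = 0" for c d
        using inv[of c d] that cdf_diff_eq[of c d] by (simp add: D_def)
      from this[of b a0] this[of a0 b] that a0 show ?thesis by (cases b a0 rule: linorder_cases) auto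
    qed
    have "D x = D a0" for x
    proof (rule ccontr)
      assume ne: "D x \<noteq> D a0"
      have "(D \<longlongrightarrow> D x) (at_right x)"
        unfolding D_def using cdf_is_right_cont[of x] DERIV_isCont[OF derH[of x]]
        by (intro tendsto_intros) (auto simp: continuous_within isCont_def intro: tendsto_within_subset)
      then have "\<forall>\<^sub>F y in at_right x. D y \<noteq> D a0"
        using ne by (rule tendsto_imp_eventually_ne)
      then obtain N where N: "N > x" "\<And>y. x < y \<Longrightarrow> y < N \<Longrightarrow> D y \<noteq> D a0"
        by (auto simp add: eventually_at_right[OF less_add_one])
      with open_minus_countable[OF count, of "{x <..< N}"] obtain b
        where "x < b" "b < N" "measure M {b} = 0" by auto
      with D1[of b] N(2)[of b] show False by auto
    qed
    then show ?thesis unfolding D_def by blast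
  qed
  then obtain k where k: "\<And>x. cdf M x = H x + k" by (metis diff_eq_eq add.commute)
  have derF: "(cdf M has_real_derivative h x) (at x)" for x
    unfolding k[abs_def] by (rule derivative_eq_intros derH refl | simp)+
  show hpos: "0 \<le> h x" for x
  proof (rule ccontr)
    assume "\<not> 0 \<le> h x"
    then obtain d where "d > 0" "\<And>e. 0 < e \<Longrightarrow> e < d \<Longrightarrow> cdf M (x + e) < cdf M x"
      using DERIV_neg_dec_right[OF derF[of x]] by auto
    from this(2)[of "d/2"] this(1) cdf_nondecreasing[of x "x + d/2"] show False by auto
  qed
  show contH: "continuous_on UNIV h"
  proof -
    have "isCont h x" for x
      unfolding h_def continuous_at_sequentially comp_def
    proof (intro allI impI tendsto_divide)
      fix X assume X: "X \<longlonglongrightarrow> x"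
      show "(\<lambda>n. \<integral>\<xi>. Re (iexp (-(\<xi> * X n)) * char M \<xi>) \<partial>lborel) \<longlonglongrightarrow> (\<integral>\<xi>. Re (iexp (-(\<xi> * x)) * char M \<xi>) \<partial>lborel)"
      proof (rule integral_dominated_convergence[where w="\<lambda>\<xi>. norm (char M \<xi>)"])
        show "AE \<xi> in lborel. (\<lambda>n. Re (iexp (-(\<xi> * X n)) * char M \<xi>)) \<longlonglongrightarrow> Re (iexp (-(\<xi> * x)) * char M \<xi>)"
          by (intro AE_I2 tendsto_intros X)
        show "AE \<xi> in lborel. norm (Re (iexp (-(\<xi> * X n)) * char M \<xi>)) \<le> norm (char M \<xi>)" for n
        proof (rule AE_I2)
          fix \<xi>
          show "norm (Re (iexp (-(\<xi> * X n)) * char M \<xi>)) \<le> norm (char M \<xi>)"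
            using abs_Re_le_cmod[of "iexp (-(\<xi> * X n)) * char M \<xi>"] by (simp add: norm_mult)
        qed
      qed (use ch in auto)
    qed auto
    then show ?thesis by (simp add: continuous_at_imp_continuous_on)
  qed
  show "M = density lborel (\<lambda>x. ennreal (h x))"
  proof (rule measure_eqI_lessThan)
    fix x
    have hm[measurable]: "h \<in> borel_measurable borel" using contH by (rule borel_measurable_continuous_onI)
    have "emeasure (density lborel (\<lambda>x. ennreal (h x))) {x<..} = (\<integral>\<^sup>+y. ennreal (h y) * indicator {x<..} y \<partial>lborel)"
      by (simp add: emeasure_density)
    also have "\<dots> = (\<integral>\<^sup>+y. ennreal (h y) * indicator {x..} y \<partial>lborel)"
      by (intro nn_integral_cong_AE) (use AE_lborel_singleton[of x] in \<open>auto simp: indicator_def\<close>)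
    also have "\<dots> = 1 - cdf M x"
      by (intro nn_integral_FTC_atLeast derF hpos cdf_lim_at_top_prob hm)
    also have "1 - cdf M x = measure M {x<..}"
    proof -
      have "UNIV - {..x} = {x<..}" by auto
      with prob_compl[of "{..x}"] show ?thesis by (simp add: cdf_def)
    qed
    finally show "emeasure M {x<..} = emeasure (density lborel (\<lambda>x. ennreal (h x))) {x<..}"
      by (simp add: emeasure_eq_measure)
  qed (auto simp: emeasure_eq_measure less_top)
qed

text \<open>Frequency \<open>0\<close> shows that the total masses agree, so division by the common
  mass reduces the claim to \<open>Levy_uniqueness\<close>. Mass \<open>0\<close> cannot be
  normalised and is treated directly.\<close>

lemma finite_measure_eq_of_fourier_eq:
  fixes A B :: "real measure"
  assumes "finite_measure A" "finite_measure B"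
    and sets[measurable_cong]: "sets A = sets borel" "sets B = sets borel"
    and eq: "\<And>\<xi>. (\<integral>x. iexp (\<xi> * x) \<partial>A) = (\<integral>x. iexp (\<xi> * x) \<partial>B)"
  shows "A = B"
proof -
  interpret A: finite_measure A by fact
  interpret B: finite_measure B by fact
  have sp: "space A = UNIV" "space B = UNIV" using sets_eq_imp_space_eq[OF sets(1)] sets_eq_imp_space_eq[OF sets(2)] by simp_all
  define m where "m = measure A UNIV"
  have mB: "m = measure B UNIV"
    using eq[of 0] by (simp add: m_def sp)
  have m0: "m \<ge> 0" by (simp add: m_def)
  show ?thesis
  proof (cases "m = 0")
    case True
    show ?thesis
    proof (rule measure_eqI)
      fix X assume "X \<in> sets A"
      have "emeasure A X \<le> emeasure A UNIV" "emeasure B X \<le> emeasure B UNIV"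
        by (auto intro!: emeasure_mono simp: sets)
      then show "emeasure A X = emeasure B X"
        using True mB by (simp add: m_def A.emeasure_eq_measure B.emeasure_eq_measure measure_le_0_iff)
    qed (simp add: sets)
  next
    case False
    with m0 have m: "m > 0" by simp
    let ?n = "\<lambda>A. density A (\<lambda>_. ennreal (1/m))"
    have em: "emeasure A UNIV = ennreal m" "emeasure B UNIV = ennreal m"
      unfolding A.emeasure_eq_measure B.emeasure_eq_measure by (simp_all only: m_def mB[symmetric])
    have one: "ennreal (1/m) * ennreal m = 1" using m by (simp flip: ennreal_mult)
    have "prob_space (?n A)" "prob_space (?n B)"
      by (rule prob_spaceI; simp add: emeasure_density sp nn_integral_cmult em one)+
    then have rd: "real_distribution (?n A)" "real_distribution (?n B)"
      by (auto simp: real_distribution_def real_distribution_axioms_def sets)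
    have "char (?n A) = char (?n B)"
      unfolding char_def using m
      by (simp add: fun_eq_iff integral_density eq del: of_real_mult)
    with rd have E: "?n A = ?n B" by (intro Levy_uniqueness)
    show ?thesis
    proof (rule measure_eqI)
      fix X assume X: "X \<in> sets A"
      then have "ennreal (1/m) * emeasure A X = ennreal (1/m) * emeasure B X"
        using arg_cong[OF E, of "\<lambda>M. emeasure M X"] by (simp add: emeasure_density nn_integral_cmult_indicator sets)
      then have "(ennreal m * ennreal (1/m)) * emeasure A X = (ennreal m * ennreal (1/m)) * emeasure B X"
        by (simp only: mult.assoc)
      then show "emeasure A X = emeasure B X"
        using one by (simp only: mult.commute[of "ennreal m"] mult_1)
    qed (simp add: sets)
  qed
qed

section \<open>Laplace exponents with a Levy density\<close>

lemma one_plus_power_div_fact_le_exp: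
  fixes x :: real
  assumes "0 \<le> x" "k \<ge> 1"
  shows "1 + x ^ k / fact k \<le> exp x"
proof -
  have "(\<Sum>n\<in>{0,k}. x ^ n /\<^sub>R fact n) \<le> (\<Sum>n. x ^ n /\<^sub>R fact n)"
    using assms by (intro sum_le_suminf summable_exp_generic) auto
  with assms show ?thesis by (simp add: exp_def divide_inverse mult.commute)
qed

text \<open>Integrated against the Levy density this becomes \<open>mom_le_phi\<close>, the half of
  the comparison between \<open>phi\<close> and its derivatives that holds without scaling
  conditions.\<close>

lemma power_times_exp_minus_le:
  fixes x :: real
  assumes "0 \<le> x" "k \<ge> 1"
  shows "x ^ k * exp (- x) \<le> fact k * (1 - exp (- x))"
proof -
  have "x ^ k \<le> fact k * (exp x - 1)"
    using one_plus_power_div_fact_le_exp[OF assms] by (simp add: field_simps)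
  then have "x ^ k * exp (- x) \<le> (fact k * (exp x - 1)) * exp (- x)"
    by (rule mult_right_mono) simp
  also have "\<dots> = fact k * (1 - exp (- x))"
    by (simp add: algebra_simps exp_minus)
  finally show ?thesis .
qed

lemma power_times_exp_minus_le_const:
  fixes s w :: real
  assumes "0 \<le> s" "0 < w"
  shows "s ^ k * exp (- (w * s)) \<le> fact k / w ^ k"
proof (cases "k = 0")
  case True
  then show ?thesis using assms by simp
next
  case False
  have "(w * s) ^ k * exp (- (w * s)) \<le> fact k * (1 - exp (- (w * s)))"
    using assms False by (intro power_times_exp_minus_le) auto
  also have "\<dots> \<le> fact k" by (simp add: mult_le_cancel_left1)
  finally show ?thesis using assms by (simp add: field_simps power_mult_distrib)
qed

text \<open>Convexity of \<open>exp\<close> at \<open>- x\<close>, the combination of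
  \<open>0\<close> and \<open>- (K * x)\<close> with weight \<open>1 / K\<close> on the
  latter.\<close>

lemma one_minus_exp_minus_mult_le:
  fixes x K :: real
  assumes "1 \<le> K"
  shows "1 - exp (- (K * x)) \<le> K * (1 - exp (- x))"
proof -
  have "exp ((1 - 1 / K) *\<^sub>R 0 + (1 / K) *\<^sub>R (- (K * x))) \<le> (1 - 1 / K) * exp 0 + (1 / K) * exp (- (K * x))"
    using assms by (intro convex_onD[OF exp_convex]) auto
  then have "exp (- x) \<le> (1 - 1 / K) + (1 / K) * exp (- (K * x))"
    using assms by simp
  then have "K * exp (- x) \<le> K * ((1 - 1 / K) + (1 / K) * exp (- (K * x)))"
    using assms by (intro mult_left_mono) auto
  also have "\<dots> = K - 1 + exp (- (K * x))"
    using assms by (simp add: distrib_left right_diff_distrib)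
  finally show ?thesis by (simp add: algebra_simps)
qed

text \<open>The remainder of the third order Taylor polynomial of \<open>iexp\<close> is at most
  \<open>y ^ 4 / 24\<close>; for \<open>\<bar>y\<bar> \<le> 1\<close> it costs only
  \<open>y\<^sup>2 / 24\<close> of the main term \<open>y\<^sup>2 / 2\<close>.\<close>

lemma one_minus_cos_ge:
  fixes y :: real
  assumes "\<bar>y\<bar> \<le> 1"
  shows "y\<^sup>2 / 4 \<le> 1 - cos y"
proof -
  have "cos y - (1 - y\<^sup>2 / 2) = Re (iexp y - (\<Sum>k\<le>3. (\<i> * y) ^ k / fact k))"
    by (simp add: numeral_3_eq_3 Re_exp power2_eq_square)
  also have "\<dots> \<le> cmod (iexp y - (\<Sum>k\<le>3. (\<i> * y) ^ k / fact k))"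
    by (rule complex_Re_le_cmod)
  also have "\<dots> \<le> \<bar>y\<bar> ^ Suc 3 / fact (Suc 3)" by (rule iexp_approx1)
  also have "\<dots> = y\<^sup>2 * y\<^sup>2 / 24"
    by (simp add: fact_numeral numeral_eq_Suc power_even_abs flip: power_add)
  also have "\<dots> \<le> y\<^sup>2 * 1 / 24"
    using assms by (intro divide_right_mono mult_left_mono) (auto simp: abs_square_le_1)
  finally have "y\<^sup>2 / 2 - y\<^sup>2 / 24 \<le> 1 - cos y" by simp
  moreover have "y\<^sup>2 / 4 \<le> y\<^sup>2 / 2 - y\<^sup>2 / 24" by simp
  ultimately show ?thesis by (rule order_trans[rotated])
qed

text \<open>Extending the density by zero lets every integral run over the whole line.
  \<open>f_nontrivial\<close> is what makes \<open>phi\<close> and its moments strictly positive at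
  positive arguments.\<close>

locale levy_density =
  fixes f :: "real \<Rightarrow> real"
  assumes f_measurable[measurable]: "f \<in> borel_measurable borel"
    and f_nonneg[simp]: "0 \<le> f s"
    and f_nonpos_eq_0[simp]: "s \<le> 0 \<Longrightarrow> f s = 0"
    and f_integrable: "integrable lborel (\<lambda>s. f s * min 1 s)"
    and f_nontrivial: "\<not> (AE s in lborel. f s = 0)"
begin

text \<open>The exponent on the closed right half plane, through which characteristic functions are
  reached.\<close>

definition Phi :: "complex \<Rightarrow> complex"
  where "Phi z = (\<integral>s. f s *\<^sub>R (1 - exp (- (z * of_real s))) \<partial>lborel)"

definition Phi' :: "complex \<Rightarrow> complex"
  where "Phi' z = (\<integral>s. f s *\<^sub>R (of_real s * exp (- (z * of_real s))) \<partial>lborel)"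

definition phi :: "real \<Rightarrow> real"
  where "phi w = (\<integral>s. f s * (1 - exp (- (w * s))) \<partial>lborel)"

text \<open>Up to sign the \<open>k\<close>-th derivative of \<open>phi\<close> for
  \<open>k \<ge> 1\<close>: \<open>mom 1\<close> is the first derivative and \<open>mom 2\<close> is
  minus the second.\<close>

definition mom :: "nat \<Rightarrow> real \<Rightarrow> real"
  where "mom k w = (\<integral>s. f s * (s ^ k * exp (- (w * s))) \<partial>lborel)"

lemma integrable_f_scaleR:
  fixes g :: "real \<Rightarrow> 'a::{banach, second_countable_topology}"
  assumes [measurable]: "g \<in> borel_measurable borel"
    and le: "\<And>s. 0 < s \<Longrightarrow> norm (g s) \<le> B * min 1 s"
  shows "integrable lborel (\<lambda>s. f s *\<^sub>R g s)"
proof (rule Bochner_Integration.integrable_bound)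
  show "integrable lborel (\<lambda>s. B * (f s * min 1 s))" using f_integrable by simp
  show "AE s in lborel. norm (f s *\<^sub>R g s) \<le> norm (B * (f s * min 1 s))"
  proof (intro AE_I2)
    fix s
    show "norm (f s *\<^sub>R g s) \<le> norm (B * (f s * min 1 s))"
    proof (cases "s > 0")
      case True
      then have "f s * norm (g s) \<le> f s * (B * min 1 s)" by (intro mult_left_mono le) auto
      then have "f s * norm (g s) \<le> B * (f s * min 1 s)" by (simp add: mult_ac)
      also have "\<dots> \<le> norm (B * (f s * min 1 s))" by simp
      finally show ?thesis by simp
    qed simp
  qed
qed simp

lemmas integrable_f_mult = integrable_f_scaleR[where 'a=real, unfolded real_scaleR_def]

lemma integral_f_mono:
  assumes "integrable lborel (\<lambda>s. f s * g s)" "integrable lborel (\<lambda>s. f s * h s)"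
    and le: "\<And>s. 0 < s \<Longrightarrow> g s \<le> h s"
  shows "(\<integral>s. f s * g s \<partial>lborel) \<le> (\<integral>s. f s * h s \<partial>lborel)"
proof (rule integral_mono)
  fix s :: real
  show "f s * g s \<le> f s * h s"
    using le[of s] by (cases "s > 0") (auto intro: mult_left_mono)
qed (use assms in auto)

lemma integral_f_pos:
  assumes int: "integrable lborel (\<lambda>s. f s * g s)"
    and pos: "\<And>s. 0 < s \<Longrightarrow> 0 < g s"
  shows "0 < (\<integral>s. f s * g s \<partial>lborel)"
proof (rule ccontr)
  have nn: "0 \<le> f s * g s" for s
    using pos[of s] by (cases "s > 0") (auto intro: mult_nonneg_nonneg)
  assume "\<not> ?thesis"
  with nn have "(\<integral>s. f s * g s \<partial>lborel) = 0"
    by (intro antisym) (auto intro!: Bochner_Integration.integral_nonneg)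
  then have "AE s in lborel. f s * g s = 0"
    using int nn by (subst (asm) integral_nonneg_eq_0_iff_AE) auto
  then have "AE s in lborel. f s = 0"
  proof eventually_elim
    case (elim s)
    then show ?case using pos[of s] by (cases "s > 0") auto
  qed
  with f_nontrivial show False by simp
qed

lemma norm_one_minus_exp_le:
  assumes "0 \<le> Re z" "0 < s"
  shows "norm (1 - exp (- (z * of_real s))) \<le> (norm z + 2) * min 1 s"
proof -
  have "norm (exp 0 - exp (- (z * of_real s))) \<le> exp 0 * norm (0 - (- (z * of_real s)))"
    using assms by (intro norm_exp_diff_le) auto
  then have "norm (1 - exp (- (z * of_real s))) \<le> norm z * s"
    using assms by (simp add: norm_mult)
  moreover have "norm (1 - exp (- (z * of_real s))) \<le> 2"
  proof -
    have "norm (1 - exp (- (z * of_real s))) \<le> norm (1::complex) + norm (exp (- (z * of_real s)))"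
      by (rule norm_triangle_ineq4)
    also have "\<dots> = 1 + exp (- (Re z * s))" by simp
    also have "\<dots> \<le> 2" using assms by simp
    finally show ?thesis .
  qed
  moreover have "norm z * s \<le> (norm z + 2) * s" "2 \<le> norm z + 2"
    using assms by (auto intro: mult_right_mono)
  moreover have "0 \<le> norm z" by simp
  ultimately show ?thesis unfolding min_def by (cases "1 \<le> s") (simp_all del: norm_ge_zero)
qed

lemma power_exp_le_min:
  fixes w s :: real
  assumes "0 < w" "k \<ge> 1" "0 < s"
  shows "s ^ k * exp (- (w * s)) \<le> (fact k / w ^ k + fact (k - 1) / w ^ (k - 1)) * min 1 s"
proof -
  have 1: "s ^ k * exp (- (w * s)) \<le> fact k / w ^ k"
    using assms by (intro power_times_exp_minus_le_const) auto
  have "s ^ (k - 1) * exp (- (w * s)) \<le> fact (k - 1) / w ^ (k - 1)"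
    using assms by (intro power_times_exp_minus_le_const) auto
  then have "s * (s ^ (k - 1) * exp (- (w * s))) \<le> s * (fact (k - 1) / w ^ (k - 1))"
    using assms by (intro mult_left_mono) auto
  moreover have "s * s ^ (k - 1) = s ^ k" using assms by (cases k) auto
  ultimately have 2: "s ^ k * exp (- (w * s)) \<le> s * (fact (k - 1) / w ^ (k - 1))"
    by (simp flip: mult.assoc)
  have nn: "0 \<le> fact k / w ^ k" "0 \<le> fact (k - 1) / w ^ (k - 1)" using assms by auto
  show ?thesis
  proof (cases "s \<le> 1")
    case True
    have "s * (fact (k - 1) / w ^ (k - 1)) \<le> (fact k / w ^ k + fact (k - 1) / w ^ (k - 1)) * s"
      using nn assms by (subst mult.commute) (intro mult_right_mono, auto)
    with 2 True show ?thesis by simp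
  next
    case False
    with 1 nn show ?thesis by simp
  qed
qed

lemma integrable_mom: "0 < w \<Longrightarrow> k \<ge> 1 \<Longrightarrow> integrable lborel (\<lambda>s. f s * (s ^ k * exp (- (w * s))))"
  using power_exp_le_min[of w k]
  by (intro integrable_f_mult[where B="fact k / w ^ k + fact (k - 1) / w ^ (k - 1)"]) auto

lemma integrable_Phi: "0 \<le> Re z \<Longrightarrow> integrable lborel (\<lambda>s. f s *\<^sub>R (1 - exp (- (z * of_real s))))"
  by (rule integrable_f_scaleR[where B="norm z + 2"]) (auto intro: norm_one_minus_exp_le)

lemma integrable_phi: "0 \<le> w \<Longrightarrow> integrable lborel (\<lambda>s. f s * (1 - exp (- (w * s))))"
proof (rule integrable_f_mult[where B="w + 1"])
  fix s :: real assume "0 \<le> w" "0 < s"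
  moreover from this have "0 \<le> w * s" by simp
  moreover have "1 - exp (- (w * s)) \<le> w * s"
    using exp_ge_add_one_self[of "- (w * s)"] by simp
  moreover have "0 < exp (- (w * s))" by simp
  ultimately show "norm (1 - exp (- (w * s))) \<le> (w + 1) * min 1 s"
    by (auto simp: min_def algebra_simps)
qed simp

lemma exp_minus_of_real: "exp (- (of_real w * of_real s)) = complex_of_real (exp (- (w * s)))"
  by (metis exp_of_real of_real_minus of_real_mult)

lemma Phi_of_real: "Phi (of_real w) = of_real (phi w)"
  unfolding Phi_def phi_def integral_complex_of_real[symmetric]
  by (simp add: scaleR_conv_of_real exp_minus_of_real)

lemma phi_has_derivative:
  assumes "0 < w"
  shows "(phi has_real_derivative mom 1 w) (at w)"
  unfolding phi_def[abs_def] mom_def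
\<comment> \<open>Staying above \<open>w / 2\<close> provides the integrable majorant: the weight is
  at most \<open>exp (- (w / 2 * s))\<close> there.\<close>
proof (rule has_field_derivative_integral[where S="{w/2<..}" and w="\<lambda>s. f s * (s ^ 1 * exp (- (w / 2 * s)))"
      and h'="\<lambda>w s. f s * (s ^ 1 * exp (- (w * s)))"])
  show "norm (f s * (s ^ 1 * exp (- (z * s)))) \<le> f s * (s ^ 1 * exp (- (w / 2 * s)))"
    if z: "z \<in> {w / 2<..}" for z s
  proof (cases "s > 0")
    case True
    with z have "w / 2 * s \<le> z * s" by (intro mult_right_mono) auto
    with True show ?thesis by (simp add: abs_mult mult_left_mono)
  qed simp
  show "((\<lambda>z. f s * (1 - exp (- (z * s)))) has_real_derivative f s * (s ^ 1 * exp (- (z * s)))) (at z)" for z s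
    by (auto intro!: derivative_eq_intros)
qed (use assms integrable_phi integrable_mom[of "w/2" 1] in auto)

lemma mom_has_derivative:
  assumes "0 < w" "k \<ge> 1"
  shows "(mom k has_real_derivative - mom (Suc k) w) (at w)"
proof -
  have "((\<lambda>w. \<integral>s. f s * (s ^ k * exp (- (w * s))) \<partial>lborel) has_real_derivative
         (\<integral>s. - (f s * (s ^ Suc k * exp (- (w * s)))) \<partial>lborel)) (at w)"
  proof (rule has_field_derivative_integral[where S="{w/2<..}" and w="\<lambda>s. f s * (s ^ Suc k * exp (- (w / 2 * s)))"
        and h'="\<lambda>w s. - (f s * (s ^ Suc k * exp (- (w * s))))"])
    show "norm (- (f s * (s ^ Suc k * exp (- (z * s))))) \<le> f s * (s ^ Suc k * exp (- (w / 2 * s)))"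
      if z: "z \<in> {w / 2<..}" for z s
    proof (cases "s > 0")
      case True
      with z have "w / 2 * s \<le> z * s" by (intro mult_right_mono) auto
      with True show ?thesis by (simp add: abs_mult mult_left_mono)
    qed simp
    show "((\<lambda>z. f s * (s ^ k * exp (- (z * s)))) has_real_derivative - (f s * (s ^ Suc k * exp (- (z * s))))) (at z)" for z s
      by (auto intro!: derivative_eq_intros)
    show "integrable lborel (\<lambda>s. f s * (s ^ k * exp (- (z * s))))" if "z \<in> {w / 2<..}" for z
      using that assms by (intro integrable_mom) auto
    show "integrable lborel (\<lambda>s. f s * (s ^ Suc k * exp (- (w / 2 * s))))"
      using assms by (intro integrable_mom) auto
  qed (use assms in auto)
  then show ?thesis unfolding mom_def[abs_def] by simp
qed

lemma Phi_has_derivative: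
  assumes z0: "0 < Re z0"
  shows "(Phi has_field_derivative Phi' z0) (at z0)"
  unfolding Phi_def[abs_def] Phi'_def
proof (rule has_field_derivative_integral[where S="{z. Re z0 / 2 < Re z}"
      and w="\<lambda>s. f s * (s ^ 1 * exp (- (Re z0 / 2 * s)))"
      and h'="\<lambda>z s. f s *\<^sub>R (of_real s * exp (- (z * of_real s)))"])
  show "norm (f s *\<^sub>R (of_real s * exp (- (z * of_real s)))) \<le> f s * (s ^ 1 * exp (- (Re z0 / 2 * s)))"
    if z: "z \<in> {z. Re z0 / 2 < Re z}" for z s
  proof (cases "s > 0")
    case True
    with z have "Re z0 / 2 * s \<le> Re z * s" by (intro mult_right_mono) auto
    with True show ?thesis by (simp add: norm_mult mult_left_mono)
  qed simp
  show "((\<lambda>z. f s *\<^sub>R (1 - exp (- (z * of_real s)))) has_field_derivative f s *\<^sub>R (of_real s * exp (- (z * of_real s)))) (at z)" for z s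
    unfolding scaleR_conv_of_real by (auto intro!: derivative_eq_intros)
  show "open {z. Re z0 / 2 < Re z}" by (rule open_halfspace_Re_gt)
  show "convex {z. Re z0 / 2 < Re z}" by (rule convex_halfspace_Re_gt)
  show "integrable lborel (\<lambda>s. f s *\<^sub>R (1 - exp (- (z * of_real s))))" if "z \<in> {z. Re z0 / 2 < Re z}" for z
    using that z0 by (intro integrable_Phi) auto
  show "integrable lborel (\<lambda>s. f s * (s ^ 1 * exp (- (Re z0 / 2 * s))))"
    using z0 by (intro integrable_mom) auto
qed (use z0 in auto)


section \<open>Monotonicity of the exponent and comparison with its derivatives\<close>

lemma phi_pos: "0 < w \<Longrightarrow> 0 < phi w"
  unfolding phi_def by (intro integral_f_pos integrable_phi) auto

lemma mom_pos: "0 < w \<Longrightarrow> k \<ge> 1 \<Longrightarrow> 0 < mom k w"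
  unfolding mom_def by (intro integral_f_pos integrable_mom) auto

lemma phi_mono: "0 \<le> v \<Longrightarrow> v \<le> w \<Longrightarrow> phi v \<le> phi w"
  unfolding phi_def by (intro integral_f_mono integrable_phi) (auto intro: mult_right_mono)

lemma phi_strict_mono:
  assumes "0 \<le> v" "v < w"
  shows "phi v < phi w"
proof -
  have "0 < (\<integral>s. f s * (exp (- (v * s)) - exp (- (w * s))) \<partial>lborel)"
  proof (rule integral_f_pos)
    have "integrable lborel (\<lambda>s. f s * (1 - exp (- (w * s))) - f s * (1 - exp (- (v * s))))"
      using assms by (intro Bochner_Integration.integrable_diff integrable_phi) auto
    then show "integrable lborel (\<lambda>s. f s * (exp (- (v * s)) - exp (- (w * s))))"
      by (simp add: algebra_simps)
  qed (use assms in auto)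
  also have "\<dots> = (\<integral>s. f s * (1 - exp (- (w * s))) - f s * (1 - exp (- (v * s))) \<partial>lborel)"
    by (simp add: algebra_simps)
  also have "\<dots> = phi w - phi v"
    unfolding phi_def using assms by (intro Bochner_Integration.integral_diff integrable_phi) auto
  finally show ?thesis by simp
qed

lemma phi_less_cancel: "0 \<le> v \<Longrightarrow> 0 \<le> w \<Longrightarrow> phi v < phi w \<longleftrightarrow> v < w"
  using phi_strict_mono[of v w] phi_mono[of w v] by (cases "v < w") auto

lemma phi_le_cancel: "0 \<le> v \<Longrightarrow> 0 \<le> w \<Longrightarrow> phi v \<le> phi w \<longleftrightarrow> v \<le> w"
  using phi_less_cancel[of w v] by (simp add: not_less[symmetric])

lemma mom_strict_antimono:
  assumes "0 < v" "v < w" "k \<ge> 1"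
  shows "mom k w < mom k v"
proof (rule DERIV_neg_imp_decreasing_open[OF assms(2)])
  show "\<exists>y. (mom k has_real_derivative y) (at x) \<and> y < 0" if "v < x" "x < w" for x
    using that assms mom_has_derivative[of x k] mom_pos[of x "Suc k"] by (intro exI[of _ "- mom (Suc k) x"]) auto
  show "continuous_on {v..w} (mom k)"
    using assms by (intro continuous_at_imp_continuous_on ballI DERIV_isCont[OF mom_has_derivative]) auto
qed

lemma phi_mult_le: "1 \<le> K \<Longrightarrow> 0 \<le> w \<Longrightarrow> phi (K * w) \<le> K * phi w"
proof -
  assume K: "1 \<le> K" and w: "0 \<le> w"
  have "phi (K * w) \<le> (\<integral>s. f s * (K * (1 - exp (- (w * s)))) \<partial>lborel)"
    unfolding phi_def
  proof (intro integral_f_mono integrable_phi)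
    show "integrable lborel (\<lambda>s. f s * (K * (1 - exp (- (w * s)))))"
      using integrable_mult_right[OF integrable_phi[OF w], of K] by (simp add: mult_ac)
    show "1 - exp (- (K * w * s)) \<le> K * (1 - exp (- (w * s)))" for s
      using one_minus_exp_minus_mult_le[OF K, of "w * s"] by (simp add: mult_ac)
  qed (use K w in auto)
  also have "\<dots> = K * phi w"
    unfolding phi_def integral_mult_right_zero[symmetric] by (simp add: mult_ac)
  finally show ?thesis .
qed

lemma mom_le_phi:
  assumes "0 < w" "k \<ge> 1"
  shows "w ^ k * mom k w \<le> fact k * phi w"
  unfolding mom_def phi_def integral_mult_right_zero[symmetric]
proof -
  have "(\<integral>s. f s * (w ^ k * (s ^ k * exp (- (w * s)))) \<partial>lborel) \<le> (\<integral>s. f s * (fact k * (1 - exp (- (w * s)))) \<partial>lborel)"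
  proof (rule integral_f_mono)
    show "integrable lborel (\<lambda>s. f s * (w ^ k * (s ^ k * exp (- (w * s)))))"
      using integrable_mult_right[OF integrable_mom[OF assms], of "w ^ k"] by (simp add: mult_ac)
    show "integrable lborel (\<lambda>s. f s * (fact k * (1 - exp (- (w * s)))))"
      using integrable_mult_right[OF integrable_phi[of w], of "fact k"] assms by (simp add: mult_ac)
    show "w ^ k * (s ^ k * exp (- (w * s))) \<le> fact k * (1 - exp (- (w * s)))" if "0 < s" for s
      using power_times_exp_minus_le[of "w * s" k] that assms by (simp add: power_mult_distrib mult_ac)
  qed
  then show "(\<integral>s. w ^ k * (f s * (s ^ k * exp (- (w * s)))) \<partial>lborel) \<le> (\<integral>s. fact k * (f s * (1 - exp (- (w * s)))) \<partial>lborel)"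
    by (simp add: mult_ac)
qed

lemma mom_1_le: "0 < w \<Longrightarrow> w * mom 1 w \<le> phi w"
  using mom_le_phi[of w 1] by simp

lemma exp_minus_diff_le:
  fixes w s K :: real
  shows "exp (- (w * s)) - exp (- (K * w * s)) \<le> (K - 1) * w * (s * exp (- (w * s)))"
proof -
  have "exp (- (w * s)) - exp (- (K * w * s)) = exp (- (w * s)) * (1 - exp (- ((K - 1) * w * s)))"
    by (simp add: algebra_simps flip: exp_add)
  also have "\<dots> \<le> exp (- (w * s)) * ((K - 1) * w * s)"
    using exp_ge_add_one_self[of "- ((K - 1) * w * s)"] by (intro mult_left_mono) auto
  finally show ?thesis by (simp add: mult_ac)
qed

text \<open>Concavity: the increment is at most the slope at the left end times the length. Combined
  with the lower scaling condition it bounds \<open>mom 1\<close> from below.\<close>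

lemma phi_diff_le:
  assumes "1 \<le> K" "0 < w"
  shows "phi (K * w) - phi w \<le> (K - 1) * w * mom 1 w"
proof -
  have int: "integrable lborel (\<lambda>s. f s * (1 - exp (- (K * w * s))) - f s * (1 - exp (- (w * s))))"
    using assms by (intro Bochner_Integration.integrable_diff integrable_phi) auto
  have "phi (K * w) - phi w = (\<integral>s. f s * (1 - exp (- (K * w * s))) - f s * (1 - exp (- (w * s))) \<partial>lborel)"
    unfolding phi_def using assms by (intro Bochner_Integration.integral_diff[symmetric] integrable_phi) auto
  also have "\<dots> = (\<integral>s. f s * (exp (- (w * s)) - exp (- (K * w * s))) \<partial>lborel)"
    by (simp add: algebra_simps)
  also have "\<dots> \<le> (\<integral>s. f s * ((K - 1) * w * (s ^ 1 * exp (- (w * s)))) \<partial>lborel)"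
  proof (rule integral_f_mono)
    show "integrable lborel (\<lambda>s. f s * (exp (- (w * s)) - exp (- (K * w * s))))"
      using int by (simp add: algebra_simps)
    show "integrable lborel (\<lambda>s. f s * ((K - 1) * w * (s ^ 1 * exp (- (w * s)))))"
      using integrable_mult_right[OF integrable_mom[of w 1], of "(K - 1) * w"] assms by (simp add: mult_ac)
  qed (use exp_minus_diff_le in auto)
  also have "\<dots> = (K - 1) * w * mom 1 w"
    unfolding mom_def integral_mult_right_zero[symmetric] by (simp add: mult_ac)
  finally show ?thesis .
qed

text \<open>Convexity of the first derivative; plays the same part for \<open>mom 2\<close> as
  \<open>phi_diff_le\<close> does for \<open>mom 1\<close>.\<close>

lemma mom_1_diff_le:
  assumes "1 \<le> K" "0 < w"
  shows "mom 1 w - mom 1 (K * w) \<le> (K - 1) * w * mom 2 w"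
proof -
  have Kw: "0 < K * w" using assms by auto
  have int: "integrable lborel (\<lambda>s. f s * (s ^ 1 * exp (- (w * s))) - f s * (s ^ 1 * exp (- (K * w * s))))"
    using assms Kw by (intro Bochner_Integration.integrable_diff integrable_mom) auto
  have "mom 1 w - mom 1 (K * w) = (\<integral>s. f s * (s ^ 1 * exp (- (w * s))) - f s * (s ^ 1 * exp (- (K * w * s))) \<partial>lborel)"
    unfolding mom_def using assms Kw by (intro Bochner_Integration.integral_diff[symmetric] integrable_mom) auto
  also have "\<dots> = (\<integral>s. f s * (s * (exp (- (w * s)) - exp (- (K * w * s)))) \<partial>lborel)"
    by (simp add: algebra_simps)
  also have "\<dots> \<le> (\<integral>s. f s * ((K - 1) * w * (s ^ 2 * exp (- (w * s)))) \<partial>lborel)"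
  proof (rule integral_f_mono)
    show "integrable lborel (\<lambda>s. f s * (s * (exp (- (w * s)) - exp (- (K * w * s)))))"
      using int by (simp add: algebra_simps)
    show "integrable lborel (\<lambda>s. f s * ((K - 1) * w * (s ^ 2 * exp (- (w * s)))))"
      using integrable_mult_right[OF integrable_mom[of w 2], of "(K - 1) * w"] assms by (simp add: mult_ac)
    show "s * (exp (- (w * s)) - exp (- (K * w * s))) \<le> (K - 1) * w * (s ^ 2 * exp (- (w * s)))" if "0 < s" for s
      using mult_left_mono[OF exp_minus_diff_le[of w s K], of s] that by (simp add: mult_ac power2_eq_square)
  qed
  also have "\<dots> = (K - 1) * w * mom 2 w"
    unfolding mom_def integral_mult_right_zero[symmetric] by (simp add: mult_ac)
  finally show ?thesis .
qed

end

section \<open>Consequences of the scaling conditions\<close>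

lemma has_bochner_integral_square_exp:
  fixes b :: real
  assumes "0 < b"
  shows "has_bochner_integral lborel (\<lambda>s. indicator {0..} s * (s\<^sup>2 * exp (- (b * s)))) (2 / b ^ 3)"
proof -
  have "has_bochner_integral lborel (\<lambda>x. x ^ 2 * exp (- x) * indicator {0 ..} x :: real) (fact 2)"
    by (rule has_bochner_integral_I0i_power_exp_m')
  from lborel_has_bochner_integral_real_affine_iff[THEN iffD1, OF _ this, of b 0]
  have "has_bochner_integral lborel (\<lambda>s. (b * s) ^ 2 * exp (- (b * s)) * indicator {0 ..} (b * s)) (fact 2 / b)"
    using assms by (simp add: divide_inverse mult.commute)
  from has_bochner_integral_mult_right[OF this, of "1 / b\<^sup>2"]
  have "has_bochner_integral lborel (\<lambda>s. 1 / b\<^sup>2 * ((b * s) ^ 2 * exp (- (b * s)) * indicator {0 ..} (b * s))) (2 / b ^ 3)"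
    by (simp add: power3_eq_cube power2_eq_square mult_ac)
  moreover have "1 / b\<^sup>2 * ((b * s) ^ 2 * exp (- (b * s)) * indicator {0 ..} (b * s)) = indicator {0..} s * (s\<^sup>2 * exp (- (b * s)))" for s
    using assms by (auto simp: indicator_def power_mult_distrib zero_le_mult_iff)
  ultimately show ?thesis by simp
qed

text \<open>For \<open>s \<le> x\<close> the factor \<open>exp (1 - s / x)\<close> is at least one,
  so the truncated first moment is dominated by \<open>exp 1 * mom 1 (1 / x)\<close>. It measures
  the small jumps in the size bias identity.\<close>

lemma (in levy_density) nn_integral_less_le:
  assumes "0 < x"
  shows "(\<integral>\<^sup>+s. ennreal (s * f s) * indicator {..x} s \<partial>lborel) \<le> ennreal (exp 1 * (x * phi (1 / x)))"
proof -
  have "(\<integral>\<^sup>+s. ennreal (s * f s) * indicator {..x} s \<partial>lborel)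
      \<le> (\<integral>\<^sup>+s. ennreal (exp 1 * (f s * (s ^ 1 * exp (- (1 / x * s))))) \<partial>lborel)"
  proof (rule nn_integral_mono)
    fix s :: real
    show "ennreal (s * f s) * indicator {..x} s \<le> ennreal (exp 1 * (f s * (s ^ 1 * exp (- (1 / x * s)))))"
    proof (cases "0 < s \<and> s \<le> x")
      case True
      then have "1 \<le> exp (1 - s / x)" using assms by (simp add: divide_le_eq)
      then have "s * f s * 1 \<le> s * f s * exp (1 - s / x)" using True by (intro mult_left_mono) auto
      also have "\<dots> = exp 1 * (f s * (s ^ 1 * exp (- (1 / x * s))))"
        by (simp add: exp_diff exp_minus divide_inverse)
      finally show ?thesis using True by (simp add: ennreal_leI)
    qed (auto simp: indicator_def not_less)
  qed
  also have "\<dots> = ennreal (\<integral>s. exp 1 * (f s * (s ^ 1 * exp (- (1 / x * s)))) \<partial>lborel)"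
  proof (rule nn_integral_eq_integral)
    show "AE s in lborel. 0 \<le> exp 1 * (f s * (s ^ 1 * exp (- (1 / x * s))))"
    proof (rule AE_I2)
      show "0 \<le> exp 1 * (f s * (s ^ 1 * exp (- (1 / x * s))))" for s
        by (cases "s > 0") auto
    qed
  qed (use integrable_mom[of "1/x" 1] assms in auto)
  also have "\<dots> = ennreal (exp 1 * mom 1 (1 / x))"
    unfolding mom_def by simp
  also have "\<dots> \<le> ennreal (exp 1 * (x * phi (1 / x)))"
    using mom_1_le[of "1 / x"] assms by (intro ennreal_leI mult_left_mono) (auto simp: field_simps)
  finally show ?thesis .
qed

text \<open>The real part of \<open>Phi (Complex w \<xi>) - phi w\<close>. Multiplied by
  \<open>t\<close> it is minus the logarithm of the modulus of the tilted characteristic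
  function.\<close>

definition (in levy_density) decay :: "real \<Rightarrow> real \<Rightarrow> real"
  where "decay w \<xi> = (\<integral>s. f s * ((1 - cos (\<xi> * s)) * exp (- (w * s))) \<partial>lborel)"

lemma (in levy_density) integrable_decay:
  assumes "0 < w"
  shows "integrable lborel (\<lambda>s. f s * ((1 - cos (\<xi> * s)) * exp (- (w * s))))"
proof (rule integrable_f_mult)
  fix s :: real assume s: "0 < s"
  have "norm (exp 0 - exp (\<i> * of_real (\<xi> * s))) \<le> exp 0 * norm (0 - \<i> * of_real (\<xi> * s))"
    by (rule norm_exp_diff_le) auto
  then have "norm (1 - iexp (\<xi> * s)) \<le> \<bar>\<xi>\<bar> * s"
    using s by (simp add: norm_mult abs_mult)
  moreover have "1 - cos (\<xi> * s) \<le> norm (1 - iexp (\<xi> * s))"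
    using complex_Re_le_cmod[of "1 - iexp (\<xi> * s)"] by (simp add: Re_exp)
  ultimately have "1 - cos (\<xi> * s) \<le> \<bar>\<xi>\<bar> * s" by simp
  moreover have "1 - cos (\<xi> * s) \<le> 2" using cos_ge_minus_one[of "\<xi> * s"] by simp
  moreover have "\<bar>\<xi>\<bar> * s \<le> (\<bar>\<xi>\<bar> + 2) * s" using s by (intro mult_right_mono) auto
  moreover have "min 1 s = s \<or> min 1 s = 1" by (auto simp: min_def)
  ultimately have "1 - cos (\<xi> * s) \<le> (\<bar>\<xi>\<bar> + 2) * min 1 s"
    using abs_ge_zero[of \<xi>] by (elim disjE) (simp only: mult_1_right; linarith)+
  moreover have "(1 - cos (\<xi> * s)) * exp (- (w * s)) \<le> (1 - cos (\<xi> * s)) * 1"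
    using s assms by (intro mult_left_mono) auto
  ultimately show "norm ((1 - cos (\<xi> * s)) * exp (- (w * s))) \<le> (\<bar>\<xi>\<bar> + 2) * min 1 s"
    by (simp add: abs_mult)
qed simp

lemma (in levy_density) Re_Phi_eq:
  assumes "0 < w"
  shows "Re (Phi (Complex w \<xi>)) - phi w = decay w \<xi>"
proof -
  have int: "integrable lborel (\<lambda>s. f s *\<^sub>R (1 - exp (- (Complex w \<xi> * of_real s))))"
    using assms by (intro integrable_Phi) auto
  have "Re (Phi (Complex w \<xi>)) - phi w = (\<integral>s. Re (f s *\<^sub>R (1 - exp (- (Complex w \<xi> * of_real s)))) - f s * (1 - exp (- (w * s))) \<partial>lborel)"
    unfolding Phi_def phi_def integral_Re[OF int, symmetric]
    using assms int by (intro Bochner_Integration.integral_diff[symmetric] integrable_phi integrable_Re) auto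
  also have "\<dots> = decay w \<xi>"
    unfolding decay_def by (simp add: Re_exp algebra_simps)
  finally show ?thesis .
qed

locale scaled_levy_density = levy_density f for f +
  fixes Cd \<alpha> \<beta> c C x0 :: real
  assumes Cd: "1 \<le> Cd"
    and almost_decr: "0 < x \<Longrightarrow> x \<le> y \<Longrightarrow> f y \<le> Cd * f x"
    and c: "0 < c" "c \<le> 1" and C: "1 \<le> C" and x0: "0 \<le> x0"
    and \<alpha>: "0 < \<alpha>" and \<beta>: "\<beta> < 1"
    and lower: "1 \<le> l \<Longrightarrow> x0 < w \<Longrightarrow> c * l powr \<alpha> * phi w \<le> phi (l * w)"
    and upper: "1 \<le> l \<Longrightarrow> x0 < w \<Longrightarrow> phi (l * w) \<le> C * l powr \<beta> * phi w"
begin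

text \<open>\<open>K\<close> solves \<open>c * K powr \<alpha> = 2\<close>, so passing from
  \<open>w\<close> to \<open>K * w\<close> at least doubles \<open>phi\<close>; by concavity this
  gain of \<open>phi w\<close> is paid for by the slope at \<open>w\<close>.\<close>

lemma phi_le_mom_1:
  obtains c1 where "0 < c1" "c1 \<le> 1" "\<And>w. x0 < w \<Longrightarrow> c1 * phi w \<le> w * mom 1 w"
proof -
  define K where "K = (2 / c) powr (1 / \<alpha>)"
  have K1: "1 \<le> K" unfolding K_def using c \<alpha> by (intro ge_one_powr_ge_zero) auto
  have Kc: "c * K powr \<alpha> = 2" unfolding K_def using c \<alpha> by (simp add: powr_powr)
  have "1 / K * phi w \<le> w * mom 1 w" if w: "x0 < w" for w
  proof -
    have w0: "0 < w" using w x0 by simp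
    have "2 * phi w \<le> phi (K * w)" using lower[OF K1 w] Kc by simp
    also have "phi (K * w) \<le> phi w + (K - 1) * w * mom 1 w" using phi_diff_le[OF K1 w0] by simp
    finally have "phi w \<le> (K - 1) * (w * mom 1 w)" by (simp add: mult.assoc)
    also have "\<dots> \<le> K * (w * mom 1 w)" using w0 mom_pos[OF w0, of 1] by (intro mult_right_mono) auto
    finally show ?thesis using K1 by (simp add: field_simps)
  qed
  with K1 show thesis by (intro that[of "1 / K"]) auto
qed

text \<open>As \<open>\<beta> < 1\<close>, the slope at \<open>K * w\<close> is at most of order
  \<open>K powr (\<beta> - 1) * phi w / w\<close>. \<open>K\<close> makes this half of the lower
  bound for the slope at \<open>w\<close>, and the drop between the two slopes is controlled by
  \<open>mom 2 w\<close>.\<close>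

lemma phi_le_mom_2:
  obtains c2 where "0 < c2" "\<And>w. x0 < w \<Longrightarrow> c2 * phi w \<le> w\<^sup>2 * mom 2 w"
proof -
  obtain c1 where c1: "0 < c1" "c1 \<le> 1" "\<And>w. x0 < w \<Longrightarrow> c1 * phi w \<le> w * mom 1 w"
    by (rule phi_le_mom_1) (rule that)
  define K where "K = (2 * C / c1) powr (1 / (1 - \<beta>))"
  have "1 \<le> 2 * C / c1" using c1 C by simp
  then have K1: "1 \<le> K" unfolding K_def using \<beta> by (intro ge_one_powr_ge_zero) auto
  have Kp: "K powr (1 - \<beta>) = 2 * C / c1" unfolding K_def using c1 C \<beta> by (simp add: powr_powr)
  have KC: "C * K powr \<beta> = K * c1 / 2"
  proof -
    have "K powr \<beta> * K powr (1 - \<beta>) = K" using K1 by (simp flip: powr_add)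
    then have "K powr \<beta> * (2 * C / c1) = K" unfolding Kp .
    then show ?thesis using c1 by (simp add: field_simps)
  qed
  have "c1 / (2 * K) * phi w \<le> w\<^sup>2 * mom 2 w" if w: "x0 < w" for w
  proof -
    have w0: "0 < w" using w x0 by simp
    have "K * w * mom 1 (K * w) \<le> phi (K * w)" using K1 w0 by (intro mom_1_le) auto
    also have "\<dots> \<le> C * K powr \<beta> * phi w" by (rule upper[OF K1 w])
    also have "\<dots> = K * (c1 / 2 * phi w)" unfolding KC by simp
    finally have "w * mom 1 (K * w) \<le> c1 / 2 * phi w" using K1 by (simp add: mult.assoc)
    with c1(3)[OF w] have "c1 / 2 * phi w \<le> w * (mom 1 w - mom 1 (K * w))" by (simp add: algebra_simps)
    also have "\<dots> \<le> w * ((K - 1) * w * mom 2 w)"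
      using mom_1_diff_le[OF K1 w0] w0 by (intro mult_left_mono) auto
    also have "\<dots> = (K - 1) * (w\<^sup>2 * mom 2 w)" by (simp add: power2_eq_square)
    also have "\<dots> \<le> K * (w\<^sup>2 * mom 2 w)"
      using w0 mom_pos[OF w0, of 2] by (intro mult_right_mono) auto
    finally show ?thesis using K1 by (simp add: field_simps)
  qed
  with K1 c1 show thesis by (intro that[of "c1 / (2 * K)"]) auto
qed

text \<open>On \<open>{x/2..x}\<close> the density is at least \<open>f x / Cd\<close>, so this
  interval alone contributes order \<open>x ^ 3 * f x\<close> to \<open>mom 2 (1 / x)\<close>, which
  is at most \<open>2 * x\<^sup>2 * phi (1 / x)\<close>.\<close>

lemma f_le:
  assumes x: "0 < x"
  shows "x * f x \<le> 16 * exp 1 * Cd * phi (1 / x)"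
proof -
  have "f x / Cd * (x / 2)\<^sup>2 * exp (- 1) * (x / 2) = (\<integral>s. indicator {x/2..x} s * (f x / Cd * (x / 2)\<^sup>2 * exp (- 1)) \<partial>lborel)"
    using x by (simp add: mult_ac)
  also have "\<dots> \<le> (\<integral>s. f s * (s ^ 2 * exp (- (1 / x * s))) \<partial>lborel)"
  proof (rule integral_mono)
    show "integrable lborel (\<lambda>s. indicator {x/2..x} s * (f x / Cd * (x / 2)\<^sup>2 * exp (- 1)))"
      by (intro integrable_mult_left integrable_real_indicator) (auto simp: emeasure_lborel_Icc_eq)
    show "integrable lborel (\<lambda>s. f s * (s ^ 2 * exp (- (1 / x * s))))"
      using x by (intro integrable_mom) auto
    fix s :: real
    show "indicator {x/2..x} s * (f x / Cd * (x / 2)\<^sup>2 * exp (- 1)) \<le> f s * (s ^ 2 * exp (- (1 / x * s)))"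
    proof (cases "s \<in> {x/2..x}")
      case True
      then have "f x / Cd \<le> f s" using almost_decr[of s x] x Cd by (auto simp: divide_le_eq mult.commute)
      moreover have "(x / 2)\<^sup>2 \<le> s\<^sup>2" using True x by (intro power_mono) auto
      moreover have "exp (- 1) \<le> exp (- (1 / x * s))" using True x by (simp add: divide_le_eq)
      ultimately have "f x / Cd * ((x / 2)\<^sup>2 * exp (- 1)) \<le> f s * (s\<^sup>2 * exp (- (1 / x * s)))"
        using Cd by (intro mult_mono) auto
      with True show ?thesis by (simp add: mult.assoc)
    qed (cases "s > 0"; simp)
  qed
  also have "\<dots> = mom 2 (1 / x)" by (simp add: mom_def)
  also have "\<dots> \<le> 2 * x\<^sup>2 * phi (1 / x)"
    using mom_le_phi[of "1 / x" 2] x by (simp add: field_simps)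
  finally have "f x * x ^ 3 * exp (- 1) / (8 * Cd) \<le> 2 * x\<^sup>2 * phi (1 / x)"
    by (simp add: power3_eq_cube power2_eq_square field_simps)
  then have "x\<^sup>2 * (x * f x) \<le> x\<^sup>2 * (16 * exp 1 * Cd * phi (1 / x))"
    using Cd by (simp add: field_simps exp_minus power3_eq_cube power2_eq_square)
  with x show ?thesis by simp
qed

text \<open>The second moment at the lower frequency \<open>a / x\<close> is split at
  \<open>x\<close>. Values \<open>s \<le> x\<close> contribute at most
  \<open>2 * exp 1 * x\<^sup>2 * phi (1 / x)\<close>, larger ones at most order
  \<open>x ^ 3 * f x\<close>. The whole is at least twice the first bound, so the second part must
  be large.\<close>

lemma f_ge:
  obtains a c4 where "0 < a" "a \<le> 1" "0 < c4" "\<And>x. 0 < x \<Longrightarrow> x0 < a / x \<Longrightarrow> c4 * phi (1 / x) \<le> x * f x"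
proof -
  obtain c2 where c2: "0 < c2" "\<And>w. x0 < w \<Longrightarrow> c2 * phi w \<le> w\<^sup>2 * mom 2 w"
    by (rule phi_le_mom_2) (rule that)
  \<comment> \<open>By \<open>phi_le_mom_2\<close> and \<open>upper\<close>, the second moment at
    \<open>1 / (K * x)\<close> is at least
    \<open>c2 / C * K powr (2 - \<beta>) * x\<^sup>2 * phi (1 / x)\<close>; this \<open>K\<close>
    raises the constant to \<open>4 * exp 1\<close>.\<close>
  define K where "K = max 1 ((4 * exp 1 * C / c2) powr (1 / (2 - \<beta>)))"
  define a where "a = 1 / K"
  have K1: "1 \<le> K" by (simp add: K_def)
  then have a: "0 < a" "a \<le> 1" by (auto simp: a_def)
  have Kp: "4 * exp 1 * C / c2 \<le> K powr (2 - \<beta>)"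
  proof -
    have "4 * exp 1 * C / c2 = ((4 * exp 1 * C / c2) powr (1 / (2 - \<beta>))) powr (2 - \<beta>)"
      using c2 C \<beta> by (simp add: powr_powr)
    also have "\<dots> \<le> K powr (2 - \<beta>)" using \<beta> by (intro powr_mono2) (auto simp: K_def)
    finally show ?thesis .
  qed
  have "exp 1 * a ^ 3 / Cd * phi (1 / x) \<le> x * f x" if x: "0 < x" "x0 < a / x" for x
  proof -
    have ax: "0 < a / x" using a x by simp
    have "4 * exp 1 * phi (1 / x) * x\<^sup>2 \<le> mom 2 (a / x)"
    proof -
      have "phi (1 / x) = phi (K * (a / x))" using K1 by (simp add: a_def)
      also have "\<dots> \<le> C * K powr \<beta> * phi (a / x)" by (rule upper[OF K1 x(2)])
      finally have le: "phi (1 / x) \<le> C * K powr \<beta> * phi (a / x)" .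
      have "K powr (2 - \<beta>) * (K powr \<beta>) = K\<^sup>2"
        using K1 by (simp flip: powr_add)
      then have "4 * exp 1 * C / c2 * K powr \<beta> \<le> K\<^sup>2"
        using mult_right_mono[OF Kp, of "K powr \<beta>"] by simp
      then have KK: "4 * exp 1 * (C * K powr \<beta>) \<le> c2 * K\<^sup>2"
        using c2 by (simp add: field_simps)
      have "4 * exp 1 * phi (1 / x) \<le> 4 * exp 1 * (C * K powr \<beta> * phi (a / x))"
        using le by simp
      also have "\<dots> = (4 * exp 1 * (C * K powr \<beta>)) * phi (a / x)" by simp
      also have "\<dots> \<le> (c2 * K\<^sup>2) * phi (a / x)"
        using KK phi_pos[OF ax] by (intro mult_right_mono) auto
      also have "\<dots> = K\<^sup>2 * (c2 * phi (a / x))" by simp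
      also have "\<dots> \<le> K\<^sup>2 * ((a / x)\<^sup>2 * mom 2 (a / x))"
        using c2(2)[OF x(2)] by (intro mult_left_mono) auto
      also have "\<dots> = mom 2 (a / x) / x\<^sup>2" using K1 by (simp add: a_def field_simps power2_eq_square)
      finally show ?thesis using x by (simp add: field_simps)
    qed
    also have "mom 2 (a / x) \<le> (\<integral>s. exp 1 * (f s * (s ^ 2 * exp (- (1 / x * s)))) + Cd * f x * (indicator {0..} s * (s\<^sup>2 * exp (- (a / x * s)))) \<partial>lborel)"
      unfolding mom_def
    proof (rule integral_mono)
      show "integrable lborel (\<lambda>s. f s * (s ^ 2 * exp (- (a / x * s))))" using ax by (intro integrable_mom) auto
      show "integrable lborel (\<lambda>s. exp 1 * (f s * (s ^ 2 * exp (- (1 / x * s)))) + Cd * f x * (indicator {0..} s * (s\<^sup>2 * exp (- (a / x * s)))))"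
        using x has_bochner_integral_square_exp[OF ax]
        by (intro Bochner_Integration.integrable_add integrable_mult_right integrable_mom) (auto simp: has_bochner_integral_iff)
      fix s :: real
      have nn: "0 \<le> exp 1 * (f s * (s ^ 2 * exp (- (1 / x * s))))" "0 \<le> Cd * f x * (indicator {0..} s * (s\<^sup>2 * exp (- (a / x * s))))"
        using Cd by auto
      show "f s * (s ^ 2 * exp (- (a / x * s))) \<le> exp 1 * (f s * (s ^ 2 * exp (- (1 / x * s)))) + Cd * f x * (indicator {0..} s * (s\<^sup>2 * exp (- (a / x * s))))"
      proof (cases "s \<le> x")
        case True
        show ?thesis
        proof (cases "0 < s")
          case s: True
          have "exp (- (a / x * s)) \<le> exp (1 - 1 / x * s)"
          proof -
            have "0 \<le> a / x * s" using ax s by (intro mult_nonneg_nonneg) auto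
            moreover have "1 / x * s \<le> 1" using x True by simp
            ultimately show ?thesis by (simp only: exp_le_cancel_iff)
          qed
          then have "f s * (s ^ 2 * exp (- (a / x * s))) \<le> f s * (s ^ 2 * exp (1 - 1 / x * s))"
            by (intro mult_left_mono) auto
          also have "\<dots> = exp 1 * (f s * (s ^ 2 * exp (- (1 / x * s))))"
            by (simp add: exp_diff exp_minus divide_inverse)
          finally show ?thesis using nn(2) by simp
        qed (use nn in simp)
      next
        case False
        then have "f s * (s ^ 2 * exp (- (a / x * s))) \<le> Cd * f x * (s ^ 2 * exp (- (a / x * s)))"
          using almost_decr[of x s] x by (intro mult_right_mono) auto
        also have "\<dots> = Cd * f x * (indicator {0..} s * (s\<^sup>2 * exp (- (a / x * s))))"
          using False x by simp
        finally show ?thesis using nn(1) by linarith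
      qed
    qed
    also have "\<dots> = exp 1 * mom 2 (1 / x) + Cd * f x * (2 / (a / x) ^ 3)"
      using x has_bochner_integral_square_exp[OF ax] integrable_mom[of "1 / x" 2] unfolding mom_def
      by (subst Bochner_Integration.integral_add)
         (auto intro!: integrable_mult_right simp: has_bochner_integral_iff)
    also have "mom 2 (1 / x) \<le> 2 * x\<^sup>2 * phi (1 / x)"
      using mom_le_phi[of "1 / x" 2] x by (simp add: field_simps)
    finally have "4 * exp 1 * phi (1 / x) * x\<^sup>2 \<le> exp 1 * (2 * x\<^sup>2 * phi (1 / x)) + Cd * f x * (2 / (a / x) ^ 3)"
      by simp
    then have "4 * (exp 1 * phi (1 / x) * x\<^sup>2) \<le> 2 * (exp 1 * phi (1 / x) * x\<^sup>2) + 2 * (Cd * f x * (1 / (a / x) ^ 3))"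
      by (simp add: mult_ac)
    then have "exp 1 * phi (1 / x) * x\<^sup>2 \<le> Cd * f x * (1 / (a / x) ^ 3)" by linarith
    also have "\<dots> = Cd / a ^ 3 * (x * f x) * x\<^sup>2" using x by (simp add: field_simps power3_eq_cube power2_eq_square)
    finally have "exp 1 * phi (1 / x) \<le> Cd / a ^ 3 * (x * f x)"
      by (rule mult_right_le_imp_le) (use x in simp)
    then show ?thesis using a Cd by (simp add: field_simps)
  qed
  moreover have "0 < exp 1 * a ^ 3 / Cd" using a Cd by simp
  ultimately show thesis using a by (intro that[of a "exp 1 * a ^ 3 / Cd"]) auto
qed

text \<open>Only \<open>s\<close> between \<open>1 / (2 * v)\<close> and \<open>1 / v\<close> is
  kept. There \<open>w * s\<close> and \<open>\<bar>\<xi> * s\<bar>\<close> are at most one, so the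
  exponential weight is bounded below, the cosine is in its quadratic range, and \<open>f s\<close>
  is at least of order \<open>v * phi v\<close>.\<close>

lemma decay_ge:
  obtains a c5 where "0 < a" "a \<le> 1" "0 < c5"
    "\<And>w \<xi> v. 0 < w \<Longrightarrow> v = max w \<bar>\<xi>\<bar> \<Longrightarrow> x0 < a * v \<Longrightarrow> c5 * phi v * (\<xi> / v)\<^sup>2 \<le> decay w \<xi>"
proof -
  obtain a c4 where a: "0 < a" "a \<le> 1" and c4: "0 < c4"
    and fge: "\<And>x. 0 < x \<Longrightarrow> x0 < a / x \<Longrightarrow> c4 * phi (1 / x) \<le> x * f x"
    by (rule f_ge) (rule that)
  have "c4 * exp (- 1) / 32 * phi v * (\<xi> / v)\<^sup>2 \<le> decay w \<xi>"
    if w: "0 < w" and v: "v = max w \<bar>\<xi>\<bar>" and x0v: "x0 < a * v" for w \<xi> v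
  proof -
    have v0: "0 < v" "\<bar>\<xi>\<bar> \<le> v" "w \<le> v" using w v by auto
    let ?k = "c4 * phi v * v * (\<xi>\<^sup>2 * (1 / (2 * v))\<^sup>2 / 4 * exp (- 1))"
    have "1 / v - 1 / (2 * v) = 1 / (2 * v)" using v0 by (simp add: divide_simps)
    then have "c4 * exp (- 1) / 32 * phi v * (\<xi> / v)\<^sup>2 = ?k * (1 / v - 1 / (2 * v))"
      using v0 by (simp add: power_divide power2_eq_square)
    also have "\<dots> = (\<integral>s. indicator {1 / (2 * v) .. 1 / v} s * ?k \<partial>lborel)"
    proof -
      have "1 / (2 * v) \<le> 1 / v" using v0 by (intro divide_left_mono) auto
      then show ?thesis by (simp add: mult.commute)
    qed
    also have "\<dots> \<le> decay w \<xi>"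
      unfolding decay_def
    proof (rule integral_mono)
      show "integrable lborel (\<lambda>s. indicator {1 / (2 * v) .. 1 / v} s * ?k)"
        by (intro integrable_mult_left integrable_real_indicator) (auto simp: emeasure_lborel_Icc_eq)
      show "integrable lborel (\<lambda>s. f s * ((1 - cos (\<xi> * s)) * exp (- (w * s))))" by (rule integrable_decay[OF w])
      fix s :: real
      show "indicator {1 / (2 * v) .. 1 / v} s * ?k \<le> f s * ((1 - cos (\<xi> * s)) * exp (- (w * s)))"
      proof (cases "s \<in> {1 / (2 * v) .. 1 / v}")
        case True
        have "0 < 1 / (2 * v)" using v0 by simp
        then have s: "0 < s" using True unfolding atLeastAtMost_iff by linarith
        have s1: "s * v \<le> 1" using True v0 by (simp add: pos_le_divide_eq)
        then have s2: "v \<le> 1 / s" using s by (simp add: pos_le_divide_eq mult.commute)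
        have "c4 * phi v \<le> c4 * phi (1 / s)" using s2 c4 v0 by (intro mult_left_mono phi_mono) auto
        also have "\<dots> \<le> s * f s"
        proof (rule fge[OF s])
          have "a * v \<le> a * (1 / s)" using a s2 by (intro mult_left_mono) auto
          with x0v show "x0 < a / s" by simp
        qed
        finally have "v * (c4 * phi v) \<le> v * (s * f s)" using v0 by (intro mult_left_mono) auto
        also have "\<dots> = (s * v) * f s" by simp
        also have "\<dots> \<le> 1 * f s" using s1 by (intro mult_right_mono) auto
        finally have 1: "c4 * phi v * v \<le> f s" by (simp add: mult_ac)
        have "\<bar>\<xi> * s\<bar> \<le> v * s" using v0 s by (simp add: abs_mult)
        then have "(\<xi> * s)\<^sup>2 / 4 \<le> 1 - cos (\<xi> * s)" using s1 by (intro one_minus_cos_ge) (simp add: mult.commute)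
        moreover have "\<xi>\<^sup>2 * (1 / (2 * v))\<^sup>2 \<le> \<xi>\<^sup>2 * s\<^sup>2"
          using True v0 by (intro mult_left_mono power_mono) auto
        ultimately have 2: "\<xi>\<^sup>2 * (1 / (2 * v))\<^sup>2 / 4 \<le> 1 - cos (\<xi> * s)" by (simp add: power_mult_distrib)
        have "w * s \<le> v * s" using v0 s by (intro mult_right_mono) auto
        then have 3: "exp (- 1) \<le> exp (- (w * s))" using s1 by (simp add: mult.commute)
        have "?k \<le> f s * ((1 - cos (\<xi> * s)) * exp (- (w * s)))"
          using 1 2 3 c4 v0 phi_pos[of v] by (intro mult_mono) auto
        then show ?thesis using True by simp
      qed simp
    qed
    finally show ?thesis .
  qed
  with a c4 show thesis by (intro that[of a "c4 * exp (- 1) / 32"]) auto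
qed

text \<open>Shape of the lower bound for the decay at \<open>\<xi> = w * \<eta>\<close>: quadratic
  while \<open>w\<close> dominates, with the growth of the lower scaling condition once the
  frequency does.\<close>

definition ker :: "real \<Rightarrow> real"
  where "ker \<eta> = (if \<bar>\<eta>\<bar> \<le> 1 then \<eta>\<^sup>2 else \<bar>\<eta>\<bar> powr \<alpha>)"

lemma decay_scaled_ge:
  obtains a c6 where "0 < a" "a \<le> 1" "0 < c6"
    "\<And>w \<eta>. 0 < w \<Longrightarrow> x0 < a * w \<Longrightarrow> c6 * phi w * ker \<eta> \<le> decay w (w * \<eta>)"
proof -
  obtain a c5 where a: "0 < a" "a \<le> 1" "0 < c5"
    and dec: "\<And>w \<xi> v. 0 < w \<Longrightarrow> v = max w \<bar>\<xi>\<bar> \<Longrightarrow> x0 < a * v \<Longrightarrow> c5 * phi v * (\<xi> / v)\<^sup>2 \<le> decay w \<xi>"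
    by (rule decay_ge) (rule that)
  have "c5 * c * phi w * ker \<eta> \<le> decay w (w * \<eta>)" if w: "0 < w" "x0 < a * w" for w \<eta>
  proof (cases "\<bar>\<eta>\<bar> \<le> 1")
    case True
    then have m: "w = max w \<bar>w * \<eta>\<bar>" using w by (simp add: abs_mult)
    have "c5 * c * phi w * \<eta>\<^sup>2 \<le> c5 * 1 * phi w * \<eta>\<^sup>2"
      using a c phi_pos[of w] w by (intro mult_right_mono mult_left_mono) auto
    also have "\<dots> \<le> decay w (w * \<eta>)"
      using dec[OF w(1) m w(2)] w by simp
    finally show ?thesis using True by (simp add: ker_def)
  next
    case False
    then have m: "\<bar>\<eta>\<bar> * w = max w \<bar>w * \<eta>\<bar>" using w by (simp add: abs_mult mult.commute)
    have aw: "a * w \<le> a * (\<bar>\<eta>\<bar> * w)" using False w a by (intro mult_left_mono) auto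
    have "a * w \<le> 1 * w" using a w by (intro mult_right_mono) auto
    with w have "x0 < w" by linarith
    then have "c5 * (c * \<bar>\<eta>\<bar> powr \<alpha> * phi w) \<le> c5 * phi (\<bar>\<eta>\<bar> * w)"
      using lower[of "\<bar>\<eta>\<bar>" w] False a by (intro mult_left_mono) auto
    also have "\<dots> = c5 * phi (\<bar>\<eta>\<bar> * w) * (w * \<eta> / (\<bar>\<eta>\<bar> * w))\<^sup>2"
      using w False by (simp add: power_divide power_mult_distrib)
    also have "\<dots> \<le> decay w (w * \<eta>)"
      using aw w by (intro dec[OF w(1) m]) auto
    finally show ?thesis using False by (simp add: ker_def mult_ac)
  qed
  with a c show thesis by (intro that[of a "c5 * c"]) auto
qed

end

section \<open>Laws with a given Laplace exponent\<close>

lemma continuous_eq_of_AE_lborel_eq: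
  fixes p q :: "real \<Rightarrow> real"
  assumes "continuous_on UNIV p" "continuous_on UNIV q" and ae: "AE x in lborel. p x = q x"
  shows "p = q"
proof
  fix x
  have "continuous_on {x - 1..x + 1} p" "continuous_on {x - 1..x + 1} q"
    using assms by (auto intro: continuous_on_subset)
  with ae show "p x = q x"
    by (intro antisym AE_lborel_le_imp_le[of "x - 1" "x + 1"]) (auto elim: eventually_mono)
qed

lemma continuous_density_unique:
  fixes p q :: "real \<Rightarrow> real"
  assumes "continuous_on UNIV p" "continuous_on UNIV q" "\<And>x. 0 \<le> p x" "\<And>x. 0 \<le> q x"
    and eq: "density lborel (\<lambda>x. ennreal (p x)) = density lborel (\<lambda>x. ennreal (q x))"
  shows "p = q"
proof (rule continuous_eq_of_AE_lborel_eq)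
  have [measurable]: "p \<in> borel_measurable borel" "q \<in> borel_measurable borel"
    using assms by (auto intro: borel_measurable_continuous_onI)
  have "AE x in lborel. ennreal (p x) = ennreal (q x)"
    using eq by (intro sigma_finite_measure.density_unique[OF sigma_finite_lborel]) auto
  then show "AE x in lborel. p x = q x" using assms by simp
qed fact+

locale levy_law = levy_density f + real_distribution P for f P +
  fixes t :: real
  assumes t_pos: "0 < t"
    and nonneg: "AE x in P. 0 \<le> x"
    and laplace: "0 \<le> w \<Longrightarrow> (\<integral>x. exp (- (w * x)) \<partial>P) = exp (- (t * phi w))"
begin

text \<open>The indicator makes the integrand bounded at every point and not just almost everywhere,
  as \<open>has_field_derivative_integral\<close> requires.\<close>

definition LT :: "complex \<Rightarrow> complex"
  where "LT z = (\<integral>x. indicator {0..} x *\<^sub>R exp (- (z * of_real x)) \<partial>P)"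

definition LT' :: "complex \<Rightarrow> complex"
  where "LT' z = (\<integral>x. indicator {0..} x *\<^sub>R (of_real x * exp (- (z * of_real x))) \<partial>P)"

lemma integrable_exp_minus: "0 \<le> w \<Longrightarrow> integrable P (\<lambda>x. exp (- (w * x)))"
  by (rule integrable_const_bound[where B=1]) (use nonneg in auto)

lemma integrable_LT: "0 \<le> Re z \<Longrightarrow> integrable P (\<lambda>x. indicator {0..} x *\<^sub>R exp (- (z * of_real x)))"
  by (rule integrable_const_bound[where B=1]) (auto simp: indicator_def)

lemma integrable_LT': "0 < Re z \<Longrightarrow> integrable P (\<lambda>x. indicator {0..} x *\<^sub>R (of_real x * exp (- (z * of_real x))))"
proof (rule integrable_const_bound[where B="1 / Re z"])
  assume "0 < Re z"
  then show "AE x in P. norm (indicator {0..} x *\<^sub>R (of_real x * exp (- (z * of_real x)))) \<le> 1 / Re z"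
    using power_times_exp_minus_le_const[of _ "Re z" 1] by (auto simp: indicator_def norm_mult)
qed simp

lemma LT_of_real: "0 \<le> w \<Longrightarrow> LT (of_real w) = of_real (exp (- (t * phi w)))"
  unfolding laplace[symmetric] LT_def integral_complex_of_real[symmetric]
  using nonneg by (intro integral_cong_AE) (auto simp: exp_minus_of_real)

lemma LT_has_derivative:
  assumes z0: "0 < Re z0"
  shows "(LT has_field_derivative - LT' z0) (at z0)"
proof -
  have "((\<lambda>z. \<integral>x. indicator {0..} x *\<^sub>R exp (- (z * of_real x)) \<partial>P) has_field_derivative
     (\<integral>x. - (indicator {0..} x *\<^sub>R (of_real x * exp (- (z0 * of_real x)))) \<partial>P)) (at z0)"
  proof (rule has_field_derivative_integral[where S="{z. Re z0 / 2 < Re z}" and w="\<lambda>_. 2 / Re z0"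
        and h'="\<lambda>z x. - (indicator {0..} x *\<^sub>R (of_real x * exp (- (z * of_real x))))"])
    show "norm (- (indicator {0..} x *\<^sub>R (of_real x * exp (- (z * of_real x))))) \<le> 2 / Re z0"
      if z: "z \<in> {z. Re z0 / 2 < Re z}" for z x
    proof (cases "0 \<le> x")
      case True
      have "x ^ 1 * exp (- (Re z * x)) \<le> fact 1 / Re z ^ 1"
        using True z z0 by (intro power_times_exp_minus_le_const) auto
      also have "\<dots> \<le> 2 / Re z0" using z z0 by (auto simp: field_simps)
      finally show ?thesis using True by (simp add: norm_mult)
    qed (use z0 in simp)
    show "((\<lambda>z. indicator {0..} x *\<^sub>R exp (- (z * of_real x))) has_field_derivative
       - (indicator {0..} x *\<^sub>R (of_real x * exp (- (z * of_real x))))) (at z)" for z and x :: real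
      unfolding scaleR_conv_of_real by (auto intro!: derivative_eq_intros)
    show "open {z. Re z0 / 2 < Re z}" by (rule open_halfspace_Re_gt)
    show "convex {z. Re z0 / 2 < Re z}" by (rule convex_halfspace_Re_gt)
    show "integrable P (\<lambda>x. indicator {0..} x *\<^sub>R exp (- (z * of_real x)))" if "z \<in> {z. Re z0 / 2 < Re z}" for z
      using that z0 by (intro integrable_LT) auto
  qed (use z0 in auto)
  then show ?thesis unfolding LT_def[abs_def] LT'_def by simp
qed

text \<open>
  The Laplace transform is only given on the positive half line; the characteristic function comes
  from analytic continuation to the right half plane.
\<close>

lemma LT_eq:
  assumes z: "0 < Re z"
  shows "LT z = exp (- (t * Phi z))"
proof -
  let ?S = "{z. 0 < Re z}"
  have "LT z - exp (- (t * Phi z)) = 0"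
  proof (rule analytic_continuation[where f="\<lambda>z. LT z - exp (- (t * Phi z))" and S="?S" and U="of_real ` {0<..}" and \<xi>=1])
    show "(\<lambda>z. LT z - exp (- (t * Phi z))) holomorphic_on ?S"
    proof (intro holomorphic_intros)
      show "LT holomorphic_on ?S"
        unfolding holomorphic_on_def field_differentiable_def
        using LT_has_derivative by (auto intro: has_field_derivative_at_within)
      show "Phi holomorphic_on ?S"
        unfolding holomorphic_on_def field_differentiable_def
        using Phi_has_derivative by (auto intro: has_field_derivative_at_within)
    qed
    show "open ?S" by (rule open_halfspace_Re_gt)
    show "connected ?S" by (rule convex_connected, rule convex_halfspace_Re_gt)
    show "1 islimpt (of_real ` {0<..} :: complex set)"
      unfolding islimpt_approachable
    proof (intro allI impI)
      fix e :: real assume "0 < e"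
      then show "\<exists>x'\<in>of_real ` {0<..}. x' \<noteq> (1::complex) \<and> dist x' 1 < e"
        by (intro bexI[of _ "of_real (1 + e / 2)"] imageI) (auto simp: dist_norm norm_divide)
    qed
    show "LT z - exp (- (t * Phi z)) = 0" if "z \<in> of_real ` {0<..}" for z
      using that by (auto simp: LT_of_real Phi_of_real simp flip: exp_of_real)
  qed (use z in auto)
  then show ?thesis by simp
qed

text \<open>Differentiation of both expressions for the transform; this is the size bias identity on
  the transform side.\<close>

lemma LT'_eq:
  assumes z: "0 < Re z"
  shows "LT' z = t * Phi' z * LT z"
proof -
  let ?S = "{z. 0 < Re z}"
  have "((\<lambda>z. exp (- (t * Phi z))) has_field_derivative - (t * Phi' z * LT z)) (at z)"
    using z by (auto intro!: derivative_eq_intros Phi_has_derivative simp: LT_eq)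
  moreover have "open ?S" by (rule open_halfspace_Re_gt)
  ultimately have "(LT has_field_derivative - (t * Phi' z * LT z)) (at z)"
    by (rule has_field_derivative_transform_within_open) (use z in \<open>auto simp: LT_eq\<close>)
  with LT_has_derivative[OF z] have "- LT' z = - (t * Phi' z * LT z)" by (rule DERIV_unique)
  then show ?thesis by simp
qed

text \<open>The Esscher transform of \<open>P\<close>, normalised by \<open>exp (t * phi w)\<close>.
  It moves Fourier inversion to the vertical line through \<open>w\<close>.\<close>

definition tilted :: "real \<Rightarrow> real measure"
  where "tilted w = density P (\<lambda>x. ennreal (exp (t * phi w - w * x)))"

lemma exp_tilt_eq: "exp (t * phi w - w * x) = exp (t * phi w) * exp (- (w * x))"
  by (simp flip: exp_add)

lemma real_distribution_tilted:
  assumes w: "0 \<le> w"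
  shows "real_distribution (tilted w)"
proof -
  have "(\<integral>\<^sup>+x. ennreal (exp (t * phi w - w * x)) \<partial>P) = ennreal (\<integral>x. exp (t * phi w - w * x) \<partial>P)"
    using integrable_exp_minus[OF w] by (intro nn_integral_eq_integral) (auto simp: exp_tilt_eq)
  also have "(\<integral>x. exp (t * phi w - w * x) \<partial>P) = exp (t * phi w) * (\<integral>x. exp (- (w * x)) \<partial>P)"
    unfolding exp_tilt_eq by (rule integral_mult_right_zero)
  also have "\<dots> = 1"
    unfolding laplace[OF w] by (simp add: exp_minus)
  also have "ennreal 1 = 1" by simp
  finally have "prob_space (tilted w)"
    unfolding tilted_def by (intro prob_spaceI) (simp add: emeasure_density)
  then show ?thesis
    by (auto simp: real_distribution_def real_distribution_axioms_def tilted_def)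
qed

lemma char_tilted:
  assumes w: "0 < w"
  shows "char (tilted w) \<xi> = exp (of_real (t * phi w) - t * Phi (Complex w (- \<xi>)))"
proof -
  have "char (tilted w) \<xi> = (\<integral>x. exp (t * phi w - w * x) *\<^sub>R iexp (\<xi> * x) \<partial>P)"
    unfolding char_def tilted_def by (subst integral_density) auto
  also have "\<dots> = (\<integral>x. of_real (exp (t * phi w)) * (indicator {0..} x *\<^sub>R exp (- (Complex w (- \<xi>) * of_real x))) \<partial>P)"
  proof (rule integral_cong_AE)
    show "AE x in P. exp (t * phi w - w * x) *\<^sub>R iexp (\<xi> * x) =
         of_real (exp (t * phi w)) * (indicator {0..} x *\<^sub>R exp (- (Complex w (- \<xi>) * of_real x)))"
      using nonneg
    proof eventually_elim
      case (elim x)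
      have "exp (- (Complex w (- \<xi>) * of_real x)) = of_real (exp (- (w * x))) * iexp (\<xi> * x)"
        by (simp add: complex_eq_iff exp_of_real Re_exp Im_exp)
      with elim show ?case by (simp add: exp_tilt_eq scaleR_conv_of_real)
    qed
  qed auto
  also have "\<dots> = of_real (exp (t * phi w)) * LT (Complex w (- \<xi>))"
    unfolding LT_def by (rule integral_mult_right_zero)
  also have "\<dots> = exp (of_real (t * phi w) - t * Phi (Complex w (- \<xi>)))"
    using w unfolding exp_of_real[symmetric] by (simp add: LT_eq exp_diff exp_minus divide_inverse)
  finally show ?thesis .
qed

lemma decay_minus: "decay w (- \<xi>) = decay w \<xi>"
  by (simp add: decay_def)

lemma norm_char_tilted:
  assumes "0 < w"
  shows "norm (char (tilted w) \<xi>) = exp (- (t * decay w \<xi>))"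
  using Re_Phi_eq[OF assms, of "- \<xi>"]
  by (simp add: char_tilted[OF assms] decay_minus algebra_simps)

text \<open>Density of the tilted law by Fourier inversion. Undoing the tilt multiplies it by
  \<open>exp (w * x - t * phi w)\<close>, a factor that for fixed \<open>x\<close> is smallest at
  the saddle point \<open>t * mom 1 w = x\<close>.\<close>

definition inv_density :: "real \<Rightarrow> real \<Rightarrow> real"
  where "inv_density w x = (\<integral>\<xi>. Re (iexp (- (\<xi> * x)) * char (tilted w) \<xi>) \<partial>lborel) / (2 * pi)"

lemma inv_density:
  assumes w: "0 < w" and int: "integrable lborel (\<lambda>\<xi>. exp (- (t * decay w \<xi>)))"
  shows "0 \<le> inv_density w x" "continuous_on UNIV (inv_density w)"
    and "P = density lborel (\<lambda>x. ennreal (exp (w * x - t * phi w) * inv_density w x))"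
proof -
  interpret Q: real_distribution "tilted w" using w by (intro real_distribution_tilted) simp
  have ch: "integrable lborel (char (tilted w))"
    by (rule Bochner_Integration.integrable_bound[OF int]) (auto simp: norm_char_tilted[OF w])
  note D = real_distribution_density_of_integrable_char[OF Q.real_distribution_axioms ch, folded inv_density_def]
  show "0 \<le> inv_density w x" by (rule D(1))
  show cont: "continuous_on UNIV (inv_density w)" using D(2) unfolding inv_density_def .
  then have [measurable]: "inv_density w \<in> borel_measurable borel" by (rule borel_measurable_continuous_onI)
  have "P = density P (\<lambda>x. ennreal (exp (t * phi w - w * x)) * ennreal (exp (w * x - t * phi w)))"
    by (simp add: density_1 flip: ennreal_mult exp_add)
  also have "\<dots> = density (tilted w) (\<lambda>x. ennreal (exp (w * x - t * phi w)))"
    unfolding tilted_def by (subst density_density_eq) auto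
  also have "tilted w = density lborel (\<lambda>x. ennreal (inv_density w x))" by (rule D(3))
  also have "density (density lborel (\<lambda>x. ennreal (inv_density w x))) (\<lambda>x. ennreal (exp (w * x - t * phi w)))
     = density lborel (\<lambda>x. ennreal (exp (w * x - t * phi w) * inv_density w x))"
    by (subst density_density_eq) (auto simp: mult.commute ennreal_mult D(1))
  finally show "P = density lborel (\<lambda>x. ennreal (exp (w * x - t * phi w) * inv_density w x))" .
qed

text \<open>On the nonnegative axis \<open>exp (- (w * x))\<close> is at most \<open>1\<close> up to
  \<open>r\<close> and at most \<open>exp (- (w * r))\<close> beyond; taking expectations turns the
  Laplace transform into a small ball bound.\<close>

lemma prob_atMost_ge:
  assumes "0 \<le> w" "0 \<le> r"
  shows "exp (- (t * phi w)) - exp (- (w * r)) \<le> prob {..r}"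
proof -
  have "exp (- (t * phi w)) = (\<integral>x. exp (- (w * x)) \<partial>P)" using laplace assms by simp
  also have "\<dots> \<le> (\<integral>x. indicator {..r} x + exp (- (w * r)) \<partial>P)"
  proof (rule integral_mono_AE)
    show "AE x in P. exp (- (w * x)) \<le> indicator {..r} x + exp (- (w * r))"
      using nonneg
    proof eventually_elim
      case (elim x)
      show ?case
      proof (cases "x \<le> r")
        case True
        then have "exp (- (w * x)) \<le> 1" using elim assms by simp
        then show ?thesis using True by (simp add: add_increasing2)
      next
        case False
        then have "w * r \<le> w * x" using assms by (intro mult_left_mono) auto
        then show ?thesis using False by simp
      qed
    qed
    show "integrable P (\<lambda>x. indicator {..r} x + exp (- (w * r)))"
      by (intro Bochner_Integration.integrable_add integrable_const integrable_const_bound[where B=1]) auto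
  qed (use assms integrable_exp_minus in auto)
  also have "\<dots> = prob {..r} + exp (- (w * r))"
    using prob_space by (subst Bochner_Integration.integral_add)
       (auto intro!: integrable_const_bound[where B=1])
  finally show ?thesis by simp
qed

end

locale levy_law_density = levy_law f P t for f P t +
  fixes p :: "real \<Rightarrow> real"
  assumes p_nonneg[simp]: "0 \<le> p x" and p_cont: "continuous_on UNIV p"
    and P_eq: "P = density lborel (\<lambda>x. ennreal (p x))"
begin

lemma p_measurable[measurable]: "p \<in> borel_measurable borel"
  using p_cont by (rule borel_measurable_continuous_onI)

lemma p_eq:
  assumes w: "0 < w" and int: "integrable lborel (\<lambda>\<xi>. exp (- (t * decay w \<xi>)))"
  shows "p x = exp (w * x - t * phi w) * inv_density w x"
proof -
  note D = inv_density[OF assms]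
  have "p = (\<lambda>x. exp (w * x - t * phi w) * inv_density w x)"
  proof (rule continuous_density_unique)
    show "continuous_on UNIV (\<lambda>x. exp (w * x - t * phi w) * inv_density w x)"
      by (intro continuous_intros D)
    show "density lborel (\<lambda>x. ennreal (p x)) = density lborel (\<lambda>x. ennreal (exp (w * x - t * phi w) * inv_density w x))"
      using D(3) P_eq by simp
  qed (use D(1) p_cont in auto)
  then show ?thesis by simp
qed

lemma AE_p_neg: "AE x in lborel. x < 0 \<longrightarrow> p x = 0"
proof -
  have "AE x in lborel. 0 < ennreal (p x) \<longrightarrow> 0 \<le> x"
    using nonneg unfolding P_eq by (subst (asm) AE_density) auto
  then show ?thesis
  proof eventually_elim
    case (elim x)
    then show ?case by (auto simp: not_less intro: antisym)
  qed
qed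

lemma nn_integral_P: "g \<in> borel_measurable borel \<Longrightarrow> (\<integral>\<^sup>+x. g x \<partial>P) = (\<integral>\<^sup>+x. ennreal (p x) * g x \<partial>lborel)"
  by (subst P_eq, subst nn_integral_density) auto

lemma nn_integral_p: "(\<integral>\<^sup>+x. ennreal (p x) \<partial>lborel) = 1"
  using nn_integral_P[of "\<lambda>_. 1"] emeasure_space_1 by simp

text \<open>
  Differentiating the Laplace transform gives \<open>x P(dx) = t (s f(s) ds) * P\<close>; this
  identity replaces all jump decomposition arguments.
\<close>

lemma AE_size_bias:
  "AE x in lborel. ennreal (x * p x) = (\<integral>\<^sup>+y. ennreal (t * ((x - y) * f (x - y))) * ennreal (p y) \<partial>lborel)"
proof -
  \<comment> \<open>The weight \<open>exp (- x)\<close> makes all three measures finite, which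
    \<open>x * p x\<close> and \<open>s * f s\<close> alone need not be. Being multiplicative, it
    passes through the convolution and is removed at the end.\<close>
  let ?a = "\<lambda>x. ennreal (x * exp (- x) * p x)"
  let ?b = "\<lambda>s. ennreal (t * (s * f s) * exp (- s))"
  let ?q = "\<lambda>x. ennreal (exp (- x) * p x)"
  let ?A = "density lborel ?a" and ?B = "density lborel ?b" and ?Q = "density lborel ?q"
  have A: "?A = density P (\<lambda>x. ennreal (x * exp (- x)))"
    unfolding P_eq by (subst density_density_eq) (simp_all add: mult.commute flip: ennreal_mult')
  have Q: "?Q = density P (\<lambda>x. ennreal (exp (- x)))"
    unfolding P_eq by (subst density_density_eq) (simp_all add: mult.commute flip: ennreal_mult')
  have bnn: "0 \<le> t * (s * f s) * exp (- s)" for s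
    using t_pos by (cases "s > 0") auto
  have intA: "integrable P (\<lambda>x. indicator {0..} x *\<^sub>R (x * exp (- x)))"
    using integrable_Re[OF integrable_LT'[of 1]] by (simp add: exp_minus_of_real Re_exp)
  have finA: "finite_measure ?A"
  proof (rule finite_measureI)
    have "emeasure ?A (space ?A) = (\<integral>\<^sup>+x. ennreal (x * exp (- x)) \<partial>P)"
      unfolding A by (simp add: emeasure_density)
    also have "\<dots> = (\<integral>\<^sup>+x. ennreal (indicator {0..} x *\<^sub>R (x * exp (- x))) \<partial>P)"
      by (intro nn_integral_cong) (auto simp: indicator_def ennreal_neg mult_nonpos_nonneg)
    also have "\<dots> < \<infinity>"
      using intA by (subst nn_integral_eq_integral) (auto simp: indicator_def)
    finally show "emeasure ?A (space ?A) \<noteq> \<infinity>" by simp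
  qed
  have finB: "finite_measure ?B"
  proof (rule finite_measureI)
    have "emeasure ?B (space ?B) = (\<integral>\<^sup>+s. ennreal (t * (f s * (s ^ 1 * exp (- (1 * s))))) \<partial>lborel)"
      by (simp add: emeasure_density mult_ac)
    also have "\<dots> < \<infinity>"
      using integrable_mult_right[OF integrable_mom[of 1 1], of t] bnn
      by (subst nn_integral_eq_integral) (auto simp: mult_ac)
    finally show "emeasure ?B (space ?B) \<noteq> \<infinity>" by simp
  qed
  have finQ: "finite_measure ?Q"
  proof (rule finite_measureI)
    have "emeasure ?Q (space ?Q) = (\<integral>\<^sup>+x. ennreal (exp (- (1 * x))) \<partial>P)"
      unfolding Q by (simp add: emeasure_density)
    also have "\<dots> < \<infinity>"
      using integrable_exp_minus[of 1] by (subst nn_integral_eq_integral) auto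
    finally show "emeasure ?Q (space ?Q) \<noteq> \<infinity>" by simp
  qed
  interpret B: finite_measure ?B by (rule finB)
  interpret Q: finite_measure ?Q by (rule finQ)
  interpret BQ: pair_sigma_finite ?B ?Q ..
  interpret BQf: finite_measure "?B \<Otimes>\<^sub>M ?Q" by (rule finite_measure_pair_measure[OF finQ finB])
  have "?A = (?B \<star> ?Q)"
  proof (rule finite_measure_eq_of_fourier_eq[OF finA convolution_finite[OF finB finQ]])
    fix \<xi> :: real
    let ?z = "Complex 1 (- \<xi>)"
    have ez: "exp (- (?z * of_real x)) = of_real (exp (- x)) * iexp (\<xi> * x)" for x
      by (simp add: complex_eq_iff exp_of_real Re_exp Im_exp)
    have "(\<integral>x. iexp (\<xi> * x) \<partial>?A) = LT' ?z"
    proof -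
      have "(\<integral>x. iexp (\<xi> * x) \<partial>?A) = (\<integral>x. indicator {0..} x *\<^sub>R iexp (\<xi> * x) \<partial>?A)"
      proof (rule integral_cong_AE)
        show "AE x in ?A. iexp (\<xi> * x) = indicator {0..} x *\<^sub>R iexp (\<xi> * x)"
        proof (subst AE_density)
          have "x * exp (- x) * p x \<le> 0" if "x < 0" for x
            using that by (intro mult_nonpos_nonneg) (auto simp: mult_nonpos_nonneg)
          then have "0 < x * exp (- x) * p x \<longrightarrow> 0 \<le> x" for x by (meson not_le)
          then show "AE x in lborel. 0 < ?a x \<longrightarrow> iexp (\<xi> * x) = indicator {0..} x *\<^sub>R iexp (\<xi> * x)"
            by (intro AE_I2) (auto simp: indicator_def)
        qed simp
      qed auto
      also have "\<dots> = (\<integral>x. indicator {0..} x *\<^sub>R iexp (\<xi> * x) \<partial>density P (\<lambda>x. ennreal (indicator {0..} x * (x * exp (- x)))))"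
      proof -
        have "(\<lambda>x. ennreal (indicator {0..} x * (x * exp (- x)))) = (\<lambda>x. ennreal (x * exp (- x)))"
          by (auto simp: fun_eq_iff indicator_def ennreal_neg mult_nonpos_nonneg)
        then show ?thesis unfolding A by simp
      qed
      also have "\<dots> = (\<integral>x. (indicator {0..} x * (x * exp (- x))) *\<^sub>R (indicator {0..} x *\<^sub>R iexp (\<xi> * x)) \<partial>P)"
        by (subst integral_density) (auto simp: indicator_def)
      also have "\<dots> = LT' ?z"
        unfolding LT'_def ez by (intro Bochner_Integration.integral_cong) (auto simp: indicator_def scaleR_conv_of_real)
      finally show ?thesis .
    qed
    \<comment> \<open>The two factors are the Fourier transforms of \<open>?B\<close> and
      \<open>?Q\<close>, which identifies \<open>?A\<close> with their convolution.\<close>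
    also have "LT' ?z = (t * Phi' ?z) * LT ?z" by (rule LT'_eq) simp
    also have "t * Phi' ?z = (\<integral>s. iexp (\<xi> * s) \<partial>?B)"
    proof -
      have "(\<integral>s. iexp (\<xi> * s) \<partial>?B) = (\<integral>s. (t * (s * f s) * exp (- s)) *\<^sub>R iexp (\<xi> * s) \<partial>lborel)"
        using bnn by (subst integral_density) auto
      also have "\<dots> = t * Phi' ?z"
        unfolding Phi'_def ez integral_mult_right_zero[symmetric] scaleR_conv_of_real by (simp add: mult_ac)
      finally show ?thesis ..
    qed
    also have "LT ?z = (\<integral>x. iexp (\<xi> * x) \<partial>?Q)"
    proof -
      have "(\<integral>x. iexp (\<xi> * x) \<partial>?Q) = (\<integral>x. exp (- x) *\<^sub>R iexp (\<xi> * x) \<partial>P)"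
        unfolding Q by (subst integral_density) auto
      also have "\<dots> = LT ?z"
        unfolding LT_def ez using nonneg by (intro integral_cong_AE) (auto simp: scaleR_conv_of_real)
      finally show ?thesis ..
    qed
    also have "(\<integral>s. iexp (\<xi> * s) \<partial>?B) * (\<integral>x. iexp (\<xi> * x) \<partial>?Q) = (\<integral>s. (\<integral>x. iexp (\<xi> * s) * iexp (\<xi> * x) \<partial>?Q) \<partial>?B)"
      by simp
    also have "\<dots> = (\<integral>s. (\<integral>x. iexp (\<xi> * (s + x)) \<partial>?Q) \<partial>?B)"
      by (simp add: distrib_left exp_add)
    also have "\<dots> = (\<integral>y. iexp (\<xi> * (fst y + snd y)) \<partial>(?B \<Otimes>\<^sub>M ?Q))"
    proof (subst BQ.integral_fst'[symmetric])
      show "integrable (?B \<Otimes>\<^sub>M ?Q) (\<lambda>y. iexp (\<xi> * (fst y + snd y)))"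
        by (rule BQf.integrable_const_bound[where B=1]) auto
    qed simp
    also have "\<dots> = (\<integral>x. iexp (\<xi> * x) \<partial>(?B \<star> ?Q))"
      unfolding convolution_def by (subst integral_distr) (auto simp: case_prod_beta)
    finally show "(\<integral>x. iexp (\<xi> * x) \<partial>?A) = (\<integral>x. iexp (\<xi> * x) \<partial>(?B \<star> ?Q))" .
  qed auto
  also have "(?B \<star> ?Q) = density lborel (\<lambda>x. \<integral>\<^sup>+y. ?b (x - y) * ?q y \<partial>lborel)"
    by (rule convolution_density[OF _ _ finB finQ]) auto
  finally have "AE x in lborel. ?a x = (\<integral>\<^sup>+y. ?b (x - y) * ?q y \<partial>lborel)"
    by (intro sigma_finite_measure.density_unique[OF sigma_finite_lborel]) auto
  then show ?thesis
  proof eventually_elim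
    case (elim x)
    have "(\<integral>\<^sup>+y. ?b (x - y) * ?q y \<partial>lborel) = (\<integral>\<^sup>+y. ennreal (exp (- x)) * (ennreal (t * ((x - y) * f (x - y))) * ennreal (p y)) \<partial>lborel)"
    proof (intro nn_integral_cong)
      fix y

      have "exp (- x) = exp (- (x - y)) * exp (- y)" by (simp flip: exp_add)
      then have "t * ((x - y) * f (x - y)) * exp (- (x - y)) * (exp (- y) * p y) = exp (- x) * (t * ((x - y) * f (x - y)) * p y)"
        by (simp only: mult_ac)
      moreover have "?b (x - y) * ?q y = ennreal (t * ((x - y) * f (x - y)) * exp (- (x - y)) * (exp (- y) * p y))"
        by (rule ennreal_mult''[symmetric]) simp
      moreover have "ennreal (exp (- x)) * (ennreal (t * ((x - y) * f (x - y))) * ennreal (p y)) = ennreal (exp (- x) * (t * ((x - y) * f (x - y)) * p y))"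
        by (simp add: ennreal_mult' ennreal_mult''[of "p y"])
      ultimately show "?b (x - y) * ?q y = ennreal (exp (- x)) * (ennreal (t * ((x - y) * f (x - y))) * ennreal (p y))"
        by (simp only:)
    qed
    also have "\<dots> = ennreal (exp (- x)) * (\<integral>\<^sup>+y. ennreal (t * ((x - y) * f (x - y))) * ennreal (p y) \<partial>lborel)"
      by (rule nn_integral_cmult) measurable
    finally have "ennreal (exp x) * ?a x = ennreal (exp x) * (ennreal (exp (- x)) * (\<integral>\<^sup>+y. ennreal (t * ((x - y) * f (x - y))) * ennreal (p y) \<partial>lborel))"
      using elim by simp
    moreover have "ennreal (exp x) * ?a x = ennreal (x * p x)"
      by (simp add: exp_minus field_simps flip: ennreal_mult')
    moreover have "ennreal (exp x) * (ennreal (exp (- x)) * r) = r" for r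
      by (simp add: exp_minus flip: mult.assoc ennreal_mult)
    ultimately show ?case by simp
  qed
qed

text \<open>Quantifying \<open>m\<close> inside gives one null set for all \<open>m\<close>; in the
  application \<open>m\<close> depends on the point \<open>x\<close>.\<close>

lemma AE_lower:
  "AE x in lborel. 0 < x \<longrightarrow> (\<forall>m\<ge>0. (\<forall>s\<in>{x/2..x}. m \<le> s * f s) \<longrightarrow> t * m * prob {..x/2} \<le> x * p x)"
  using AE_size_bias
proof eventually_elim
  case (elim x)
  show ?case
  proof (intro allI impI)
    fix m assume x: "0 < x" and m: "0 \<le> m" "\<forall>s\<in>{x/2..x}. m \<le> s * f s"
    have "ennreal (t * m * prob {..x/2}) = ennreal (t * m) * emeasure P {..x/2}"
      using t_pos m by (simp add: emeasure_eq_measure ennreal_mult)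
    also have "emeasure P {..x/2} = (\<integral>\<^sup>+y. ennreal (p y) * indicator {..x/2} y \<partial>lborel)"
      by (subst P_eq) (simp add: emeasure_density)
    also have "ennreal (t * m) * \<dots> = (\<integral>\<^sup>+y. ennreal (t * m) * (ennreal (p y) * indicator {..x/2} y) \<partial>lborel)"
      by (rule nn_integral_cmult[symmetric]) measurable
    also have "\<dots> \<le> (\<integral>\<^sup>+y. ennreal (t * ((x - y) * f (x - y))) * ennreal (p y) \<partial>lborel)"
    proof (rule nn_integral_mono_AE)
      show "AE y in lborel. ennreal (t * m) * (ennreal (p y) * indicator {..x/2} y) \<le> ennreal (t * ((x - y) * f (x - y))) * ennreal (p y)"
        using AE_p_neg
      proof eventually_elim
        case (elim y)
        show ?case
        proof (cases "0 \<le> y \<and> y \<le> x / 2")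
          case True
          then have "x - y \<in> {x/2..x}" by auto
          with m have "t * m \<le> t * ((x - y) * f (x - y))" using t_pos by (intro mult_left_mono) auto
          then show ?thesis using True by (auto intro!: mult_right_mono ennreal_leI)
        qed (use elim in \<open>auto simp: indicator_def not_le\<close>)
      qed
    qed
    also have "\<dots> = ennreal (x * p x)" using elim by simp
    finally have "ennreal (t * m * prob {..x/2}) \<le> ennreal (x * p x)" .
    moreover have "0 \<le> x * p x" using x by simp
    ultimately show "t * m * prob {..x/2} \<le> x * p x" by (simp only: ennreal_le_iff)
  qed
qed

text \<open>The size bias integral is split at \<open>y = x / 2\<close>. Below, the jump
  \<open>x - y\<close> is at least \<open>x / 2\<close> and the total is at most
  \<open>t * D\<close>; above, \<open>p\<close> is at most \<open>B\<close> and the jumps carry the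
  truncated first moment. Again \<open>B\<close> and \<open>D\<close> vary with \<open>x\<close>, so
  they are quantified inside.\<close>

lemma AE_upper:
  "AE x in lborel. 0 < x \<longrightarrow> (\<forall>B\<ge>0. \<forall>D\<ge>0. (\<forall>y\<in>{x/2..x}. p y \<le> B) \<longrightarrow> (\<forall>s\<in>{x/2..x}. s * f s \<le> D) \<longrightarrow>
     x * p x \<le> t * D + t * B * (exp 1 * (x * phi (1 / x))))"
  using AE_size_bias
proof eventually_elim
  case (elim x)
  show ?case
  proof (intro allI impI)
    fix B D assume x: "0 < x" and B: "0 \<le> B" "\<forall>y\<in>{x/2..x}. p y \<le> B" and D: "0 \<le> D" "\<forall>s\<in>{x/2..x}. s * f s \<le> D"
    have nn: "0 \<le> t * D" "0 \<le> t * B" "0 \<le> exp 1 * (x * phi (1 / x))"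
      using t_pos B(1) D(1) x phi_pos[of "1 / x"] by auto
    have "ennreal (x * p x) = (\<integral>\<^sup>+y. ennreal (t * ((x - y) * f (x - y))) * ennreal (p y) \<partial>lborel)" by (rule elim)
    also have "\<dots> \<le> (\<integral>\<^sup>+y. ennreal (t * D) * ennreal (p y) + ennreal (t * B) * (ennreal ((x - y) * f (x - y)) * indicator {..x} (x - y)) \<partial>lborel)"
    proof (rule nn_integral_mono_AE)
      show "AE y in lborel. ennreal (t * ((x - y) * f (x - y))) * ennreal (p y) \<le>
          ennreal (t * D) * ennreal (p y) + ennreal (t * B) * (ennreal ((x - y) * f (x - y)) * indicator {..x} (x - y))"
        using AE_p_neg
      proof eventually_elim
        case (elim y)
        consider "y < 0" | "0 \<le> y" "y < x / 2" | "x / 2 \<le> y" "y \<le> x" | "x < y" by linarith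
        then show ?case
        proof cases
          case 2
          then have "x - y \<in> {x/2..x}" by auto
          with D have "t * ((x - y) * f (x - y)) \<le> t * D" using t_pos by (intro mult_left_mono) auto
          then show ?thesis by (intro add_increasing2) (auto intro!: mult_right_mono ennreal_leI)
        next
          case 3
          then have nn: "0 \<le> (x - y) * f (x - y)" by simp
          have "(t * ((x - y) * f (x - y))) * p y \<le> (t * ((x - y) * f (x - y))) * B"
            using 3 B t_pos nn by (intro mult_left_mono) auto
          also have "\<dots> = t * B * ((x - y) * f (x - y))" by simp
          finally have "ennreal (t * ((x - y) * f (x - y))) * ennreal (p y) \<le> ennreal (t * B) * ennreal ((x - y) * f (x - y))"
            using t_pos nn B by (simp add: ennreal_leI flip: ennreal_mult)
          then show ?thesis using 3 x by (intro add_increasing) auto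
        qed (use elim in auto)
      qed
    qed
    also have "\<dots> = ennreal (t * D) * (\<integral>\<^sup>+y. ennreal (p y) \<partial>lborel) + ennreal (t * B) * (\<integral>\<^sup>+y. ennreal ((x - y) * f (x - y)) * indicator {..x} (x - y) \<partial>lborel)"
      by (subst nn_integral_add) (auto simp: nn_integral_cmult)
    also have "(\<integral>\<^sup>+y. ennreal ((x - y) * f (x - y)) * indicator {..x} (x - y) \<partial>lborel) = (\<integral>\<^sup>+s. ennreal (s * f s) * indicator {..x} s \<partial>lborel)"
      by (subst nn_integral_real_affine[where c="-1" and t=x]) auto
    also have "\<dots> \<le> ennreal (exp 1 * (x * phi (1 / x)))" using x by (rule nn_integral_less_le)
    finally have "ennreal (x * p x) \<le> ennreal (t * D) + ennreal (t * B) * ennreal (exp 1 * (x * phi (1 / x)))"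
      by (simp add: nn_integral_p mult_left_mono add_left_mono)
    also have "\<dots> = ennreal (t * D + t * B * (exp 1 * (x * phi (1 / x))))"
      unfolding ennreal_mult[OF nn(2,3), symmetric]
      by (rule ennreal_plus[OF nn(1) mult_nonneg_nonneg[OF nn(2,3)], symmetric])
    finally show "x * p x \<le> t * D + t * B * (exp 1 * (x * phi (1 / x)))"
      using add_nonneg_nonneg[OF nn(1) mult_nonneg_nonneg[OF nn(2,3)]] by (simp only: ennreal_le_iff)
  qed
qed

end

section \<open>Fourier upper bound\<close>

lemma has_bochner_integral_gaussian:
  fixes a :: real
  assumes "0 < a"
  shows "has_bochner_integral lborel (\<lambda>\<eta>. exp (- (a * \<eta>\<^sup>2))) (sqrt (pi / a))"
proof -
  have sq: "(1 / sqrt (2 * a))\<^sup>2 = 1 / (2 * a)" using assms by (simp add: power_divide)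
  have "exp (- (a * \<eta>\<^sup>2)) = sqrt (pi / a) * normal_density 0 (1 / sqrt (2 * a)) \<eta>" for \<eta>
    unfolding normal_density_def sq using assms by (simp add: real_sqrt_divide mult.commute)
  then show ?thesis
    using integral_normal_density[of "1 / sqrt (2 * a)" 0] integrable_normal_density[of "1 / sqrt (2 * a)" 0] assms
    by (simp add: has_bochner_integral_iff)
qed

lemma integrable_inverse_one_plus_square: "integrable lborel (\<lambda>\<eta>::real. 1 / (1 + \<eta>\<^sup>2))"
proof -
  have pos: "integrable lborel (\<lambda>\<eta>::real. indicator {0<..} \<eta> * (1 / (1 + \<eta>\<^sup>2)))"
    using integrable_I0i_1_div_plus_square
    by (simp add: interval_lebesgue_integrable_def set_integrable_def zero_ereal_def)
  have "integrable lborel (\<lambda>\<eta>::real. indicator {0<..} (0 + (- 1) * \<eta>) * (1 / (1 + (0 + (- 1) * \<eta>)\<^sup>2)))"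
    by (rule lborel_integrable_real_affine[OF pos]) simp
  with pos have "integrable lborel (\<lambda>\<eta>::real. indicator {0<..} \<eta> * (1 / (1 + \<eta>\<^sup>2)) + indicator {0<..} (- \<eta>) * (1 / (1 + \<eta>\<^sup>2)))"
    by (intro Bochner_Integration.integrable_add) simp_all
  then show ?thesis
    by (rule integrable_cong_AE_imp)
       (use AE_lborel_singleton[of "0::real"] in \<open>auto simp: indicator_def elim!: eventually_mono\<close>)
qed

definition cauchy_mass :: real
  where "cauchy_mass = (\<integral>\<eta>. 1 / (1 + (\<eta>::real)\<^sup>2) \<partial>lborel)"

lemma cauchy_mass_nonneg: "0 \<le> cauchy_mass"
  unfolding cauchy_mass_def by (intro Bochner_Integration.integral_nonneg) auto

lemma (in levy_density) isCont_phi: "0 < w \<Longrightarrow> isCont phi w"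
  using phi_has_derivative DERIV_isCont by blast

text \<open>The second order Taylor remainder of \<open>iexp\<close> is integrated against the
  tilted Levy density, which produces the third moment.\<close>

lemma (in levy_density) Phi_taylor:
  assumes w: "0 < w"
  shows "norm (of_real (phi w) - Phi (Complex w (- \<xi>)) - \<i> * of_real (\<xi> * mom 1 w) + of_real (\<xi>\<^sup>2 / 2 * mom 2 w))
    \<le> \<bar>\<xi>\<bar> ^ 3 / 6 * mom 3 w"
proof -
  let ?z = "Complex w (- \<xi>)"
  have ez: "exp (- (?z * of_real s)) = of_real (exp (- (w * s))) * iexp (\<xi> * s)" for s
    by (simp add: complex_eq_iff exp_of_real Re_exp Im_exp)
  let ?h = "\<lambda>s. f s *\<^sub>R (of_real (exp (- (w * s))) * (iexp (\<xi> * s) - (1 + \<i> * of_real (\<xi> * s) - of_real ((\<xi> * s)\<^sup>2 / 2))))"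
  have 0: "has_bochner_integral lborel (\<lambda>s. complex_of_real (f s * (1 - exp (- (w * s))))) (of_real (phi w))"
    unfolding phi_def using integrable_phi[of w] w
    by (intro has_bochner_integral_bounded_linear[OF bounded_linear_of_real]) (simp add: has_bochner_integral_iff)
  have z: "has_bochner_integral lborel (\<lambda>s. f s *\<^sub>R (1 - exp (- (?z * of_real s)))) (Phi ?z)"
    unfolding Phi_def using integrable_Phi[of ?z] w by (simp add: has_bochner_integral_iff)
  have k: "has_bochner_integral lborel (\<lambda>s. complex_of_real (f s * (s ^ k * exp (- (w * s))))) (of_real (mom k w))" if "k \<ge> 1" for k
    unfolding mom_def using integrable_mom[OF w that]
    by (intro has_bochner_integral_bounded_linear[OF bounded_linear_of_real]) (simp add: has_bochner_integral_iff)
  have "has_bochner_integral lborel (\<lambda>s. complex_of_real (f s * (1 - exp (- (w * s)))) - f s *\<^sub>R (1 - exp (- (?z * of_real s)))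
      - \<i> * of_real \<xi> * of_real (f s * (s ^ 1 * exp (- (w * s)))) + of_real (\<xi>\<^sup>2 / 2) * of_real (f s * (s ^ 2 * exp (- (w * s)))))
     (of_real (phi w) - Phi ?z - \<i> * of_real \<xi> * of_real (mom 1 w) + of_real (\<xi>\<^sup>2 / 2) * of_real (mom 2 w))"
    by (intro has_bochner_integral_add has_bochner_integral_diff has_bochner_integral_mult_right 0 z k) auto
  moreover have "complex_of_real (f s * (1 - exp (- (w * s)))) - f s *\<^sub>R (1 - exp (- (?z * of_real s)))
      - \<i> * of_real \<xi> * of_real (f s * (s ^ 1 * exp (- (w * s)))) + of_real (\<xi>\<^sup>2 / 2) * of_real (f s * (s ^ 2 * exp (- (w * s)))) = ?h s" for s
    unfolding ez scaleR_conv_of_real by (simp add: algebra_simps power2_eq_square)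
  ultimately have h: "has_bochner_integral lborel ?h
     (of_real (phi w) - Phi ?z - \<i> * of_real \<xi> * of_real (mom 1 w) + of_real (\<xi>\<^sup>2 / 2) * of_real (mom 2 w))"
    by simp
  have "norm (\<integral>s. ?h s \<partial>lborel) \<le> (\<integral>s. norm (?h s) \<partial>lborel)" by (rule integral_norm_bound)
  also have "\<dots> \<le> (\<integral>s. \<bar>\<xi>\<bar> ^ 3 / 6 * (f s * (s ^ 3 * exp (- (w * s)))) \<partial>lborel)"
  proof (rule integral_mono)
    show "integrable lborel (\<lambda>s. norm (?h s))" using h unfolding has_bochner_integral_iff by (intro integrable_norm) simp
    show "integrable lborel (\<lambda>s. \<bar>\<xi>\<bar> ^ 3 / 6 * (f s * (s ^ 3 * exp (- (w * s)))))"
      using w by (intro integrable_mult_right integrable_mom) auto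
    fix s :: real
    show "norm (?h s) \<le> \<bar>\<xi>\<bar> ^ 3 / 6 * (f s * (s ^ 3 * exp (- (w * s))))"
    proof (cases "0 < s")
      case True
      have "(\<Sum>k\<le>2. (\<i> * of_real (\<xi> * s)) ^ k / fact k) = 1 + \<i> * of_real (\<xi> * s) - of_real ((\<xi> * s)\<^sup>2 / 2)"
        by (simp add: numeral_2_eq_2 power_mult_distrib)
      moreover have "\<bar>\<xi> * s\<bar> ^ Suc 2 / fact (Suc 2) = \<bar>\<xi>\<bar> ^ 3 * s ^ 3 / 6"
        using True by (simp add: fact_numeral numeral_eq_Suc abs_mult power_mult_distrib)
      ultimately have "norm (iexp (\<xi> * s) - (1 + \<i> * of_real (\<xi> * s) - of_real ((\<xi> * s)\<^sup>2 / 2))) \<le> \<bar>\<xi>\<bar> ^ 3 * s ^ 3 / 6"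
        using iexp_approx1[of "\<xi> * s" 2] by metis
      then have "f s * (exp (- (w * s)) * norm (iexp (\<xi> * s) - (1 + \<i> * of_real (\<xi> * s) - of_real ((\<xi> * s)\<^sup>2 / 2))))
         \<le> f s * (exp (- (w * s)) * (\<bar>\<xi>\<bar> ^ 3 * s ^ 3 / 6))"
        by (intro mult_left_mono) auto
      then show ?thesis by (simp only: norm_scaleR norm_mult norm_of_real abs_exp_cancel) (simp add: mult_ac)
    qed simp
  qed
  also have "\<dots> = \<bar>\<xi>\<bar> ^ 3 / 6 * mom 3 w" unfolding mom_def by simp
  finally show ?thesis using h by (simp add: has_bochner_integral_iff mult.assoc)
qed

text \<open>\<open>phi\<close> tends to \<open>0\<close> at \<open>0\<close> by dominated
  convergence. Together with \<open>ex_phi_ge\<close> this makes every \<open>1 / t\<close> a value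
  of \<open>phi\<close>.\<close>

lemma (in levy_density) ex_phi_le:
  assumes "0 < y"
  shows "\<exists>v>0. phi v \<le> y"
proof -
  have "(\<lambda>n. \<integral>s. f s * (1 - exp (- (1 / real (Suc n) * s))) \<partial>lborel) \<longlonglongrightarrow> (\<integral>s. (0::real) \<partial>(lborel::real measure))"
  proof (rule integral_dominated_convergence[where w="\<lambda>s. f s * (1 - exp (- (1 * s)))"])
    show "AE s in lborel. (\<lambda>n. f s * (1 - exp (- (1 / real (Suc n) * s)))) \<longlonglongrightarrow> 0"
    proof (rule AE_I2)
      fix s :: real
      have "(\<lambda>n. 1 / real (Suc n)) \<longlonglongrightarrow> 0" by (rule LIMSEQ_Suc[OF lim_1_over_n])
      then have "(\<lambda>n. f s * (1 - exp (- (1 / real (Suc n) * s)))) \<longlonglongrightarrow> f s * (1 - exp (- (0 * s)))"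
        by (intro tendsto_intros)
      then show "(\<lambda>n. f s * (1 - exp (- (1 / real (Suc n) * s)))) \<longlonglongrightarrow> 0" by simp
    qed
    show "AE s in lborel. norm (f s * (1 - exp (- (1 / real (Suc n) * s)))) \<le> f s * (1 - exp (- (1 * s)))" for n
    proof (rule AE_I2)
      fix s :: real
      show "norm (f s * (1 - exp (- (1 / real (Suc n) * s)))) \<le> f s * (1 - exp (- (1 * s)))"
      proof (cases "0 < s")
        case True
        have "1 / real (Suc n) * s \<le> 1 * s" using True by (intro mult_right_mono) auto
        then have "1 - exp (- (1 / real (Suc n) * s)) \<le> 1 - exp (- (1 * s))" by (simp only: diff_left_mono exp_le_cancel_iff neg_le_iff_le)
        moreover have "0 \<le> 1 - exp (- (1 / real (Suc n) * s))" using True by simp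
        ultimately show ?thesis by (simp add: abs_mult mult_left_mono)
      qed simp
    qed
  qed (use integrable_phi[of 1] in auto)
  then have "(\<lambda>n. phi (1 / real (Suc n))) \<longlonglongrightarrow> 0" by (simp add: phi_def)
  then have "\<forall>\<^sub>F n in sequentially. phi (1 / real (Suc n)) < y" using assms by (rule order_tendstoD)
  then obtain n where "phi (1 / real (Suc n)) < y" by (auto dest: eventually_happens)
  then show ?thesis by (intro exI[of _ "1 / real (Suc n)"]) auto
qed

context scaled_levy_density
begin

text \<open>The lower scaling condition makes \<open>phi\<close> unbounded; it is started at
  \<open>x0 + 1\<close> because it applies only above \<open>x0\<close>.\<close>

lemma ex_phi_ge:
  assumes "0 < y"
  shows "\<exists>v>0. y \<le> phi v"
proof -
  define l where "l = max 1 ((y / (c * phi (x0 + 1))) powr (1 / \<alpha>))"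
  have pp: "0 < phi (x0 + 1)" using x0 by (intro phi_pos) simp
  have "y / (c * phi (x0 + 1)) = ((y / (c * phi (x0 + 1))) powr (1 / \<alpha>)) powr \<alpha>"
    using assms c pp \<alpha> by (simp add: powr_powr)
  also have "\<dots> \<le> l powr \<alpha>" using \<alpha> by (intro powr_mono2) (auto simp: l_def)
  finally have "y \<le> c * l powr \<alpha> * phi (x0 + 1)" using c pp by (simp add: field_simps)
  also have "\<dots> \<le> phi (l * (x0 + 1))" by (rule lower) (auto simp: l_def)
  finally show ?thesis using x0 by (intro exI[of _ "l * (x0 + 1)"]) (auto simp: l_def)
qed

lemma phi_surj:
  assumes "0 < y"
  obtains u where "0 < u" "phi u = y"
proof -
  obtain v1 v2 where v: "0 < v1" "phi v1 \<le> y" "0 < v2" "y \<le> phi v2"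
    using ex_phi_le[OF assms] ex_phi_ge[OF assms] by auto
  then have "v1 \<le> v2" using phi_le_cancel[of v1 v2] by simp
  moreover have "\<forall>x. v1 \<le> x \<and> x \<le> v2 \<longrightarrow> isCont phi x" using v isCont_phi by auto
  ultimately obtain u where "v1 \<le> u" "phi u = y" using IVT[of phi v1 y v2] v by auto
  with v show thesis by (intro that[of u]) auto
qed

text \<open>\<open>n\<close> is at least \<open>2 / \<alpha>\<close>, so
  \<open>ker \<eta> ^ n\<close> is at least \<open>\<eta>\<^sup>2\<close> and the exponential falls
  below an integrable Cauchy tail. One factor \<open>y\<close> is kept for the decay
  \<open>1 / y\<close>, the other \<open>n - 1\<close> are replaced by \<open>y0\<close>.\<close>

lemma exp_ker_tail_le:
  assumes "0 < k" "0 < y0"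
  obtains D where "0 < D" "\<And>y \<eta>. y0 \<le> y \<Longrightarrow> 1 < \<bar>\<eta>\<bar> \<Longrightarrow> exp (- (k * y * ker \<eta>)) \<le> D / y * (1 / (1 + \<eta>\<^sup>2))"
proof -
  define n where "n = nat \<lceil>2 / \<alpha>\<rceil>"
  have n: "2 \<le> \<alpha> * real n"
    using \<alpha> real_nat_ceiling_ge[of "2 / \<alpha>"] unfolding n_def[symmetric] by (simp add: field_simps)
  then have n1: "1 \<le> n" using \<alpha> by (cases n) auto
  define D where "D = 2 * fact n / (k ^ n * y0 ^ (n - 1))"
  have "exp (- (k * y * ker \<eta>)) \<le> D / y * (1 / (1 + \<eta>\<^sup>2))" if y: "y0 \<le> y" and \<eta>: "1 < \<bar>\<eta>\<bar>" for y \<eta>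
  proof -
    have y_pos: "0 < y" using y assms by simp
    define z where "z = k * y * ker \<eta>"
    have "0 < ker \<eta>" using \<eta> by (auto simp: ker_def)
    then have z: "0 < z" using assms y_pos by (simp add: z_def)
    have "z ^ n * exp (- (1 * z)) \<le> fact n / 1 ^ n" using z by (intro power_times_exp_minus_le_const) auto
    then have "z ^ n * exp (- z) \<le> fact n" by simp
    moreover have "k ^ n * y0 ^ (n - 1) * y * \<eta>\<^sup>2 \<le> z ^ n"
    proof -
      have "(ker \<eta>) ^ n = \<bar>\<eta>\<bar> powr (\<alpha> * real n)"
        using \<eta> by (simp add: ker_def powr_power mult.commute)
      moreover have "\<bar>\<eta>\<bar> powr 2 \<le> \<bar>\<eta>\<bar> powr (\<alpha> * real n)" using n \<eta> by (intro powr_mono) auto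
      ultimately have 1: "\<eta>\<^sup>2 \<le> (ker \<eta>) ^ n" using \<eta> by (simp add: powr_numeral)
      have "y0 ^ (n - 1) * y \<le> y ^ (n - 1) * y" using y assms by (intro mult_right_mono power_mono) auto
      also have "\<dots> = y ^ n" using n1 by (cases n) auto
      finally have "k ^ n * (y0 ^ (n - 1) * y) * \<eta>\<^sup>2 \<le> k ^ n * y ^ n * (ker \<eta>) ^ n"
        using 1 assms y_pos by (intro mult_mono mult_left_mono) auto
      then show ?thesis by (simp add: z_def power_mult_distrib mult.assoc)
    qed
    ultimately have "k ^ n * y0 ^ (n - 1) * y * \<eta>\<^sup>2 * exp (- z) \<le> fact n"
      by (meson exp_ge_zero mult_right_mono order_trans)
    then have "exp (- z) \<le> fact n / (k ^ n * y0 ^ (n - 1)) / y * (1 / \<eta>\<^sup>2)"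
      using assms y_pos \<eta> by (simp add: field_simps)
    also have "1 / \<eta>\<^sup>2 \<le> 2 / (1 + \<eta>\<^sup>2)"
    proof -
      have "1\<^sup>2 \<le> \<bar>\<eta>\<bar>\<^sup>2" using \<eta> by (intro power_mono) auto
      then have "1 \<le> \<eta>\<^sup>2" by simp
      then have "2 / (\<eta>\<^sup>2 + \<eta>\<^sup>2) \<le> 2 / (1 + \<eta>\<^sup>2)" by (intro divide_left_mono mult_pos_pos) auto
      then show ?thesis by simp
    qed
    then have "fact n / (k ^ n * y0 ^ (n - 1)) / y * (1 / \<eta>\<^sup>2) \<le> fact n / (k ^ n * y0 ^ (n - 1)) / y * (2 / (1 + \<eta>\<^sup>2))"
      using assms y_pos by (intro mult_left_mono) auto
    also have "\<dots> = D / y * (1 / (1 + \<eta>\<^sup>2))" by (simp add: D_def)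
    finally show ?thesis by (simp add: z_def)
  qed
  moreover have "0 < D" using assms by (simp add: D_def)
  ultimately show thesis by (rule that[rotated])
qed

text \<open>After \<open>\<xi> = w * \<eta>\<close> the modulus of the characteristic function lies
  below a Gaussian of width of order \<open>1 / sqrt (t * phi w)\<close> plus a Cauchy tail of size
  \<open>1 / (t * phi w)\<close>. The point \<open>x\<close> is not tied to \<open>w\<close>:
  besides saddle points, the frequency with \<open>t * phi w = 1\<close> is used later.\<close>

lemma upper_saddle:
  assumes y0: "0 < y0"
  obtains a K where "0 < a" "a \<le> 1" "0 < K"
    "\<And>P t p w x. levy_law f P t \<Longrightarrow> 0 < w \<Longrightarrow> x0 < a * w \<Longrightarrow> y0 \<le> t * phi w \<Longrightarrow>
       integrable lborel (\<lambda>\<xi>. exp (- (t * decay w \<xi>)))"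
    "\<And>P t p w x. levy_law_density f P t p \<Longrightarrow> 0 < w \<Longrightarrow> x0 < a * w \<Longrightarrow> y0 \<le> t * phi w \<Longrightarrow>
       p x \<le> K * (exp (w * x - t * phi w) * (w / sqrt (t * phi w)))"
proof -
  obtain a c6 where a: "0 < a" "a \<le> 1" and c6: "0 < c6"
    and dec: "\<And>w \<eta>. 0 < w \<Longrightarrow> x0 < a * w \<Longrightarrow> c6 * phi w * ker \<eta> \<le> decay w (w * \<eta>)"
    by (rule decay_scaled_ge) (rule that)
  obtain D where D: "0 < D" "\<And>y \<eta>. y0 \<le> y \<Longrightarrow> 1 < \<bar>\<eta>\<bar> \<Longrightarrow> exp (- (c6 * y * ker \<eta>)) \<le> D / y * (1 / (1 + \<eta>\<^sup>2))"
    using exp_ker_tail_le[OF c6 y0] by blast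
  \<comment> \<open>For \<open>y \<ge> y0\<close> the tail \<open>D / y\<close> is at most
    \<open>D / (sqrt y0 * sqrt y)\<close>, which puts both parts on the scale
    \<open>1 / sqrt y\<close>.\<close>
  define K where "K = sqrt (pi / c6) + D * cauchy_mass / sqrt y0"
  have K: "0 < K" using c6 D cauchy_mass_nonneg y0 by (simp add: K_def add_pos_nonneg)
  have main: "integrable lborel (\<lambda>\<xi>. exp (- (t * decay w \<xi>)))"
      "(\<integral>\<xi>. exp (- (t * decay w \<xi>)) \<partial>lborel) \<le> K * (w / sqrt (t * phi w))"
    if law: "levy_law f P t" and w: "0 < w" "x0 < a * w" and y: "y0 \<le> t * phi w" for P t w
  proof -
    interpret L: levy_law f P t by (rule law)
    interpret Q: real_distribution "L.tilted w" using w by (intro L.real_distribution_tilted) simp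
    let ?y = "t * phi w"
    let ?B = "\<lambda>\<eta>. exp (- (c6 * ?y * \<eta>\<^sup>2)) + D / ?y * (1 / (1 + \<eta>\<^sup>2))"
    have y_pos: "0 < ?y" using y y0 by simp
    have [measurable]: "(\<lambda>\<xi>. exp (- (t * decay w \<xi>))) \<in> borel_measurable borel"
      using Q.char_measurable unfolding L.norm_char_tilted[OF w(1), symmetric] by measurable
    have B: "exp (- (t * decay w (w * \<eta>))) \<le> ?B \<eta>" for \<eta>
    proof -
      have "t * (c6 * phi w * ker \<eta>) \<le> t * decay w (w * \<eta>)"
        using L.t_pos by (intro mult_left_mono dec w) auto
      then have "exp (- (t * decay w (w * \<eta>))) \<le> exp (- (c6 * ?y * ker \<eta>))" by (simp add: mult_ac)
      also have "\<dots> \<le> ?B \<eta>"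
      proof (cases "\<bar>\<eta>\<bar> \<le> 1")
        case True
        then show ?thesis using D(1) y_pos by (auto simp: ker_def)
      next
        case False
        then show ?thesis using D(2)[OF y, of \<eta>] by (simp add: add_increasing)
      qed
      finally show ?thesis .
    qed
    have g: "has_bochner_integral lborel ?B (sqrt (pi / (c6 * ?y)) + D / ?y * cauchy_mass)"
      using has_bochner_integral_gaussian[of "c6 * ?y"] c6 y_pos integrable_inverse_one_plus_square
      by (intro has_bochner_integral_add has_bochner_integral_mult_right)
         (auto simp: cauchy_mass_def has_bochner_integral_iff)
    have int: "integrable lborel (\<lambda>\<eta>. exp (- (t * decay w (0 + w * \<eta>))))"
    proof (rule Bochner_Integration.integrable_bound)
      show "integrable lborel ?B" using g by (simp add: has_bochner_integral_iff)
      show "AE \<eta> in lborel. norm (exp (- (t * decay w (0 + w * \<eta>)))) \<le> norm (?B \<eta>)"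
        using B by (intro AE_I2) (simp add: order_trans[OF _ abs_ge_self])
    qed measurable
    then show "integrable lborel (\<lambda>\<xi>. exp (- (t * decay w \<xi>)))"
      using w by (subst (asm) lborel_integrable_real_affine_iff) auto
    have "(\<integral>\<xi>. exp (- (t * decay w \<xi>)) \<partial>lborel) = w * (\<integral>\<eta>. exp (- (t * decay w (0 + w * \<eta>))) \<partial>lborel)"
      using w by (subst lborel_integral_real_affine[of w _ 0]) auto
    also have "\<dots> \<le> w * (\<integral>\<eta>. ?B \<eta> \<partial>lborel)"
      using w int g B by (intro mult_left_mono integral_mono) (auto simp: has_bochner_integral_iff)
    also have "(\<integral>\<eta>. ?B \<eta> \<partial>lborel) = sqrt (pi / (c6 * ?y)) + D / ?y * cauchy_mass"
      using g by (simp add: has_bochner_integral_iff)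
    also have "\<dots> \<le> K / sqrt ?y"
    proof -
      have "D * cauchy_mass / z \<le> D * cauchy_mass / (sqrt y0 * sqrt z)" if "y0 \<le> z" for z
      proof -
        have "sqrt y0 * sqrt z \<le> sqrt z * sqrt z" using that y0 by (intro mult_right_mono) auto
        also have "\<dots> = z" using that y0 by simp
        finally show ?thesis
          using D cauchy_mass_nonneg y0 that by (intro divide_left_mono mult_nonneg_nonneg mult_pos_pos) auto
      qed
      from this[OF y] have "D * cauchy_mass / ?y \<le> D * cauchy_mass / (sqrt y0 * sqrt ?y)" .
      moreover have "sqrt (pi / (c6 * ?y)) = sqrt (pi / c6) / sqrt ?y"
        unfolding real_sqrt_divide[symmetric] by simp
      ultimately show ?thesis by (simp add: K_def add_divide_distrib)
    qed
    finally show "(\<integral>\<xi>. exp (- (t * decay w \<xi>)) \<partial>lborel) \<le> K * (w / sqrt ?y)"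
      using w by (simp add: mult.commute mult_left_mono)
  qed
  show thesis
  proof (rule that[OF a K])
    show "integrable lborel (\<lambda>\<xi>. exp (- (t * decay w \<xi>)))"
      if "levy_law f P t" "0 < w" "x0 < a * w" "y0 \<le> t * phi w" for P t w
      by (rule main(1)[OF that])
    show "p x \<le> K * (exp (w * x - t * phi w) * (w / sqrt (t * phi w)))"
      if law: "levy_law_density f P t p" and w: "0 < w" "x0 < a * w" "y0 \<le> t * phi w" for P t p w x
    proof -
      interpret L: levy_law_density f P t p by (rule law)
      interpret Q: real_distribution "L.tilted w" using w by (intro L.real_distribution_tilted) simp
      note m = main[OF L.levy_law_axioms w]
      have "L.inv_density w x \<le> (\<integral>\<xi>. exp (- (t * decay w \<xi>)) \<partial>lborel) / (2 * pi)"
        unfolding L.inv_density_def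
      proof (intro divide_right_mono integral_mono m(1))
        show b: "Re (iexp (- (\<xi> * x)) * char (L.tilted w) \<xi>) \<le> exp (- (t * decay w \<xi>))" for \<xi>
          using complex_Re_le_cmod[of "iexp (- (\<xi> * x)) * char (L.tilted w) \<xi>"] L.norm_char_tilted[OF w(1)]
          by (simp add: norm_mult)
        show "integrable lborel (\<lambda>\<xi>. Re (iexp (- (\<xi> * x)) * char (L.tilted w) \<xi>))"
        proof (rule Bochner_Integration.integrable_bound[OF m(1)])
          show "AE \<xi> in lborel. norm (Re (iexp (- (\<xi> * x)) * char (L.tilted w) \<xi>)) \<le> norm (exp (- (t * decay w \<xi>)))"
          proof (rule AE_I2)
            fix \<xi>
            show "norm (Re (iexp (- (\<xi> * x)) * char (L.tilted w) \<xi>)) \<le> norm (exp (- (t * decay w \<xi>)))"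
              using abs_Re_le_cmod[of "iexp (- (\<xi> * x)) * char (L.tilted w) \<xi>"] L.norm_char_tilted[OF w(1)]
              by (simp add: norm_mult)
          qed
        qed measurable
      qed simp
      also have "\<dots> \<le> K * (w / sqrt (t * phi w)) / (2 * pi)"
        using m(2) by (intro divide_right_mono) auto
      also have "\<dots> \<le> K * (w / sqrt (t * phi w))"
      proof -
        have "0 \<le> K * (w / sqrt (t * phi w))" using K w y0 by simp
        moreover have "1 \<le> 2 * pi" using pi_ge_two by simp
        ultimately show ?thesis by (simp add: divide_le_eq mult_le_cancel_left1 del: times_divide_eq_right)
      qed
      finally have "exp (w * x - t * phi w) * L.inv_density w x \<le> exp (w * x - t * phi w) * (K * (w / sqrt (t * phi w)))"
        by (rule mult_left_mono) simp
      then show ?thesis using L.p_eq[OF w(1) m(1), of x] by (simp only: mult_ac)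
    qed
  qed
qed

end

section \<open>Saddle point lower bound\<close>

text \<open>Applied with \<open>r = sqrt y * \<bar>\<eta>\<bar>\<close> to absorb a cubic Taylor
  error into a Gaussian weight.\<close>

lemma cube_times_exp_le:
  fixes k r :: real
  assumes "0 < k" "0 \<le> r"
  shows "r ^ 3 * exp (- (k * r\<^sup>2)) \<le> 1 + 2 / k\<^sup>2"
proof -
  have "r ^ 3 \<le> 1 + (r\<^sup>2)\<^sup>2"
  proof (cases "r \<le> 1")
    case True
    then have "r ^ 3 \<le> 1" using assms by (intro power_le_one) auto
    then show ?thesis by (simp add: add_increasing2)
  next
    case False
    then have "r ^ 3 \<le> r ^ 4" by (intro power_increasing) auto
    then show ?thesis by (simp flip: power_mult)
  qed
  then have "r ^ 3 * exp (- (k * r\<^sup>2)) \<le> (1 + (r\<^sup>2)\<^sup>2) * exp (- (k * r\<^sup>2))"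
    by (intro mult_right_mono) auto
  also have "\<dots> = exp (- (k * r\<^sup>2)) + (r\<^sup>2)\<^sup>2 * exp (- (k * r\<^sup>2))"
    by (simp add: algebra_simps)
  also have "\<dots> \<le> 1 + 2 / k\<^sup>2"
    using power_times_exp_minus_le_const[of "r\<^sup>2" k 2] assms
    by (intro add_mono) (auto simp: fact_numeral numeral_eq_Suc)
  finally show ?thesis .
qed

context scaled_levy_density
begin

lemma ker_nonneg: "0 \<le> ker \<eta>"
  by (simp add: ker_def)

lemma ker_le_square: "\<alpha> \<le> 2 \<Longrightarrow> ker \<eta> \<le> \<eta>\<^sup>2"
  using powr_mono[of \<alpha> 2 "\<bar>\<eta>\<bar>"] by (auto simp: ker_def powr_numeral)

text \<open>
  The integrand of the inversion formula at the saddle point is compared with its Gaussian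
  approximation; after rescaling by \<open>w\<close> only \<open>y = t * phi w\<close> matters, and the
  relative error is of order \<open>1 / sqrt y\<close>.
\<close>

lemma lower_saddle:
  assumes \<alpha>2: "\<alpha> \<le> 2"
  obtains a k M0 where "0 < a" "a \<le> 1" "0 < k" "0 < M0"
    "\<And>P t p w. levy_law_density f P t p \<Longrightarrow> 0 < w \<Longrightarrow> x0 < a * w \<Longrightarrow> M0 \<le> t * phi w \<Longrightarrow>
       k * (exp (w * (t * mom 1 w) - t * phi w) * (w / sqrt (t * phi w))) \<le> p (t * mom 1 w)"
proof -
  obtain a c6 where a: "0 < a" "a \<le> 1" and c6: "0 < c6"
    and dec: "\<And>w \<eta>. 0 < w \<Longrightarrow> x0 < a * w \<Longrightarrow> c6 * phi w * ker \<eta> \<le> decay w (w * \<eta>)"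
    by (rule decay_scaled_ge) (rule that)
  obtain a' where a': "0 < a'" "a' \<le> 1"
    and int: "\<And>P t w. levy_law f P t \<Longrightarrow> 0 < w \<Longrightarrow> x0 < a' * w \<Longrightarrow> 1 \<le> t * phi w \<Longrightarrow>
       integrable lborel (\<lambda>\<xi>. exp (- (t * decay w \<xi>)))"
    using upper_saddle[of 1] by (metis zero_less_one)
  obtain c2 where c2: "0 < c2" "\<And>w. x0 < w \<Longrightarrow> c2 * phi w \<le> w\<^sup>2 * mom 2 w"
    by (rule phi_le_mom_2) (rule that)
  \<comment> \<open>A common rate: the true exponent (through \<open>dec\<close>) and the quadratic
    one (through \<open>c2\<close>) both have real part at most
    \<open>- (k * y * ker \<eta>)\<close>.\<close>
  define k where "k = min c6 (c2 / 2)"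
  have k: "0 < k" "k \<le> c6" "k \<le> c2 / 2" using c6 c2 by (auto simp: k_def)
  obtain D where D: "0 < D" "\<And>y \<eta>. 1 \<le> y \<Longrightarrow> 1 < \<bar>\<eta>\<bar> \<Longrightarrow> exp (- (k * y * ker \<eta>)) \<le> D / y * (1 / (1 + \<eta>\<^sup>2))"
    using exp_ker_tail_le[OF k(1), of 1] by (metis zero_less_one)
  define E where "E = 1 + 2 / (k / 2)\<^sup>2"
  define F where "F = E * sqrt (2 * pi / k) + 2 * D * cauchy_mass"
  have E: "0 < E" by (simp add: E_def add_pos_nonneg)
  have F: "0 < F" using E k D cauchy_mass_nonneg by (simp add: F_def add_pos_nonneg)
  \<comment> \<open>The Gaussian integral is at least \<open>w * sqrt pi / sqrt y\<close> and the
    error at most \<open>w * (F / y)\<close>; above this threshold the error is at most half of the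
    main term.\<close>
  define M0 where "M0 = max 1 ((2 * F / sqrt pi)\<^sup>2)"
  have M0: "1 \<le> M0" by (simp add: M0_def)
  have "1 / (4 * sqrt pi) * (exp (w * (t * mom 1 w) - t * phi w) * (w / sqrt (t * phi w))) \<le> p (t * mom 1 w)"
    if law: "levy_law_density f P t p" and w: "0 < w" "x0 < min a a' * w" and y: "M0 \<le> t * phi w" for P t p w
  proof -
    interpret L: levy_law_density f P t p by (rule law)
    interpret Q: real_distribution "L.tilted w" using w by (intro L.real_distribution_tilted) simp
    define x where "x = t * mom 1 w"
    define y where "y = t * phi w"
    have y1: "1 \<le> y" "M0 \<le> y" using y M0 by (auto simp: y_def)
    have aw: "x0 < a * w" "x0 < a' * w"
      using w order.strict_trans2[OF w(2) mult_right_mono[of "min a a'" a w]]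
        order.strict_trans2[OF w(2) mult_right_mono[of "min a a'" a' w]] by auto
    have "a * w \<le> 1 * w" using a w by (intro mult_right_mono) auto
    with aw(1) have wx0: "x0 < w" by linarith
    have intd: "integrable lborel (\<lambda>\<xi>. exp (- (t * decay w \<xi>)))"
      using y1 by (intro int[OF L.levy_law_axioms w(1) aw(2)]) (simp add: y_def)
    let ?A = "\<lambda>\<xi>. - \<i> * of_real (\<xi> * x) + of_real (t * phi w) - t * Phi (Complex w (- \<xi>))"
    let ?B = "\<lambda>\<xi>. - (t * mom 2 w / 2 * \<xi>\<^sup>2)"
    have A: "iexp (- (\<xi> * x)) * char (L.tilted w) \<xi> = exp (?A \<xi>)" for \<xi>
      unfolding L.char_tilted[OF w(1)] exp_add[symmetric] by (simp add: algebra_simps)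
    have ReA: "Re (?A \<xi>) = - (t * decay w \<xi>)" for \<xi>
      using Re_Phi_eq[OF w(1), of "- \<xi>"] by (simp add: L.decay_minus algebra_simps)
    \<comment> \<open>At \<open>x = t * mom 1 w\<close> the term linear in \<open>\<xi>\<close>
      cancels, so only the cubic remainder separates the exponent from the quadratic one.\<close>
    have AB: "norm (?A \<xi> - of_real (?B \<xi>)) \<le> t * (\<bar>\<xi>\<bar> ^ 3 / 6 * mom 3 w)" for \<xi>
    proof -
      have "?A \<xi> - of_real (?B \<xi>) = of_real t * (of_real (phi w) - Phi (Complex w (- \<xi>)) - \<i> * of_real (\<xi> * mom 1 w) + of_real (\<xi>\<^sup>2 / 2 * mom 2 w))"
        by (simp add: x_def algebra_simps)
      then show ?thesis
        using Phi_taylor[OF w(1), of \<xi>] L.t_pos by (simp only: norm_mult norm_of_real abs_of_pos mult_left_mono less_imp_le)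
    qed
    let ?G = "\<lambda>\<eta>. E / sqrt y * exp (- (k / 2 * y * \<eta>\<^sup>2)) + 2 * (D / y * (1 / (1 + \<eta>\<^sup>2)))"
    have bound: "norm (exp (?A (w * \<eta>)) - exp (of_real (?B (w * \<eta>)))) \<le> ?G \<eta>" for \<eta>
    proof -
      have RA: "Re (?A (w * \<eta>)) \<le> - (k * y * ker \<eta>)"
      proof -
        have "k * (phi w * ker \<eta>) \<le> c6 * (phi w * ker \<eta>)"
          using k phi_pos[OF w(1)] ker_nonneg[of \<eta>] by (intro mult_right_mono) auto
        also have "\<dots> \<le> decay w (w * \<eta>)" using dec[OF w(1) aw(1), of \<eta>] by (simp add: mult.assoc)
        finally have "t * (k * (phi w * ker \<eta>)) \<le> t * decay w (w * \<eta>)" using L.t_pos by (intro mult_left_mono) auto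
        then show ?thesis unfolding ReA by (simp add: y_def mult_ac)
      qed
      have RB: "?B (w * \<eta>) \<le> - (k * y * ker \<eta>)"
      proof -
        have "k * phi w * ker \<eta> \<le> c2 / 2 * phi w * \<eta>\<^sup>2"
          using k phi_pos[OF w(1)] ker_nonneg[of \<eta>] ker_le_square[OF \<alpha>2, of \<eta>] by (intro mult_mono) auto
        also have "\<dots> \<le> w\<^sup>2 * mom 2 w / 2 * \<eta>\<^sup>2"
          using c2(2)[OF wx0] by (intro mult_right_mono) auto
        finally have "t * (k * phi w * ker \<eta>) \<le> t * (w\<^sup>2 * mom 2 w / 2 * \<eta>\<^sup>2)"
          using L.t_pos by (intro mult_left_mono) auto
        then show ?thesis by (simp add: y_def power_mult_distrib mult_ac)
      qed
      show ?thesis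
      proof (cases "\<bar>\<eta>\<bar> \<le> 1")
        case True
        then have kerq: "ker \<eta> = \<eta>\<^sup>2" by (simp add: ker_def)
        have "norm (?A (w * \<eta>) - of_real (?B (w * \<eta>))) \<le> y * \<bar>\<eta>\<bar> ^ 3"
        proof -
          have "norm (?A (w * \<eta>) - of_real (?B (w * \<eta>))) \<le> t * (\<bar>w * \<eta>\<bar> ^ 3 / 6 * mom 3 w)" by (rule AB)
          also have "\<dots> = t * (w ^ 3 * mom 3 w / 6) * \<bar>\<eta>\<bar> ^ 3" using w by (simp add: abs_mult power_mult_distrib)
          also have "\<dots> \<le> t * phi w * \<bar>\<eta>\<bar> ^ 3"
            using mom_le_phi[of w 3] w L.t_pos by (intro mult_right_mono mult_left_mono) (auto simp: fact_numeral numeral_eq_Suc)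
          finally show ?thesis by (simp add: y_def)
        qed
        then have "norm (exp (?A (w * \<eta>)) - exp (of_real (?B (w * \<eta>)))) \<le> exp (- (k * y * \<eta>\<^sup>2)) * (y * \<bar>\<eta>\<bar> ^ 3)"
          using RA RB unfolding kerq
          by (intro order_trans[OF norm_exp_diff_le[where m="- (k * y * \<eta>\<^sup>2)"]] mult_left_mono) auto
        \<comment> \<open>Half of the Gaussian weight is spent on the cubic factor, the other half
          stays for the integration; a factor \<open>1 / sqrt y\<close> is gained.\<close>
        also have "\<dots> = ((sqrt y * \<bar>\<eta>\<bar>) ^ 3 * exp (- (k / 2 * (sqrt y * \<bar>\<eta>\<bar>)\<^sup>2))) / sqrt y * exp (- (k / 2 * y * \<eta>\<^sup>2))"
        proof -
          have 1: "exp (- (k * y * \<eta>\<^sup>2)) = exp (- (k / 2 * y * \<eta>\<^sup>2)) * exp (- (k / 2 * y * \<eta>\<^sup>2))"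
            by (simp flip: exp_add)
          have 2: "k / 2 * (sqrt y * \<bar>\<eta>\<bar>)\<^sup>2 = k / 2 * y * \<eta>\<^sup>2" using y1 by (simp add: power_mult_distrib)
          have "sqrt y ^ 3 = y * sqrt y" using y1 by (simp add: power3_eq_cube)
          then have 3: "(sqrt y * \<bar>\<eta>\<bar>) ^ 3 / sqrt y = y * \<bar>\<eta>\<bar> ^ 3" using y1 by (simp add: power_mult_distrib)
          have "a * e / s * e = (e * e) * (a / s)" for a e s :: real by simp
          then show ?thesis unfolding 1 2 3[symmetric] by (simp only:)
        qed
        also have "\<dots> \<le> E / sqrt y * exp (- (k / 2 * y * \<eta>\<^sup>2))"
          unfolding E_def using k y1 by (intro mult_right_mono divide_right_mono cube_times_exp_le) auto
        also have "\<dots> \<le> ?G \<eta>" using D y1 by simp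
        finally show ?thesis .
      next
        case False
        have "norm (exp (?A (w * \<eta>)) - exp (of_real (?B (w * \<eta>)))) \<le> norm (exp (?A (w * \<eta>))) + norm (exp (complex_of_real (?B (w * \<eta>))))"
          by (rule norm_triangle_ineq4)
        also have "\<dots> = exp (Re (?A (w * \<eta>))) + exp (?B (w * \<eta>))"
          unfolding norm_exp_eq_Re by simp
        also have "\<dots> \<le> exp (- (k * y * ker \<eta>)) + exp (- (k * y * ker \<eta>))"
          using RA RB by (intro add_mono) auto
        also have "\<dots> \<le> 2 * (D / y * (1 / (1 + \<eta>\<^sup>2)))" using D(2)[OF y1(1), of \<eta>] False by simp
        also have "\<dots> \<le> ?G \<eta>" using E y1 by simp
        finally show ?thesis .
      qed
    qed
    have G: "has_bochner_integral lborel ?G (E / sqrt y * sqrt (pi / (k / 2 * y)) + 2 * (D / y * cauchy_mass))"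
      using has_bochner_integral_gaussian[of "k / 2 * y"] k y1 integrable_inverse_one_plus_square
      by (intro has_bochner_integral_add has_bochner_integral_mult_right)
         (auto simp: cauchy_mass_def has_bochner_integral_iff)
    have t2: "0 < t * mom 2 w / 2" using L.t_pos mom_pos[OF w(1), of 2] by simp
    have gB: "has_bochner_integral lborel (\<lambda>\<xi>. exp (?B \<xi>)) (sqrt (pi / (t * mom 2 w / 2)))"
      using has_bochner_integral_gaussian[OF t2] .
    have intA: "integrable lborel (\<lambda>\<xi>. Re (exp (?A \<xi>)))"
    proof (rule Bochner_Integration.integrable_bound[OF intd])
      show "(\<lambda>\<xi>. Re (exp (?A \<xi>))) \<in> borel_measurable lborel" unfolding A[symmetric] by measurable
      show "AE \<xi> in lborel. norm (Re (exp (?A \<xi>))) \<le> norm (exp (- (t * decay w \<xi>)))"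
      proof (rule AE_I2)
        fix \<xi>
        show "norm (Re (exp (?A \<xi>))) \<le> norm (exp (- (t * decay w \<xi>)))"
          using abs_Re_le_cmod[of "exp (?A \<xi>)"] unfolding norm_exp_eq_Re ReA by simp
      qed
    qed
    have "(\<integral>\<xi>. exp (?B \<xi>) - Re (exp (?A \<xi>)) \<partial>lborel) = w * (\<integral>\<eta>. exp (?B (0 + w * \<eta>)) - Re (exp (?A (0 + w * \<eta>))) \<partial>lborel)"
      using w by (subst lborel_integral_real_affine[of w _ 0]) auto
    also have "\<dots> \<le> w * (\<integral>\<eta>. ?G \<eta> \<partial>lborel)"
    proof (intro mult_left_mono integral_mono)
      show "integrable lborel ?G" using G by (simp add: has_bochner_integral_iff)
      have "integrable lborel (\<lambda>\<xi>. exp (?B \<xi>) - Re (exp (?A \<xi>)))"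
        using gB intA by (intro Bochner_Integration.integrable_diff) (auto simp: has_bochner_integral_iff)
      from lborel_integrable_real_affine[OF this, of w 0]
      show "integrable lborel (\<lambda>\<eta>. exp (?B (0 + w * \<eta>)) - Re (exp (?A (0 + w * \<eta>))))" using w by simp
      fix \<eta>
      have "Re (exp (of_real b)) = exp b" for b by (metis Re_complex_of_real exp_of_real)
      then have "exp (?B (w * \<eta>)) - Re (exp (?A (w * \<eta>))) = - Re (exp (?A (w * \<eta>)) - exp (of_real (?B (w * \<eta>))))"
        by (simp only: minus_complex.simps minus_diff_eq)
      also have "\<dots> \<le> norm (exp (?A (w * \<eta>)) - exp (of_real (?B (w * \<eta>))))"
        using abs_Re_le_cmod[of "exp (?A (w * \<eta>)) - exp (of_real (?B (w * \<eta>)))"] by linarith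
      also have "\<dots> \<le> ?G \<eta>" by (rule bound)
      finally show "exp (?B (0 + w * \<eta>)) - Re (exp (?A (0 + w * \<eta>))) \<le> ?G \<eta>" by simp
    qed (use w in auto)
    also have "(\<integral>\<eta>. ?G \<eta> \<partial>lborel) = F / y"
    proof -
      have "sqrt (pi / (k / 2 * y)) = sqrt (2 * pi / k) / sqrt y"
        unfolding real_sqrt_divide[symmetric] by (simp add: mult_ac)
      then have "E / sqrt y * sqrt (pi / (k / 2 * y)) = E * sqrt (2 * pi / k) / y" using y1 by simp
      then show ?thesis using G by (simp add: has_bochner_integral_iff F_def add_divide_distrib)
    qed
    finally have diff: "(\<integral>\<xi>. exp (?B \<xi>) - Re (exp (?A \<xi>)) \<partial>lborel) \<le> w * (F / y)" .
    have main: "w * sqrt pi / sqrt y \<le> sqrt (pi / (t * mom 2 w / 2))"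
    proof -
      have "w\<^sup>2 * (t * mom 2 w / 2) \<le> y"
        using mom_le_phi[OF w(1), of 2] L.t_pos mult_left_mono[of "w\<^sup>2 * mom 2 w" "2 * phi w" t]
        by (simp add: y_def mult_ac)
      then have "w\<^sup>2 / y \<le> 1 / (t * mom 2 w / 2)"
        using t2 y1 by (simp add: divide_simps mult_ac)
      then have "pi * (w\<^sup>2 / y) \<le> pi * (1 / (t * mom 2 w / 2))" by (intro mult_left_mono) auto
      then have "sqrt (pi * w\<^sup>2 / y) \<le> sqrt (pi / (t * mom 2 w / 2))" by simp
      moreover have "sqrt (pi * w\<^sup>2 / y) = w * sqrt pi / sqrt y"
        using w by (simp add: real_sqrt_divide real_sqrt_mult)
      ultimately show ?thesis by simp
    qed
    have "(\<integral>\<xi>. exp (?B \<xi>) - Re (exp (?A \<xi>)) \<partial>lborel) = sqrt (pi / (t * mom 2 w / 2)) - (\<integral>\<xi>. Re (exp (?A \<xi>)) \<partial>lborel)"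
      using gB intA by (subst Bochner_Integration.integral_diff) (auto simp: has_bochner_integral_iff)
    with diff main have "w * sqrt pi / sqrt y - w * (F / y) \<le> (\<integral>\<xi>. Re (exp (?A \<xi>)) \<partial>lborel)" by linarith
    moreover have "w * (F / y) \<le> w * sqrt pi / sqrt y / 2"
    proof -
      have "2 * F / sqrt pi = sqrt ((2 * F / sqrt pi)\<^sup>2)" using F by simp
      also have "\<dots> \<le> sqrt y" using y1 by (intro real_sqrt_le_mono) (simp add: M0_def)
      finally have "F \<le> sqrt pi / 2 * sqrt y" by (simp add: field_simps)
      then have "F / y \<le> sqrt pi / 2 * sqrt y / y" using y1 by (intro divide_right_mono) auto
      also have "\<dots> = sqrt pi / 2 * (sqrt y / y)" by simp
      also have "sqrt y / y = 1 / sqrt y" using y1 by (simp add: sqrt_divide_self_eq inverse_eq_divide)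
      also have "sqrt pi / 2 * (1 / sqrt y) = sqrt pi / 2 / sqrt y" by simp
      finally have "w * (F / y) \<le> w * (sqrt pi / 2 / sqrt y)" using w by (intro mult_left_mono) auto
      then show ?thesis by simp
    qed
    ultimately have "w * sqrt pi / sqrt y / 2 \<le> (\<integral>\<xi>. Re (exp (?A \<xi>)) \<partial>lborel)" by linarith
    then have "w * sqrt pi / sqrt y / 2 / (2 * pi) \<le> L.inv_density w x"
      unfolding L.inv_density_def A by (intro divide_right_mono) auto
    moreover have "w * sqrt pi / sqrt y / 2 / (2 * pi) = 1 / (4 * sqrt pi) * (w / sqrt y)"
    proof -
      have "w * sqrt pi / sqrt y / 2 / (2 * pi) = (sqrt pi / pi) * (w / sqrt y) / 4" by (simp add: mult_ac)
      also have "sqrt pi / pi = 1 / sqrt pi" by (simp add: sqrt_divide_self_eq inverse_eq_divide)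
      finally show ?thesis by simp
    qed
    ultimately have "exp (w * x - t * phi w) * (1 / (4 * sqrt pi) * (w / sqrt y)) \<le> exp (w * x - t * phi w) * L.inv_density w x"
      by (intro mult_left_mono) auto
    also have "\<dots> = p x" by (rule L.p_eq[OF w(1) intd, symmetric])
    finally show ?thesis by (simp add: x_def y_def mult_ac)
  qed
  then show thesis using a a' M0 by (intro that[of "min a a'" "1 / (4 * sqrt pi)" M0]) auto
qed

end

section \<open>Large arguments\<close>

lemma (in levy_density) phi_inverse_mono: "0 < x \<Longrightarrow> x \<le> y \<Longrightarrow> phi (1 / y) \<le> phi (1 / x)"
  by (intro phi_mono) (auto simp: frac_le)

lemma (in levy_density) continuous_on_phi_inverse:
  assumes "0 < l"
  shows "continuous_on {l..r} (\<lambda>z. phi (1 / z))"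
proof -
  have "continuous_on {0<..} phi"
    by (intro continuous_at_imp_continuous_on) (auto intro: isCont_phi)
  then have "continuous_on ((\<lambda>z. 1 / z) ` {l..r}) phi"
    by (rule continuous_on_subset) (use assms in auto)
  moreover have "continuous_on {l..r} (\<lambda>z. 1 / z)" using assms by (intro continuous_intros) auto
  ultimately show ?thesis by (rule continuous_on_compose2) auto
qed

context scaled_levy_density
begin

text \<open>
  The small ball probability only needs the Laplace transform at a large multiple \<open>A / r\<close>
  of \<open>1 / r\<close>: since \<open>\<beta> < 1\<close>, \<open>t * phi (A / r)\<close> is eventually below \<open>A / 2\<close>.
\<close>

lemma lower_large:
  assumes M: "0 < M"
  obtains a k where "0 < a" "a \<le> 1" "0 < k"
    "\<And>P t p x. levy_law_density f P t p \<Longrightarrow> 0 < x \<Longrightarrow> x0 < a / x \<Longrightarrow> t * phi (1 / x) \<le> M \<Longrightarrow>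
       k * (t * phi (1 / x) / x) \<le> p x"
proof -
  obtain a c4 where a: "0 < a" "a \<le> 1" and c4: "0 < c4"
    and fge: "\<And>x. 0 < x \<Longrightarrow> x0 < a / x \<Longrightarrow> c4 * phi (1 / x) \<le> x * f x"
    by (rule f_ge) (rule that)
  \<comment> \<open>The Laplace transform is taken at \<open>2 * A / z\<close> for the ball of
    radius \<open>z / 2\<close>: the product is exactly \<open>A\<close>, while the exponent is at
    most \<open>A / 2\<close> by this choice, so the difference \<open>\<kappa>\<close> of the two
    exponentials is positive.\<close>
  define A where "A = max 1 ((2 * C * 2 powr \<beta> * M) powr (1 / (1 - \<beta>)))"
  have A1: "1 \<le> A" by (simp add: A_def)
  have "2 * C * 2 powr \<beta> * M = ((2 * C * 2 powr \<beta> * M) powr (1 / (1 - \<beta>))) powr (1 - \<beta>)"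
    using C M \<beta> by (simp add: powr_powr)
  also have "\<dots> \<le> A powr (1 - \<beta>)" using \<beta> by (intro powr_mono2) (auto simp: A_def)
  finally have "2 * C * 2 powr \<beta> * M * A powr \<beta> \<le> A powr (1 - \<beta>) * A powr \<beta>" by (intro mult_right_mono) auto
  also have "\<dots> = A" using A1 by (simp flip: powr_add)
  finally have AM: "C * (2 * A) powr \<beta> * M \<le> A / 2" using A1 by (simp add: powr_mult mult_ac)
  define \<kappa> where "\<kappa> = exp (- (A / 2)) - exp (- A)"
  have \<kappa>: "0 < \<kappa>" using A1 by (simp add: \<kappa>_def)
  have "c4 * \<kappa> * (t * phi (1 / x) / x) \<le> p x"
    if law: "levy_law_density f P t p" and x: "0 < x" "x0 < a / x" "t * phi (1 / x) \<le> M" for P t p x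
  proof -
    interpret L: levy_law_density f P t p by (rule law)
    have ball: "\<kappa> \<le> L.prob {..z / 2}" if z: "0 < z" "x0 < a / z" "t * phi (1 / z) \<le> M" for z
    proof -
      have "a / z \<le> 1 / z" using a z by (intro divide_right_mono) auto
      then have x0z: "x0 < 1 / z" using z by linarith
      have "t * phi ((2 * A) * (1 / z)) \<le> t * (C * (2 * A) powr \<beta> * phi (1 / z))"
        using A1 L.t_pos x0z by (intro mult_left_mono upper) auto
      also have "\<dots> = C * (2 * A) powr \<beta> * (t * phi (1 / z))" by simp
      also have "\<dots> \<le> C * (2 * A) powr \<beta> * M" using C z by (intro mult_left_mono) auto
      also have "\<dots> \<le> A / 2" by (rule AM)
      finally have "exp (- (A / 2)) \<le> exp (- (t * phi (2 * A * (1 / z))))" by simp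
      moreover have "exp (- (t * phi (2 * A * (1 / z)))) - exp (- (2 * A * (1 / z) * (z / 2))) \<le> L.prob {..z / 2}"
        using A1 z by (intro L.prob_atMost_ge) auto
      moreover have "2 * A * (1 / z) * (z / 2) = A" using z by simp
      ultimately show ?thesis unfolding \<kappa>_def by (simp only:)
    qed
    \<comment> \<open>Both conditions on \<open>x\<close> persist on \<open>{x<..<d}\<close>; the
      almost everywhere bound there passes to the left end \<open>x\<close> by continuity.\<close>
    define d where "d = (if x0 = 0 then x + 1 else (x + a / x0) / 2)"
    have xd: "x < d" using x x0 by (auto simp: d_def field_simps)
    have good: "x0 < a / z" "t * phi (1 / z) \<le> M" if z: "z \<in> {x<..<d}" for z
    proof -
      show "x0 < a / z"
      proof (cases "x0 = 0")
        case True
        then show ?thesis using a z x by auto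
      next
        case False
        then have "x < a / x0" using x x0 by (simp add: field_simps)
        moreover have "(x + q) / 2 < q" if "x < q" for q using that by simp
        ultimately have "d < a / x0" using False unfolding d_def by (simp only: if_False)
        then have "z < a / x0" using z by simp
        then show ?thesis using False x0 z x by (simp add: field_simps)
      qed
      have "t * phi (1 / z) \<le> t * phi (1 / x)"
        using z x L.t_pos by (intro mult_left_mono phi_inverse_mono) auto
      with x show "t * phi (1 / z) \<le> M" by simp
    qed
    have "t * (c4 * phi (1 / x)) * \<kappa> \<le> x * p x"
    proof (rule AE_lborel_le_imp_le[where a=x and b=d and F="\<lambda>z. t * (c4 * phi (1 / z)) * \<kappa>" and G="\<lambda>z. z * p z" and x=x])
      show "continuous_on {x..d} (\<lambda>z. t * (c4 * phi (1 / z)) * \<kappa>)"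
        using x by (intro continuous_intros continuous_on_phi_inverse)
      show "continuous_on {x..d} (\<lambda>z. z * p z)"
        by (intro continuous_intros continuous_on_subset[OF L.p_cont]) auto
      show "AE z in lborel. z \<in> {x<..<d} \<longrightarrow> t * (c4 * phi (1 / z)) * \<kappa> \<le> z * p z"
        using L.AE_lower
      proof eventually_elim
        case (elim z)
        show ?case
        proof
          assume z: "z \<in> {x<..<d}"
          then have z0: "0 < z" using x by simp
          have "\<forall>s\<in>{z/2..z}. c4 * phi (1 / z) \<le> s * f s"
          proof
            fix s assume s: "s \<in> {z/2..z}"
            then have s0: "0 < s" using z0 by simp
            have "c4 * phi (1 / z) \<le> c4 * phi (1 / s)"
              using s s0 c4 by (intro mult_left_mono phi_inverse_mono) auto
            also have "a / z \<le> a / s" using s s0 a by (intro divide_left_mono) auto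
            then have "c4 * phi (1 / s) \<le> s * f s" using good(1)[OF z] by (intro fge s0) simp
            finally show "c4 * phi (1 / z) \<le> s * f s" .
          qed
          moreover have "0 \<le> c4 * phi (1 / z)" using c4 phi_pos[of "1 / z"] z0 by simp
          ultimately have "t * (c4 * phi (1 / z)) * L.prob {..z/2} \<le> z * p z" using elim z0 by blast
          moreover have "t * (c4 * phi (1 / z)) * \<kappa> \<le> t * (c4 * phi (1 / z)) * L.prob {..z/2}"
            using ball[OF z0 good[OF z]] L.t_pos c4 phi_pos[of "1 / z"] z0 by (intro mult_left_mono) auto
          ultimately show "t * (c4 * phi (1 / z)) * \<kappa> \<le> z * p z" by simp
        qed
      qed
    qed (use xd in auto)
    then show ?thesis using x by (simp add: field_simps)
  qed
  then show thesis using a c4 \<kappa> by (intro that[of a "c4 * \<kappa>"]) auto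
qed

text \<open>
  The size bias identity bounds \<open>p\<close> at \<open>x\<close> by the jump term plus a multiple
  \<open>O(t * phi (1 / x))\<close> of its values on \<open>[x / 2, x]\<close>. Where that factor is small, the maximum of
  \<open>p / g\<close>, with \<open>g z = t * phi (1 / z) / z\<close>, absorbs the second term; elsewhere
  \<open>upper_saddle\<close> applies.
\<close>

lemma upper_large:
  obtains a K where "0 < a" "a \<le> 1" "0 < K"
    "\<And>P t p x. levy_law_density f P t p \<Longrightarrow> 0 < x \<Longrightarrow> x0 < a / x \<Longrightarrow> t * phi (1 / x) \<le> 1 \<Longrightarrow>
       p x \<le> K * (t * phi (1 / x) / x)"
proof -
  obtain a K1 where a: "0 < a" "a \<le> 1" and K1: "0 < K1"
    and up: "\<And>P t p w x. levy_law_density f P t p \<Longrightarrow> 0 < w \<Longrightarrow> x0 < a * w \<Longrightarrow> 1 \<le> t * phi w \<Longrightarrow>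
       p x \<le> K1 * (exp (w * x - t * phi w) * (w / sqrt (t * phi w)))"
    using upper_saddle[of 1] by (metis zero_less_one)
  \<comment> \<open>Beyond \<open>L / u\<close> the lower scaling condition makes
    \<open>4 * exp 1 * (t * phi (1 / z))\<close> at most \<open>1 / 2\<close>. The bound
    \<open>2 \<le> L\<close> keeps \<open>z / 2\<close> above \<open>1 / u\<close>, inside the range
    of the maximum.\<close>
  define L where "L = max 2 ((8 * exp 1 / c) powr (1 / \<alpha>))"
  have L2: "2 \<le> L" by (simp add: L_def)
  have "8 * exp 1 / c = ((8 * exp 1 / c) powr (1 / \<alpha>)) powr \<alpha>" using c \<alpha> by (simp add: powr_powr)
  also have "\<dots> \<le> L powr \<alpha>" using \<alpha> by (intro powr_mono2) (auto simp: L_def)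
  finally have Lc: "8 * exp 1 \<le> c * L powr \<alpha>" using c by (simp add: field_simps)
  define K where "K = max (K1 * exp L * L\<^sup>2) (64 * exp 1 * Cd)"
  have K: "0 < K" using K1 L2 by (simp add: K_def less_max_iff_disj)
  have "p x \<le> K * (t * phi (1 / x) / x)"
    if law: "levy_law_density f P t p" and x: "0 < x" "x0 < a / x" and tx: "t * phi (1 / x) \<le> 1" for P t p x
  proof -
    interpret Law: levy_law_density f P t p by (rule law)
    have t: "0 < t" by (rule Law.t_pos)
    \<comment> \<open>\<open>1 / u\<close> is the natural length scale at time \<open>t\<close>; the
      assumption on \<open>t * phi (1 / x)\<close> says that \<open>x\<close> is not below
      it.\<close>
    obtain u where u: "0 < u" "phi u = 1 / t" using phi_surj[of "1 / t"] t by auto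
    have tu: "t * phi u = 1" using u t by simp
    have "phi (1 / x) \<le> phi u" using tx t unfolding u(2) by (simp add: pos_le_divide_eq mult.commute)
    then have xu: "1 / x \<le> u" using phi_le_cancel[of "1 / x" u] x u by simp
    have ux: "1 / u \<le> x" using xu x u by (simp add: field_simps)
    have ax1: "a / x \<le> 1 / x" using a x by (intro divide_right_mono) auto
    have au: "x0 < a * u"
    proof -
      have "a / x = a * (1 / x)" by simp
      also have "\<dots> \<le> a * u" using xu a by (intro mult_left_mono) auto
      finally show ?thesis using x by simp
    qed
    define g where "g z = t * phi (1 / z) / z" for z
    have g_pos: "0 < g z" if "0 < z" for z using that t phi_pos[of "1 / z"] by (simp add: g_def)
    have g_anti: "g z' \<le> g z" if "0 < z" "z \<le> z'" for z z'
      unfolding g_def using that t phi_inverse_mono[of z z'] phi_pos[of "1 / z"] by (intro frac_le mult_left_mono) auto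
    have g_half: "g (z / 2) \<le> 4 * g z" if z: "0 < z" for z
      using phi_mult_le[of 2 "1 / z"] z t by (simp add: g_def field_simps)
    have g_cont: "continuous_on {l..r} g" if "0 < l" for l r
      unfolding g_def using that by (intro continuous_intros continuous_on_phi_inverse) auto
    \<comment> \<open>An attained maximum \<open>B\<close> is finite, so
      \<open>B \<le> 32 * exp 1 * Cd + B / 2\<close> can be solved for \<open>B\<close>, with a
      result that does not depend on the length of the interval.\<close>
    have "\<exists>zm\<in>{1/u..x}. \<forall>z\<in>{1/u..x}. p z / g z \<le> p zm / g zm"
    proof (rule continuous_attains_sup)
      have "g z \<noteq> 0" if "z \<in> {1/u..x}" for z
        using g_pos[of z] that u less_le_trans[of 0 "1 / u" z] by auto
      then show "continuous_on {1/u..x} (\<lambda>z. p z / g z)"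
        using u by (intro continuous_on_divide g_cont continuous_on_subset[OF Law.p_cont]) auto
    qed (use ux in auto)
    then obtain zm where zm: "zm \<in> {1/u..x}" and max: "\<And>z. z \<in> {1/u..x} \<Longrightarrow> p z / g z \<le> p zm / g zm" by blast
    have u_pos: "0 < 1 / u" using u by simp
    then have zm0: "0 < zm" using zm by (simp only: atLeastAtMost_iff) linarith
    define B where "B = p zm / g zm"
    have B0: "0 \<le> B" using g_pos[OF zm0] by (simp add: B_def)
    have pB: "p z \<le> B * g z" if z: "z \<in> {1/u..x}" for z
    proof -
      have "0 < z" using z u_pos by (simp only: atLeastAtMost_iff) linarith
      with max[OF z] g_pos[of z] show ?thesis by (simp add: B_def pos_divide_le_eq)
    qed
    have "B \<le> K"
    proof (cases "zm \<le> L / u")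
      \<comment> \<open>Near the scale \<open>1 / u\<close> the Fourier bound at frequency
        \<open>u\<close> suffices, since \<open>exp (u * zm)\<close> is at most \<open>exp L\<close>
        and \<open>g\<close> is still at least of order \<open>u\<close>.\<close>
      case True
      have "p zm \<le> K1 * (exp (u * zm - t * phi u) * (u / sqrt (t * phi u)))"
        by (rule up[OF law u(1) au]) (simp add: tu)
      also have "\<dots> \<le> K1 * (exp L * u)"
      proof -
        have "u * zm \<le> L" using True u by (simp add: field_simps)
        then show ?thesis using K1 u by (simp add: tu)
      qed
      finally have pm: "p zm \<le> K1 * (exp L * u)" .
      have "u / L\<^sup>2 \<le> g (L / u)"
      proof -
        have "phi u \<le> L * phi (u / L)" using phi_mult_le[of L "u / L"] L2 u by simp
        then have "t * phi u \<le> t * (L * phi (u / L))" using t by (intro mult_left_mono) auto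
        then have "1 \<le> L * (t * phi (u / L))" using tu by (simp add: mult_ac)
        then show ?thesis using L2 u by (simp add: g_def field_simps power2_eq_square)
      qed
      also have "\<dots> \<le> g zm" using True zm0 by (rule g_anti[rotated])
      finally have gm: "u / L\<^sup>2 \<le> g zm" .
      have "B \<le> K1 * (exp L * u) / (u / L\<^sup>2)"
        unfolding B_def using pm gm u L2 K1 by (intro frac_le) auto
      also have "\<dots> = K1 * exp L * L\<^sup>2" using u by simp
      finally show ?thesis by (simp add: K_def)
    next
      case False
      let ?l = "L / u"
      have l0: "0 < ?l" using L2 u by simp
      have lx: "?l < x" using False zm by simp
      have "p zm \<le> (32 * exp 1 * Cd + B / 2) * g zm"
      proof (rule AE_lborel_le_imp_le[where a="?l" and b=x and F=p and G="\<lambda>z. (32 * exp 1 * Cd + B / 2) * g z"])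
        show "continuous_on {?l..x} p" by (rule continuous_on_subset[OF Law.p_cont]) simp
        show "continuous_on {?l..x} (\<lambda>z. (32 * exp 1 * Cd + B / 2) * g z)"
          using l0 by (intro continuous_intros g_cont)
        show "AE z in lborel. z \<in> {?l<..<x} \<longrightarrow> p z \<le> (32 * exp 1 * Cd + B / 2) * g z"
          using Law.AE_upper
        proof eventually_elim
          case (elim z)
          show ?case
          proof
            assume z: "z \<in> {?l<..<x}"
            then have z0: "0 < z" using l0 by (simp only: greaterThanLessThan_iff) linarith
            have Luz: "L \<le> u * z" using z u by (simp add: field_simps)
            have z2: "1 / u \<le> z / 2" using Luz L2 u by (simp add: field_simps)
            have 1: "\<forall>y\<in>{z/2..z}. p y \<le> 4 * B * g z"
            proof
              fix y assume y: "y \<in> {z/2..z}"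
              then have "p y \<le> B * g y" using z z2 by (intro pB) auto
              also have "\<dots> \<le> B * g (z / 2)" using y z0 B0 by (intro mult_left_mono g_anti) auto
              also have "\<dots> \<le> B * (4 * g z)" using g_half[OF z0] B0 by (intro mult_left_mono) auto
              finally show "p y \<le> 4 * B * g z" by simp
            qed
            have 2: "\<forall>s\<in>{z/2..z}. s * f s \<le> 32 * exp 1 * Cd * phi (1 / z)"
            proof
              fix s assume s: "s \<in> {z/2..z}"
              then have s0: "0 < s" using z0 by simp
              have "s * f s \<le> 16 * exp 1 * Cd * phi (1 / s)" by (rule f_le[OF s0])
              also have "phi (1 / s) \<le> phi (2 * (1 / z))" using s s0 z0 by (intro phi_mono) (auto simp: field_simps)
              also have "\<dots> \<le> 2 * phi (1 / z)" using z0 by (intro phi_mult_le) auto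
              finally show "s * f s \<le> 32 * exp 1 * Cd * phi (1 / z)" using Cd by simp
            qed
            have "0 \<le> 4 * B * g z" using B0 g_pos[OF z0] by simp
            moreover have "0 \<le> 32 * exp 1 * Cd * phi (1 / z)" using Cd phi_pos[of "1 / z"] z0 by simp
            ultimately have "z * p z \<le> t * (32 * exp 1 * Cd * phi (1 / z)) + t * (4 * B * g z) * (exp 1 * (z * phi (1 / z)))"
              using elim z0 1 2 by blast
            also have "\<dots> = z * (32 * exp 1 * Cd * g z + B * g z * (4 * exp 1 * (t * phi (1 / z))))"
              using z0 by (simp add: g_def field_simps)
            finally have pz: "p z \<le> 32 * exp 1 * Cd * g z + B * g z * (4 * exp 1 * (t * phi (1 / z)))"
              using z0 by simp
            have "4 * exp 1 * (t * phi (1 / z)) \<le> 1 / 2"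
            proof -
              have "1 / x \<le> 1 / z" using z z0 x by (intro divide_left_mono) auto
              then have xz: "x0 < 1 / z" using x ax1 by linarith
              have "c * L powr \<alpha> * phi (1 / z) \<le> c * (u * z) powr \<alpha> * phi (1 / z)"
                using c \<alpha> Luz L2 phi_pos[of "1 / z"] z0 by (intro mult_right_mono mult_left_mono powr_mono2) auto
              also have "\<dots> \<le> phi (u * z * (1 / z))" using Luz L2 xz by (intro lower) auto
              also have "\<dots> = phi u" using z0 by simp
              finally have "c * L powr \<alpha> * phi (1 / z) \<le> phi u" .
              moreover have "8 * exp 1 * phi (1 / z) \<le> c * L powr \<alpha> * phi (1 / z)"
                using Lc phi_pos[of "1 / z"] z0 by (intro mult_right_mono) auto
              ultimately have "8 * exp 1 * phi (1 / z) \<le> phi u" by linarith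
              then have "t * (8 * exp 1 * phi (1 / z)) \<le> t * phi u" using t by (intro mult_left_mono) auto
              moreover have "t * (8 * exp 1 * phi (1 / z)) = 2 * (4 * exp 1 * (t * phi (1 / z)))" by simp
              ultimately show ?thesis using tu by linarith
            qed
            then have "B * g z * (4 * exp 1 * (t * phi (1 / z))) \<le> B * g z * (1 / 2)"
              using B0 g_pos[OF z0] by (intro mult_left_mono) auto
            with pz show "p z \<le> (32 * exp 1 * Cd + B / 2) * g z" by (simp add: algebra_simps)
          qed
        qed
      qed (use lx zm False in auto)
      then have "p zm / g zm \<le> 32 * exp 1 * Cd + B / 2"
        using g_pos[OF zm0] by (simp add: pos_divide_le_eq)
      then have "B \<le> 32 * exp 1 * Cd + B / 2" by (fold B_def)
      then show ?thesis by (simp add: K_def)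
    qed
    have "p x \<le> B * g x" using ux by (intro pB) auto
    also have "\<dots> \<le> K * g x" using \<open>B \<le> K\<close> g_pos[of x] x by (intro mult_right_mono) auto
    finally show ?thesis by (simp add: g_def)
  qed
  then show thesis using a K by (intro that[of a K]) auto
qed

end

section \<open>Two-sided estimate\<close>

context scaled_levy_density
begin

lemma ex_levy_law_density:
  assumes law: "levy_law f P t"
  shows "\<exists>p. levy_law_density f P t p"
proof -
  interpret L: levy_law f P t by (rule law)
  obtain a where a: "0 < a" "a \<le> 1"
    and int: "\<And>P t w. levy_law f P t \<Longrightarrow> 0 < w \<Longrightarrow> x0 < a * w \<Longrightarrow> 1 \<le> t * phi w \<Longrightarrow>
       integrable lborel (\<lambda>\<xi>. exp (- (t * decay w \<xi>)))"
    using upper_saddle[of 1] by (metis zero_less_one)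
  obtain v where v: "0 < v" "1 / t \<le> phi v" using ex_phi_ge[of "1 / t"] L.t_pos by auto
  define w where "w = v + x0 / a + 1"
  have xa: "0 \<le> x0 / a" using x0 a by simp
  have w: "0 < w" "x0 < a * w" using v xa a by (auto simp: w_def distrib_left add_pos_pos)
  have "phi v \<le> phi w" using v xa by (intro phi_mono) (auto simp: w_def)
  with v have "1 / t \<le> phi w" by simp
  then have "1 \<le> t * phi w" using L.t_pos by (simp add: field_simps)
  note D = L.inv_density[OF w(1) int[OF law w this]]
  have "levy_law_density f P t (\<lambda>x. exp (w * x - t * phi w) * L.inv_density w x)"
  proof (intro levy_law_density.intro levy_law_density_axioms.intro law)
    show "continuous_on UNIV (\<lambda>x. exp (w * x - t * phi w) * L.inv_density w x)"
      by (intro continuous_intros D(2))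
  qed (use D(1) D(3) in auto)
  then show ?thesis by (intro exI[of _ "\<lambda>x. exp (w * x - t * phi w) * L.inv_density w x"])
qed

text \<open>\<open>N\<close> is chosen so that upper scaling from \<open>v = 1 / (N * x)\<close> to
  \<open>1 / x\<close> reads \<open>phi (1 / x) \<le> N * c1 * phi v\<close>, which is at most
  \<open>N * v * mom 1 v\<close>. When \<open>t * phi (1 / x) \<ge> 1\<close>, it places the saddle
  point at or above \<open>y0 / x\<close>.\<close>

lemma mom_1_ge_secant:
  obtains y0 where "0 < y0" "y0 \<le> 1" "\<And>x. 0 < x \<Longrightarrow> x0 < y0 / x \<Longrightarrow> x * phi (1 / x) \<le> mom 1 (y0 / x)"
proof -
  obtain c1 where c1: "0 < c1" "c1 \<le> 1" "\<And>w. x0 < w \<Longrightarrow> c1 * phi w \<le> w * mom 1 w"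
    by (rule phi_le_mom_1) (rule that)
  define N where "N = (C / c1) powr (1 / (1 - \<beta>))"
  have "1 \<le> C / c1" using c1 C by simp
  then have N1: "1 \<le> N" unfolding N_def using \<beta> by (intro ge_one_powr_ge_zero) auto
  have "N powr (1 - \<beta>) = C / c1" unfolding N_def using c1 C \<beta> by (simp add: powr_powr)
  moreover have "N powr \<beta> * N powr (1 - \<beta>) = N" using N1 by (simp flip: powr_add)
  ultimately have "N powr \<beta> * (C / c1) = N" by (simp only:)
  then have CN: "C * N powr \<beta> = N * c1" using c1 by (simp add: field_simps)
  have "x * phi (1 / x) \<le> mom 1 (1 / N / x)" if x: "0 < x" "x0 < 1 / N / x" for x
  proof -
    define v where "v = 1 / N / x"
    have v: "0 < v" "x0 < v" "1 / x = N * v" using x N1 by (auto simp: v_def)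
    have "phi (1 / x) \<le> C * N powr \<beta> * phi v" unfolding v(3) by (rule upper[OF N1 v(2)])
    also have "\<dots> = N * (c1 * phi v)" unfolding CN by simp
    also have "\<dots> \<le> N * (v * mom 1 v)" using c1(3)[OF v(2)] N1 by (intro mult_left_mono) auto
    also have "\<dots> = mom 1 v / x" unfolding v(3)[symmetric] mult.assoc[symmetric] by (simp flip: v(3))
    finally show ?thesis using x by (simp add: v_def field_simps)
  qed
  then show thesis using N1 by (intro that[of "1 / N"]) auto
qed

text \<open>\<open>mom 1 w\<close> is at most \<open>phi w / w\<close>, which tends to
  \<open>0\<close> at infinity because \<open>\<beta> < 1\<close>; \<open>l\<close> is taken large
  enough for the intermediate value theorem on the interval from \<open>v\<close> to
  \<open>l * v\<close>.\<close>

lemma ex_saddle: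
  assumes v: "x0 < v" and s: "0 < s" "s \<le> mom 1 v"
  shows "\<exists>w>0. mom 1 w = s"
proof -
  have v0: "0 < v" using v x0 by simp
  define q where "q = C * phi v / (v * s)"
  define l where "l = max 1 (q powr (1 / (1 - \<beta>)))"
  have l1: "1 \<le> l" by (simp add: l_def)
  have "0 < q" using C phi_pos[OF v0] v0 s by (simp add: q_def)
  then have "q = (q powr (1 / (1 - \<beta>))) powr (1 - \<beta>)"
    using \<beta> by (simp add: powr_powr)
  also have "\<dots> \<le> l powr (1 - \<beta>)" using \<beta> by (intro powr_mono2) (auto simp: l_def)
  finally have "C * phi v \<le> l powr (1 - \<beta>) * (v * s)" using v0 s by (simp add: q_def pos_divide_le_eq)
  then have "l powr \<beta> * (C * phi v) \<le> l powr \<beta> * (l powr (1 - \<beta>) * (v * s))" by (intro mult_left_mono) auto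
  also have "\<dots> = (l powr \<beta> * l powr (1 - \<beta>)) * (v * s)" by simp
  also have "l powr \<beta> * l powr (1 - \<beta>) = l" using l1 by (simp flip: powr_add)
  finally have "C * l powr \<beta> * phi v \<le> (l * v) * s" by (simp add: mult_ac)
  moreover have "(l * v) * mom 1 (l * v) \<le> phi (l * v)" using l1 v0 by (intro mom_1_le) auto
  moreover have "phi (l * v) \<le> C * l powr \<beta> * phi v" by (rule upper[OF l1 v])
  ultimately have "(l * v) * mom 1 (l * v) \<le> (l * v) * s" by linarith
  moreover have lv: "0 < l * v" using l1 v0 by simp
  ultimately have "mom 1 (l * v) \<le> s" by (rule mult_left_le_imp_le)
  moreover have "v \<le> l * v" using l1 v0 by simp
  moreover have "\<forall>x. v \<le> x \<and> x \<le> l * v \<longrightarrow> isCont (mom 1) x"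
    using v0 by (auto intro: DERIV_isCont[OF mom_has_derivative])
  ultimately obtain w where "v \<le> w" "mom 1 w = s"
    using IVT2[of "mom 1" "l * v" s v] s by auto
  with v0 show ?thesis by (intro exI[of _ w]) auto
qed

text \<open>The first branch of the final estimate, once \<open>mom 1\<close> and
  \<open>mom 2\<close> are identified with the derivatives of \<open>\<phi>\<close>.\<close>

definition saddle_form :: "real \<Rightarrow> real \<Rightarrow> real"
  where "saddle_form t w = (t * mom 2 w) powr (- (1 / 2)) * exp (- t * (phi w - w * mom 1 w))"

text \<open>Above \<open>x0\<close> the quantities \<open>w\<^sup>2 * mom 2 w\<close> and
  \<open>phi w\<close> are comparable, so the prefactor of the Fourier bounds may be exchanged for
  the one of the theorem.\<close>

lemma saddle_form_bounds:
  obtains k K where "0 < k" "0 < K"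
    "\<And>t w. 0 < t \<Longrightarrow> x0 < w \<Longrightarrow> k * saddle_form t w \<le> exp (w * (t * mom 1 w) - t * phi w) * (w / sqrt (t * phi w))"
    "\<And>t w. 0 < t \<Longrightarrow> x0 < w \<Longrightarrow> exp (w * (t * mom 1 w) - t * phi w) * (w / sqrt (t * phi w)) \<le> K * saddle_form t w"
proof -
  obtain c2 where c2: "0 < c2" "\<And>w. x0 < w \<Longrightarrow> c2 * phi w \<le> w\<^sup>2 * mom 2 w"
    by (rule phi_le_mom_2) (rule that)
  have main: "sqrt c2 * saddle_form t w \<le> exp (w * (t * mom 1 w) - t * phi w) * (w / sqrt (t * phi w)) \<and>
      exp (w * (t * mom 1 w) - t * phi w) * (w / sqrt (t * phi w)) \<le> sqrt 2 * saddle_form t w"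
    if t: "0 < t" and w: "x0 < w" for t w
  proof -
    have w0: "0 < w" using w x0 by simp
    define y where "y = t * phi w"
    define m where "m = t * mom 2 w"
    have y0: "0 < y" and m0: "0 < m" using t phi_pos[OF w0] mom_pos[OF w0, of 2] by (auto simp: y_def m_def)
    have e: "exp (- t * (phi w - w * mom 1 w)) = exp (w * (t * mom 1 w) - t * phi w)"
      by (simp add: algebra_simps)
    have p: "m powr (- (1 / 2)) = 1 / sqrt m" using m0 by (simp add: powr_minus powr_half_sqrt inverse_eq_divide)
    have wm: "w / sqrt y = sqrt (w\<^sup>2 * m / y) * (1 / sqrt m)"
      using w0 m0 y0 by (simp add: real_sqrt_divide real_sqrt_mult)
    have "t * (c2 * phi w) \<le> t * (w\<^sup>2 * mom 2 w)" using c2(2)[OF w] t by (intro mult_left_mono) auto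
    then have "c2 \<le> w\<^sup>2 * m / y" using y0 by (simp add: pos_le_divide_eq) (simp add: y_def m_def mult_ac)
    then have 1: "sqrt c2 * (1 / sqrt m) \<le> w / sqrt y" unfolding wm using m0 by (intro mult_right_mono) auto
    have "t * (w\<^sup>2 * mom 2 w) \<le> t * (2 * phi w)" using mom_le_phi[OF w0, of 2] t by (intro mult_left_mono) auto
    then have "w\<^sup>2 * m / y \<le> 2" using y0 by (simp add: pos_divide_le_eq) (simp add: y_def m_def mult_ac)
    then have 2: "w / sqrt y \<le> sqrt 2 * (1 / sqrt m)" unfolding wm using m0 by (intro mult_right_mono) auto
    have S: "saddle_form t w = 1 / sqrt m * exp (w * (t * mom 1 w) - t * phi w)"
      unfolding saddle_form_def e m_def[symmetric] p ..
    show ?thesis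
      using mult_right_mono[OF 1, of "exp (w * (t * mom 1 w) - t * phi w)"] mult_right_mono[OF 2, of "exp (w * (t * mom 1 w) - t * phi w)"]
      unfolding S y_def[symmetric] by (simp add: mult_ac)
  qed
  then show thesis using c2 by (intro that[of "sqrt c2" "sqrt 2"]) auto
qed

lemma two_sided_estimate:
  assumes \<alpha>2: "\<alpha> \<le> 2"
  obtains r K where "0 < r" "1 \<le> K"
    "\<And>t x. 0 < t \<Longrightarrow> 0 < x \<Longrightarrow> x0 < r / x \<Longrightarrow> 1 \<le> t * phi (1 / x) \<Longrightarrow> \<exists>w>0. mom 1 w = x / t"
    "\<And>P t p x w. levy_law_density f P t p \<Longrightarrow> 0 < x \<Longrightarrow> x0 < r / x \<Longrightarrow> 1 \<le> t * phi (1 / x) \<Longrightarrow>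
       0 < w \<Longrightarrow> mom 1 w = x / t \<Longrightarrow> p x \<le> K * saddle_form t w \<and> saddle_form t w \<le> K * p x"
    "\<And>P t p x. levy_law_density f P t p \<Longrightarrow> 0 < x \<Longrightarrow> x0 < r / x \<Longrightarrow> t * phi (1 / x) \<le> 1 \<Longrightarrow>
       p x \<le> K * (t * phi (1 / x) / x) \<and> t * phi (1 / x) / x \<le> K * p x"
proof -
  obtain y0 where y0: "0 < y0" "y0 \<le> 1"
    and secant: "\<And>x. 0 < x \<Longrightarrow> x0 < y0 / x \<Longrightarrow> x * phi (1 / x) \<le> mom 1 (y0 / x)"
    by (rule mom_1_ge_secant) (rule that)
  obtain c1 where c1: "0 < c1" "c1 \<le> 1" "\<And>w. x0 < w \<Longrightarrow> c1 * phi w \<le> w * mom 1 w"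
    by (rule phi_le_mom_1) (rule that)
  obtain s1 s2 where s: "0 < s1" "0 < s2"
    and S1: "\<And>t w. 0 < t \<Longrightarrow> x0 < w \<Longrightarrow> s1 * saddle_form t w \<le> exp (w * (t * mom 1 w) - t * phi w) * (w / sqrt (t * phi w))"
    and S2: "\<And>t w. 0 < t \<Longrightarrow> x0 < w \<Longrightarrow> exp (w * (t * mom 1 w) - t * phi w) * (w / sqrt (t * phi w)) \<le> s2 * saddle_form t w"
    by (rule saddle_form_bounds) (rule that)
  obtain a1 K1 where a1: "0 < a1" "a1 \<le> 1" and K1: "0 < K1"
    and up: "\<And>P t p w x. levy_law_density f P t p \<Longrightarrow> 0 < w \<Longrightarrow> x0 < a1 * w \<Longrightarrow> y0 \<le> t * phi w \<Longrightarrow>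
       p x \<le> K1 * (exp (w * x - t * phi w) * (w / sqrt (t * phi w)))"
    by (rule upper_saddle[OF y0(1)]) (rule that)
  obtain a2 k2 M0 where a2: "0 < a2" "a2 \<le> 1" and k2: "0 < k2" and M0: "0 < M0"
    and low: "\<And>P t p w. levy_law_density f P t p \<Longrightarrow> 0 < w \<Longrightarrow> x0 < a2 * w \<Longrightarrow> M0 \<le> t * phi w \<Longrightarrow>
       k2 * (exp (w * (t * mom 1 w) - t * phi w) * (w / sqrt (t * phi w))) \<le> p (t * mom 1 w)"
    by (rule lower_saddle[OF \<alpha>2]) (rule that)
  \<comment> \<open>If \<open>t * phi w < M0\<close> at the saddle point, then
    \<open>1 / x \<le> w / (c1 * y0)\<close> bounds \<open>t * phi (1 / x)\<close> by this number;
    \<open>lower_large\<close> is prepared for that range.\<close>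
  have M_pos: "0 < M0 / (c1 * y0)" using M0 c1 y0 by simp
  obtain a3 k3 where a3: "0 < a3" "a3 \<le> 1" and k3: "0 < k3"
    and lowM: "\<And>P t p x. levy_law_density f P t p \<Longrightarrow> 0 < x \<Longrightarrow> x0 < a3 / x \<Longrightarrow> t * phi (1 / x) \<le> M0 / (c1 * y0) \<Longrightarrow>
       k3 * (t * phi (1 / x) / x) \<le> p x"
    by (rule lower_large[OF M_pos]) (rule that)
  obtain a4 k4 where a4: "0 < a4" "a4 \<le> 1" and k4: "0 < k4"
    and low1: "\<And>P t p x. levy_law_density f P t p \<Longrightarrow> 0 < x \<Longrightarrow> x0 < a4 / x \<Longrightarrow> t * phi (1 / x) \<le> 1 \<Longrightarrow>
       k4 * (t * phi (1 / x) / x) \<le> p x"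
    by (rule lower_large[OF zero_less_one]) (rule that)
  obtain a5 K5 where a5: "0 < a5" "a5 \<le> 1" and K5: "0 < K5"
    and up1: "\<And>P t p x. levy_law_density f P t p \<Longrightarrow> 0 < x \<Longrightarrow> x0 < a5 / x \<Longrightarrow> t * phi (1 / x) \<le> 1 \<Longrightarrow>
       p x \<le> K5 * (t * phi (1 / x) / x)"
    by (rule upper_large) (rule that)
  define m where "m = min (min a1 a2) (min a3 (min a4 a5))"
  have m: "0 < m" "m \<le> 1" "m \<le> a1" "m \<le> a2" "m \<le> a3" "m \<le> a4" "m \<le> a5"
    using a1 a2 a3 a4 a5 by (auto simp: m_def)
  \<comment> \<open>The saddle point is only known to satisfy \<open>w \<ge> y0 / x\<close>; the
    factor \<open>y0\<close> converts a threshold on \<open>1 / x\<close> into one on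
    \<open>w\<close>.\<close>
  define r where "r = m * y0"
  have r: "0 < r" "r \<le> m" "r \<le> y0" using m y0 by (auto simp: r_def mult_le_cancel_left1 mult_le_cancel_right1)
  define k6 where "k6 = k3 * s1 * sqrt y0 / M0"
  have k6: "0 < k6" using k3 s y0 M0 by (simp add: k6_def)
  define K where "K = Max {1, K1 * s2, 1 / (k2 * s1), 1 / k6, K5, 1 / k4}"
  have K: "1 \<le> K" "K1 * s2 \<le> K" "1 / (k2 * s1) \<le> K" "1 / k6 \<le> K" "K5 \<le> K" "1 / k4 \<le> K"
    unfolding K_def by (rule Max_ge; simp)+
  have thr: "x0 < b / x" if "x0 < r / x" "0 < x" "r \<le> b" for b x :: real
  proof -
    have "r / x \<le> b / x" using that by (intro divide_right_mono) auto
    with that(1) show ?thesis by (rule order.strict_trans2)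
  qed
  have inv_le: "b \<le> K * q" if "k * b \<le> q" "0 < k" "1 / k \<le> K" "0 \<le> b" for k b q :: real
  proof -
    have "0 \<le> k * b" using that(2,4) by simp
    then have "0 \<le> q" using that(1) by linarith
    have "b = 1 / k * (k * b)" using that(2) by simp
    also have "\<dots> \<le> 1 / k * q" using that(1,2) by (intro mult_left_mono) auto
    also have "\<dots> \<le> K * q" using that(3) \<open>0 \<le> q\<close> by (rule mult_right_mono)
    finally show ?thesis .
  qed
  show thesis
  proof (rule that[OF r(1) K(1)])
    fix t x :: real assume t: "0 < t" and x: "0 < x" "x0 < r / x" and tx: "1 \<le> t * phi (1 / x)"
    have "x / t \<le> x * phi (1 / x)" using tx x t by (simp add: field_simps)
    also have "\<dots> \<le> mom 1 (y0 / x)" using thr[OF x(2,1) r(3)] x by (intro secant) auto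
    finally show "\<exists>w>0. mom 1 w = x / t"
      using thr[OF x(2,1) r(3)] x t by (intro ex_saddle[of "y0 / x"]) auto
  next
    fix P t p x w
    assume law: "levy_law_density f P t p" and x: "0 < x" "x0 < r / x" and tx: "1 \<le> t * phi (1 / x)"
      and w: "0 < w" "mom 1 w = x / t"
    interpret L: levy_law_density f P t p by (rule law)
    have t: "0 < t" by (rule L.t_pos)
    have xw: "x = t * mom 1 w" using w t by simp
    have "x / t \<le> x * phi (1 / x)" using tx x t by (simp add: field_simps)
    also have "\<dots> \<le> mom 1 (y0 / x)" using thr[OF x(2,1) r(3)] x by (intro secant) auto
    finally have wy: "y0 / x \<le> w"
      using mom_strict_antimono[of w "y0 / x" 1] w x y0 by (cases "y0 / x \<le> w") auto
    have thw: "x0 < b * w" if "m \<le> b" for b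
    proof -
      have "r / x = m * (y0 / x)" by (simp add: r_def)
      also have "\<dots> \<le> b * w" using that wy m x y0 by (intro mult_mono) auto
      finally show ?thesis using x by simp
    qed
    have wx0: "x0 < w" using thw[of 1] m by simp
    have wx: "w * x \<le> t * phi w"
      using mult_left_mono[OF mom_1_le[OF w(1)], of t] t unfolding xw by (simp add: mult_ac)
    have "y0 \<le> w * x" using wy x by (simp add: pos_divide_le_eq)
    then have yt: "y0 \<le> t * phi w" using wx by simp
    let ?E = "exp (w * (t * mom 1 w) - t * phi w) * (w / sqrt (t * phi w))"
    have S0: "0 \<le> saddle_form t w" by (simp add: saddle_form_def)
    have "p x \<le> K1 * ?E" using up[OF law w(1) thw yt, of x] m xw by simp
    also have "\<dots> \<le> K1 * (s2 * saddle_form t w)" using S2[OF t wx0] K1 by (intro mult_left_mono) auto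
    also have "\<dots> = (K1 * s2) * saddle_form t w" by simp
    also have "\<dots> \<le> K * saddle_form t w" using K S0 by (intro mult_right_mono) auto
    finally have upper: "p x \<le> K * saddle_form t w" .
    have lower: "saddle_form t w \<le> K * p x"
    proof (cases "M0 \<le> t * phi w")
      case True
      have "k2 * (s1 * saddle_form t w) \<le> k2 * ?E" using S1[OF t wx0] k2 by (intro mult_left_mono) auto
      also have "\<dots> \<le> p x" using low[OF law w(1) thw True] m xw by simp
      finally show ?thesis using K S0 k2 s by (intro inv_le[of "k2 * s1"]) (auto simp: mult.assoc)
    next
      \<comment> \<open>Here \<open>t * phi w\<close> lies between \<open>y0\<close> and
        \<open>M0\<close>, so \<open>w * x\<close> is bounded above and below. The saddle form is
        then at most of order \<open>1 / x\<close>, and the small ball bound gives at least this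
        order for \<open>p x\<close>.\<close>
      case False
      have 1: "w / M0 \<le> 1 / x" using wx False M0 x by (simp add: field_simps)
      have "c1 * y0 \<le> w * x"
      proof -
        have "c1 * y0 \<le> c1 * (t * phi w)" using yt c1 by (intro mult_left_mono) auto
        also have "\<dots> = t * (c1 * phi w)" by simp
        also have "\<dots> \<le> t * (w * mom 1 w)" using c1(3)[OF wx0] t by (intro mult_left_mono) auto
        finally show ?thesis by (simp add: xw mult_ac)
      qed
      then have "1 / x \<le> 1 / (c1 * y0) * w" using x c1 y0 by (simp add: field_simps)
      then have "phi (1 / x) \<le> phi (1 / (c1 * y0) * w)" using x by (intro phi_mono) auto
      also have "\<dots> \<le> 1 / (c1 * y0) * phi w" using c1 y0 w by (intro phi_mult_le) (auto simp: mult_le_one)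
      finally have "t * phi (1 / x) \<le> t * (1 / (c1 * y0) * phi w)" using t by (intro mult_left_mono) auto
      also have "\<dots> = t * phi w / (c1 * y0)" by simp
      also have "\<dots> \<le> M0 / (c1 * y0)" using False c1 y0 by (intro divide_right_mono) auto
      finally have pl: "k3 * (t * phi (1 / x) / x) \<le> p x"
        using thr[OF x(2,1)] r m by (intro lowM[OF law x(1)]) auto
      have "s1 * saddle_form t w \<le> ?E" by (rule S1[OF t wx0])
      also have "\<dots> \<le> 1 * (w / sqrt y0)"
        using wx w t yt y0 by (intro mult_mono divide_left_mono) (auto simp: xw mult_ac)
      finally have "s1 * saddle_form t w * sqrt y0 \<le> w" using y0 by (simp add: field_simps)
      then have "k3 / M0 * (s1 * saddle_form t w * sqrt y0) \<le> k3 / M0 * w" using k3 M0 by (intro mult_left_mono) auto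
      also have "\<dots> = k3 * (w / M0)" by simp
      also have "\<dots> \<le> k3 * (1 / x)" using 1 k3 by (intro mult_left_mono) auto
      also have "\<dots> \<le> k3 * (t * phi (1 / x) / x)" using tx k3 x by (intro mult_left_mono divide_right_mono) auto
      also have "\<dots> \<le> p x" by (rule pl)
      finally have "k6 * saddle_form t w \<le> p x" by (simp add: k6_def mult_ac)
      then show ?thesis using K S0 k6 by (intro inv_le[of k6]) auto
    qed
    from upper lower show "p x \<le> K * saddle_form t w \<and> saddle_form t w \<le> K * p x" ..
  next
    fix P t p x
    assume law: "levy_law_density f P t p" and x: "0 < x" "x0 < r / x" and tx: "t * phi (1 / x) \<le> 1"
    interpret L: levy_law_density f P t p by (rule law)
    have g0: "0 \<le> t * phi (1 / x) / x" using L.t_pos phi_pos[of "1 / x"] x by simp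
    have "p x \<le> K5 * (t * phi (1 / x) / x)" using thr[OF x(2,1)] r m by (intro up1[OF law x(1) _ tx]) auto
    also have "\<dots> \<le> K * (t * phi (1 / x) / x)" using K g0 by (intro mult_right_mono) auto
    finally have "p x \<le> K * (t * phi (1 / x) / x)" .
    moreover have "t * phi (1 / x) / x \<le> K * p x"
      using thr[OF x(2,1)] r m K g0 k4 by (intro inv_le[of k4] low1[OF law x(1) _ tx]) auto
    ultimately show "p x \<le> K * (t * phi (1 / x) / x) \<and> t * phi (1 / x) / x \<le> K * p x" ..
  qed
qed

end

section \<open>The density of the subordinator\<close>

text \<open>A nonzero value at \<open>x\<close> would keep the integrand above a positive constant
  on the whole half line beyond \<open>x\<close>.\<close>

lemma almost_increasing_integrable_imp_zero:
  assumes f: "\<And>s. 0 \<le> f s" and int: "integrable lborel (\<lambda>s. f s * min 1 s)"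
    and zero: "\<And>s. s \<le> 0 \<Longrightarrow> f s = 0"
    and c: "0 < c" "\<And>x y. 0 < x \<Longrightarrow> x \<le> y \<Longrightarrow> c * f x \<le> f y" and x: "0 < (x::real)"
  shows "f x = (0::real)"
proof (rule ccontr)
  assume "f x \<noteq> 0"
  define e where "e = c * f x * min 1 x"
  have "0 < f x" using f[of x] \<open>f x \<noteq> 0\<close> by simp
  then have e: "0 < e" using c x by (simp add: e_def)
  have "real n * e \<le> (\<integral>s. f s * min 1 s \<partial>lborel)" for n :: nat
  proof -
    have "real n * e = (\<integral>s. indicator {x..x + real n} s * e \<partial>lborel)" by simp
    also have "\<dots> \<le> (\<integral>s. f s * min 1 s \<partial>lborel)"
    proof (rule integral_mono[OF _ int])
      show "integrable lborel (\<lambda>s. indicator {x..x + real n} s * e)"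
        by (intro integrable_mult_left integrable_real_indicator) (auto simp: emeasure_lborel_Icc_eq)
      fix s :: real
      show "indicator {x..x + real n} s * e \<le> f s * min 1 s"
      proof (cases "s \<in> {x..x + real n}")
        case True
        then have "e \<le> f s * min 1 s"
          unfolding e_def using c(2)[of x s] f[of s] x by (intro mult_mono) (auto simp: min_def)
        then show ?thesis using True by simp
      next
        case False
        have "0 \<le> f s * min 1 s" using f[of s] zero[of s] by (cases "s \<le> 0") auto
        then show ?thesis using False by simp
      qed
    qed
    finally show ?thesis .
  qed
  moreover obtain n :: nat where "(\<integral>s. f s * min 1 s \<partial>lborel) < real n * e"
    using reals_Archimedean3[OF e] by blast
  ultimately show False by (meson not_le)
qed

text \<open>The density is cut off to the positive axis, where alone its values are constrained. It
  is not almost everywhere zero, since otherwise \<open>\<phi>\<close> would vanish on the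
  nonnegative axis, against the assumption on its second derivative.\<close>

lemma scaled_levy_density_of_laplace_exponent:
  assumes drift: "drift_and_levy_measure \<phi> b \<nu>"
    and phi'': "\<exists>x>0. deriv (deriv \<phi>) x \<noteq> 0"
    and scalars: "0 < c" "c \<le> 1" "1 \<le> C" "0 \<le> x0" "0 < \<alpha>" "\<beta> < 1"
    and scal: "\<phi> \<in> WLSC \<alpha> c x0 \<inter> WUSC \<beta> C x0"
    and b: "b = 0"
    and dens: "has_levy_density \<nu> \<nu>d" and mono: "almost_monotone \<nu>d"
  obtains f Cd where "scaled_levy_density f Cd \<alpha> \<beta> c C x0" "\<And>l. 0 \<le> l \<Longrightarrow> \<phi> l = levy_density.phi f l"
proof -
  define f where "f s = indicator {0<..} s *\<^sub>R \<nu>d s" for s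
  have f_meas[measurable]: "f \<in> borel_measurable borel"
    using dens unfolding has_levy_density_def set_borel_measurable_def f_def[abs_def] by simp
  have f_nonneg: "0 \<le> f s" for s using dens by (auto simp: f_def has_levy_density_def indicator_def)
  have f_zero: "f s = 0" if "s \<le> 0" for s using that by (simp add: f_def)
  have \<nu>: "\<nu> = density lborel (\<lambda>s. ennreal (f s))"
  proof -
    have "(\<lambda>x. indicator {0<..} x * ennreal (\<nu>d x)) = (\<lambda>s. ennreal (f s))"
      by (auto simp: f_def indicator_def)
    with dens show ?thesis by (simp add: has_levy_density_def)
  qed
  have min_nn: "0 \<le> f s * min 1 s" for s using f_nonneg[of s] f_zero[of s] by (cases "s \<le> 0") auto
  have f_int: "integrable lborel (\<lambda>s. f s * min 1 s)"
  proof (rule integrableI_bounded)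
    have "(\<integral>\<^sup>+s. ennreal (norm (f s * min 1 s)) \<partial>lborel) = (\<integral>\<^sup>+s. ennreal (f s) * (ennreal (min 1 s) * indicator {0<..} s) \<partial>lborel)"
    proof (intro nn_integral_cong)
      fix s :: real
      show "ennreal (norm (f s * min 1 s)) = ennreal (f s) * (ennreal (min 1 s) * indicator {0<..} s)"
        using f_nonneg[of s] f_zero[of s] min_nn[of s] by (cases "0 < s") (auto simp: ennreal_mult' abs_mult)
    qed
    also have "\<dots> = (\<integral>\<^sup>+s. ennreal (min 1 s) * indicator {0<..} s \<partial>\<nu>)"
      unfolding \<nu> by (subst nn_integral_density) auto
    also have "\<dots> < \<infinity>" using drift by (simp add: drift_and_levy_measure_def levy_measure_def)
    finally show "(\<integral>\<^sup>+s. ennreal (norm (f s * min 1 s)) \<partial>lborel) < \<infinity>" .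
  qed simp
  have \<phi>_eq: "\<phi> l = (\<integral>s. f s * (1 - exp (- (l * s))) \<partial>lborel)" if l: "0 \<le> l" for l
  proof -
    have "\<phi> l = (\<integral>s. indicator {0<..} s *\<^sub>R (1 - exp (- l * s)) \<partial>\<nu>)"
      using drift b l by (simp add: drift_and_levy_measure_def set_lebesgue_integral_def)
    also have "\<dots> = (\<integral>s. f s *\<^sub>R (indicator {0<..} s *\<^sub>R (1 - exp (- l * s))) \<partial>lborel)"
      unfolding \<nu> using f_nonneg by (subst integral_density) auto
    also have "\<dots> = (\<integral>s. f s * (1 - exp (- (l * s))) \<partial>lborel)"
      by (intro Bochner_Integration.integral_cong) (auto simp: f_def indicator_def)
    finally show ?thesis .
  qed
  have nontriv: "\<not> (AE s in lborel. f s = 0)"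
  proof
    assume ae: "AE s in lborel. f s = 0"
    have \<phi>0: "\<phi> l = 0" if "0 \<le> l" for l
      unfolding \<phi>_eq[OF that] by (rule integral_eq_zero_AE) (use ae in \<open>auto elim: eventually_mono\<close>)
    have d1: "deriv \<phi> y = 0" if y: "0 < y" for y
    proof (rule DERIV_imp_deriv)
      show "(\<phi> has_real_derivative 0) (at y)"
        by (rule has_field_derivative_transform_within_open[OF DERIV_const, of "{0<..}"]) (use y \<phi>0 in auto)
    qed
    have "deriv (deriv \<phi>) y = 0" if y: "0 < y" for y
    proof (rule DERIV_imp_deriv)
      show "(deriv \<phi> has_real_derivative 0) (at y)"
        by (rule has_field_derivative_transform_within_open[OF DERIV_const, of "{0<..}"]) (use y d1 in auto)
    qed
    with phi'' show False by auto
  qed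
  interpret levy_density f
    by unfold_locales (use f_nonneg f_zero f_int nontriv in auto)
  have \<phi>_phi: "\<phi> l = phi l" if "0 \<le> l" for l
    using \<phi>_eq[OF that] by (simp add: phi_def)
  have "\<exists>Cd\<ge>1. \<forall>x>0. \<forall>y\<ge>x. f y \<le> Cd * f x"
    using mono unfolding almost_monotone_def
  proof
    assume "almost_decreasing \<nu>d"
    then obtain Cd where "1 \<le> Cd" "\<And>x y. 0 < x \<Longrightarrow> x \<le> y \<Longrightarrow> \<nu>d y \<le> Cd * \<nu>d x"
      unfolding almost_decreasing_def by blast
    then show ?thesis by (intro exI[of _ Cd]) (auto simp: f_def)
  next
    \<comment> \<open>Integrability at infinity makes such a density vanish, so the almost
      decreasing bound holds with constant \<open>1\<close>.\<close>
    assume "almost_increasing \<nu>d"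
    then obtain ci where ci: "0 < ci" "\<And>x y. 0 < x \<Longrightarrow> x \<le> y \<Longrightarrow> ci * \<nu>d x \<le> \<nu>d y"
      unfolding almost_increasing_def by blast
    have "f x = 0" if x: "0 < x" for x
    proof (rule almost_increasing_integrable_imp_zero[OF f_nonneg f_int f_zero ci(1) _ x])
      show "ci * f x \<le> f y" if "0 < x" "x \<le> y" for x y using ci(2)[OF that] that by (simp add: f_def)
    qed
    then show ?thesis by (intro exI[of _ 1]) auto
  qed
  then obtain Cd where Cd: "1 \<le> Cd" "\<And>x y. 0 < x \<Longrightarrow> x \<le> y \<Longrightarrow> f y \<le> Cd * f x" by blast
  have "scaled_levy_density f Cd \<alpha> \<beta> c C x0"
  proof unfold_locales
    show "c * l powr \<alpha> * phi w \<le> phi (l * w)" "phi (l * w) \<le> C * l powr \<beta> * phi w" if "1 \<le> l" "x0 < w" for l w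
    proof -
      have "0 \<le> w" "0 \<le> l * w" using that scalars by auto
      then show "c * l powr \<alpha> * phi w \<le> phi (l * w)" "phi (l * w) \<le> C * l powr \<beta> * phi w"
        using scal that by (auto simp: WLSC_def WUSC_def \<phi>_phi[symmetric])
    qed
  qed (use Cd scalars in auto)
  then show thesis using \<phi>_phi by (rule that)
qed

theorem theorem4p17:
  fixes M :: "'w measure" and T :: "real \<Rightarrow> 'w \<Rightarrow> real"
    and \<phi> :: "real \<Rightarrow> real" and b :: real
    and \<nu> :: "real measure" and \<nu>d :: "real \<Rightarrow> real"
    and \<alpha> \<beta> c C x0 :: real
  assumes "subordinator M T"
    and "laplace_exponent M T \<phi>"
    and "drift_and_levy_measure \<phi> b \<nu>"
    and "\<exists>x>0. deriv (deriv \<phi>) x \<noteq> 0"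
    and "0 < c" and "c \<le> 1" and "1 \<le> C" and "0 \<le> x0"
    and "0 < \<alpha>" and "\<alpha> \<le> \<beta>" and "\<beta> < 1"
    and "\<phi> \<in> WLSC \<alpha> c x0 \<inter> WUSC \<beta> C x0"
    and "b = 0"
    and "has_levy_density \<nu> \<nu>d" and "almost_monotone \<nu>d"
  shows "\<exists>p :: real \<Rightarrow> real \<Rightarrow> real.
    (\<forall>t>0. continuous_density M (T t) (p t)) \<and>
    (\<exists>x1 :: ereal. 0 < x1 \<and> (x0 = 0 \<longrightarrow> x1 = \<infinity>) \<and>
      comparable_on
        {(t, x). 0 < t \<and> ereal t < 1 / ereal (varphi \<phi> x0) \<and> 0 < x \<and> ereal x < x1}
        (\<lambda>(t, x). p t x)
        (\<lambda>(t, x).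
           if 0 < x * phi_inv \<phi> (1 / t) \<and> x * phi_inv \<phi> (1 / t) \<le> 1
           then let w = dphi_inv \<phi> (x / t) in
                (t * (- deriv (deriv \<phi>) w)) powr (- (1 / 2)) *
                exp (- t * (\<phi> w - w * deriv \<phi> w))
           else t * inverse x * \<phi> (1 / x)))"
proof -
  obtain f Cd where loc: "scaled_levy_density f Cd \<alpha> \<beta> c C x0"
    and \<phi>0: "\<And>l. 0 \<le> l \<Longrightarrow> \<phi> l = levy_density.phi f l"
    using scaled_levy_density_of_laplace_exponent[OF assms(3-9,11-15)] by blast
  interpret scaled_levy_density f Cd \<alpha> \<beta> c C x0 by (rule loc)
  have \<phi>: "\<phi> l = phi l" if "0 \<le> l" for l using \<phi>0[OF that] .
  have d1: "deriv \<phi> w = mom 1 w" if w: "0 < w" for w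
  proof (rule DERIV_imp_deriv)
    show "(\<phi> has_real_derivative mom 1 w) (at w)"
      by (rule has_field_derivative_transform_within_open[OF phi_has_derivative[OF w], of "{0<..}"]) (use w \<phi> in auto)
  qed
  have d2: "deriv (deriv \<phi>) w = - mom 2 w" if w: "0 < w" for w
  proof (rule DERIV_imp_deriv)
    have "(mom 1 has_real_derivative - mom 2 w) (at w)"
      using mom_has_derivative[OF w, of 1] by (simp add: numeral_2_eq_2)
    then show "(deriv \<phi> has_real_derivative - mom 2 w) (at w)"
      by (rule has_field_derivative_transform_within_open[of _ _ _ "{0<..}"]) (use w d1 in auto)
  qed
  have levy: "levy_process M T" and inc: "AE \<omega> in M. mono_on {0..} (\<lambda>t. T t \<omega>)"
    using assms(1) by (auto simp: subordinator_def)
  interpret M: prob_space M using levy by (simp add: levy_process_def)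
  have Tm: "T t \<in> borel_measurable M" if "0 \<le> t" for t using levy that by (simp add: levy_process_def)
  have T0: "AE \<omega> in M. T 0 \<omega> = 0" using levy by (simp add: levy_process_def)
  let ?P = "\<lambda>t. distr M borel (T t)"
  have law: "levy_law f (?P t) t" if t: "0 < t" for t
  proof -
    have [measurable]: "T t \<in> borel_measurable M" using Tm t by simp
    interpret D: prob_space "?P t" by (rule M.prob_space_distr) simp
    interpret D: real_distribution "?P t" by unfold_locales auto
    show ?thesis
    proof unfold_locales
      show "AE x in ?P t. 0 \<le> x"
      proof (subst AE_distr_iff)
        show "AE \<omega> in M. 0 \<le> T t \<omega>"
          using inc T0
        proof eventually_elim
          case (elim \<omega>)
          have "T 0 \<omega> \<le> T t \<omega>" using monotone_onD[OF elim(1), of 0 t] t by simp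
          with elim(2) show ?case by simp
        qed
      qed auto
      show "(\<integral>x. exp (- (w * x)) \<partial>?P t) = exp (- (t * phi w))" if "0 \<le> w" for w
        using assms(2) that t \<phi>[OF that] by (subst integral_distr) (auto simp: laplace_exponent_def)
    qed (use t in auto)
  qed
  have "\<forall>t. \<exists>q. 0 < t \<longrightarrow> levy_law_density f (?P t) t q"
    using ex_levy_law_density[OF law] by blast
  then obtain p where p: "\<And>t. 0 < t \<Longrightarrow> levy_law_density f (?P t) t (p t)" by metis
  have dens: "continuous_density M (T t) (p t)" if t: "0 < t" for t
  proof -
    interpret L: levy_law_density f "?P t" t "p t" by (rule p[OF t])
    have "distr M lborel (T t) = ?P t" by (rule distr_cong) auto
    then show ?thesis
      using L.p_cont L.P_eq Tm[of t] t by (auto simp: continuous_density_def distributed_def)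
  qed
  have "\<alpha> \<le> 2" using assms(10,11) by simp
  then obtain r K where r: "0 < r" and K: "1 \<le> K"
    and sad: "\<And>t x. 0 < t \<Longrightarrow> 0 < x \<Longrightarrow> x0 < r / x \<Longrightarrow> 1 \<le> t * phi (1 / x) \<Longrightarrow> \<exists>w>0. mom 1 w = x / t"
    and near: "\<And>P t p x w. levy_law_density f P t p \<Longrightarrow> 0 < x \<Longrightarrow> x0 < r / x \<Longrightarrow> 1 \<le> t * phi (1 / x) \<Longrightarrow>
       0 < w \<Longrightarrow> mom 1 w = x / t \<Longrightarrow> p x \<le> K * saddle_form t w \<and> saddle_form t w \<le> K * p x"
    and far: "\<And>P t p x. levy_law_density f P t p \<Longrightarrow> 0 < x \<Longrightarrow> x0 < r / x \<Longrightarrow> t * phi (1 / x) \<le> 1 \<Longrightarrow>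
       p x \<le> K * (t * phi (1 / x) / x) \<and> t * phi (1 / x) / x \<le> K * p x"
    by (rule two_sided_estimate) (rule that)
  \<comment> \<open>With this choice \<open>x < x1\<close> amounts to \<open>x0 < r / x\<close>, the
    threshold of \<open>two_sided_estimate\<close>.\<close>
  define x1 :: ereal where "x1 = (if x0 = 0 then \<infinity> else ereal (r / x0))"
  have x1: "0 < x1" "x0 = 0 \<longrightarrow> x1 = \<infinity>" using r assms(8) by (auto simp: x1_def)
  let ?G = "\<lambda>t x. if 0 < x * phi_inv \<phi> (1 / t) \<and> x * phi_inv \<phi> (1 / t) \<le> 1
           then let w = dphi_inv \<phi> (x / t) in
                (t * (- deriv (deriv \<phi>) w)) powr (- (1 / 2)) *
                exp (- t * (\<phi> w - w * deriv \<phi> w))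
           else t * inverse x * \<phi> (1 / x)"
  have main: "p t x \<le> K * ?G t x \<and> ?G t x \<le> K * p t x" if t: "0 < t" and x: "0 < x" "ereal x < x1" for t x
  proof -
    have xr: "x0 < r / x"
    proof (cases "x0 = 0")
      case True
      then show ?thesis using r x by simp
    next
      case False
      then have "x < r / x0" using x by (simp add: x1_def)
      then show ?thesis using False assms(8) x by (simp add: field_simps)
    qed
    obtain u where u: "0 < u" "phi u = 1 / t" using phi_surj[of "1 / t"] t by auto
    have "inj_on \<phi> {0..}"
    proof (rule inj_onI)
      fix v w assume "v \<in> {0..}" "w \<in> {0..}" "\<phi> v = \<phi> w"
      then show "v = w" using phi_le_cancel[of v w] phi_le_cancel[of w v] \<phi> by auto
    qed
    then have inv: "phi_inv \<phi> (1 / t) = u"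
      unfolding phi_inv_def using u \<phi> by (intro the_inv_into_f_eq) auto
    \<comment> \<open>Strict monotonicity of \<open>phi\<close> turns the case distinction of the
      theorem into the one of \<open>two_sided_estimate\<close>.\<close>
    have "x * u \<le> 1 \<longleftrightarrow> u \<le> 1 / x" using x by (simp add: field_simps)
    also have "\<dots> \<longleftrightarrow> phi u \<le> phi (1 / x)" using u x by (intro phi_le_cancel[symmetric]) auto
    also have "\<dots> \<longleftrightarrow> 1 \<le> t * phi (1 / x)" unfolding u(2) using t by (simp add: pos_divide_le_eq mult.commute)
    finally have region: "x * u \<le> 1 \<longleftrightarrow> 1 \<le> t * phi (1 / x)" .
    show ?thesis
    proof (cases "1 \<le> t * phi (1 / x)")
      case True
      obtain w where w: "0 < w" "mom 1 w = x / t" using sad[OF t x(1) xr True] by blast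
      have "inj_on (deriv \<phi>) {0<..}"
      proof (rule inj_onI)
        fix v w assume "v \<in> {0<..}" "w \<in> {0<..}" "deriv \<phi> v = deriv \<phi> w"
        then show "v = w"
          using mom_strict_antimono[of v w 1] mom_strict_antimono[of w v 1] d1[of v] d1[of w]
          by (cases v w rule: linorder_cases) auto
      qed
      then have dinv: "dphi_inv \<phi> (x / t) = w"
        unfolding dphi_inv_def using w d1 by (intro the_inv_into_f_eq) auto
      have "0 < x * u" "x * u \<le> 1" using region True u x by auto
      then have "?G t x = saddle_form t w"
        unfolding inv dinv Let_def saddle_form_def d2[OF w(1)] d1[OF w(1)] \<phi>[OF less_imp_le[OF w(1)]] minus_minus
        by (simp only: simp_thms if_True)
      then show ?thesis using near[OF p[OF t] x(1) xr True w] by (simp only:)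
    next
      case False
      then have "\<not> x * u \<le> 1" using region by simp
      then have "?G t x = t * inverse x * phi (1 / x)"
        unfolding inv using x \<phi>[of "1 / x"] by (simp only: simp_thms if_False) simp
      also have "\<dots> = t * phi (1 / x) / x" by (simp add: divide_inverse)
      finally have G: "?G t x = t * phi (1 / x) / x" .
      have "t * phi (1 / x) \<le> 1" using False by simp
      from far[OF p[OF t] x(1) xr this] show ?thesis by (simp only: G)
    qed
  qed
  have "comparable_on {(t, x). 0 < t \<and> ereal t < 1 / ereal (varphi \<phi> x0) \<and> 0 < x \<and> ereal x < x1}
        (\<lambda>(t, x). p t x) (\<lambda>(t, x). ?G t x)"
    unfolding comparable_on_def
  proof (intro exI[of _ K] conjI ballI K)
    fix z assume "z \<in> {(t, x). 0 < t \<and> ereal t < 1 / ereal (varphi \<phi> x0) \<and> 0 < x \<and> ereal x < x1}"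
    then obtain t x where z: "z = (t, x)" "0 < t" "0 < x" "ereal x < x1" by auto
    note m = main[OF z(2-4)]
    have "inverse K * p t x \<le> inverse K * (K * ?G t x)" using m K by (intro mult_left_mono) auto
    also have "\<dots> = ?G t x" using K by (simp only: mult.assoc[symmetric]) simp
    finally show "inverse K * (case z of (t, x) \<Rightarrow> p t x) \<le> (case z of (t, x) \<Rightarrow> ?G t x)" using z(1) by simp
    show "(case z of (t, x) \<Rightarrow> ?G t x) \<le> K * (case z of (t, x) \<Rightarrow> p t x)" using m z(1) by simp
  qed
  with x1 have "\<exists>x1 :: ereal. 0 < x1 \<and> (x0 = 0 \<longrightarrow> x1 = \<infinity>) \<and>
      comparable_on {(t, x). 0 < t \<and> ereal t < 1 / ereal (varphi \<phi> x0) \<and> 0 < x \<and> ereal x < x1}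
        (\<lambda>(t, x). p t x) (\<lambda>(t, x). ?G t x)"
    by (intro exI[of _ x1] conjI)
  with dens show ?thesis by (intro exI[of _ p] conjI allI impI)
qed

end
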